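(* Let $d>1$, let $M$ be a combinatorial $d$-manifold, let $f\colon M\to\mathbb{R}$ be a generic PL function, and let $v$ be a vertex of $M$ with $f(v)=a$. Then $v$ is strongly regular for $f$ if and only if the pair $(lk(v),\,f^{-1}(a)\cap lk(v))$ is an unknotted $(d-1,d-2)$-sphere pair.
   Context: A combinatorial $d$-manifold is a finite simplicial complex in which the link of every $k$-simplex is a combinatorial (i.e. PL) $(d-k-1)$-sphere; it is regarded as a compact PL $d$-manifold (without boundary). A function $f\colon M\to\mathbb{R}$ is generic PL if it is linear on each simplex and $f(v)\neq f(w)$ for any two distinct vertices $v,w$. A point $p$ is strongly regular for $f$ if there is a PL chart around $p$ with coordinates $x_1,\dots,x_d$ (with $p$ at the origin) in which $f(x_1,\dots,x_d)=f(p)+x_d$. $lk(v)$ denotes the link of $v$. An unknotted $(d-1,d-2)$-sphere pair is a pair consisting of a PL $(d-1)$-sphere and a PL $(d-2)$-sphere embedded in it that separates it into two PL $(d-1)$-balls (equivalently, the pair is PL homeomorphic to the standard pair). *)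

theory Defs
  imports "HOL-Analysis.Analysis"
begin

text \<open>Simplicial complexes are geometric, as in \<^theory>\<open>HOL-Analysis.Polytope\<close>: finite sets of
  simplices in a Euclidean space, closed under faces, the empty face included.  The polyhedron
  underlying \<open>M\<close> is \<open>\<Union>M\<close>, and \<open>v\<close> is a vertex iff \<open>{v} \<in> M\<close>.\<close>

definition affine_fun_on :: "'a::real_vector set \<Rightarrow> ('a \<Rightarrow> 'b::real_vector) \<Rightarrow> bool" where
  "affine_fun_on S h \<longleftrightarrow> (\<exists>L c. linear L \<and> (\<forall>x\<in>S. h x = L x + c))"

definition pl_on :: "'a::euclidean_space set \<Rightarrow> ('a \<Rightarrow> 'b::euclidean_space) \<Rightarrow> bool" where
  "pl_on X h \<longleftrightarrow> (\<exists>T. simplicial_complex T \<and> \<Union>T = X \<and> (\<forall>\<sigma>\<in>T. affine_fun_on \<sigma> h))"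

definition pl_homeomorphic :: "'a::euclidean_space set \<Rightarrow> 'b::euclidean_space set \<Rightarrow> bool" where
  "pl_homeomorphic X Y \<longleftrightarrow> (\<exists>h g. homeomorphism X Y h g \<and> pl_on X h \<and> pl_on Y g)"

definition pl_ball :: "int \<Rightarrow> 'a::euclidean_space set \<Rightarrow> bool" where
  "pl_ball n X \<longleftrightarrow> (\<exists>\<Delta>::'a set. n simplex \<Delta> \<and> pl_homeomorphic X \<Delta>)"

text \<open>The \<open>(-1)\<close>-sphere is the empty set.  Taking the model simplex in the same space as \<open>X\<close> is no
  restriction, since an \<open>n\<close>-sphere only embeds in spaces of dimension at least \<open>n + 1\<close>.  The
  condition \<open>n \<ge> -1\<close> is needed because the empty set is a \<open>(-1)\<close>-simplex.\<close>

definition pl_sphere :: "int \<Rightarrow> 'a::euclidean_space set \<Rightarrow> bool" where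
  "pl_sphere n X \<longleftrightarrow>
     n \<ge> -1 \<and> (\<exists>\<Delta>::'a set. (n + 1) simplex \<Delta> \<and> pl_homeomorphic X (rel_frontier \<Delta>))"

definition link :: "'a::euclidean_space set set \<Rightarrow> 'a set \<Rightarrow> 'a set set" where
  "link M \<sigma> = {\<tau>\<in>M. \<sigma> \<inter> \<tau> = {} \<and> (\<exists>\<rho>\<in>M. \<sigma> face_of \<rho> \<and> \<tau> face_of \<rho>)}"

definition combinatorial_manifold :: "nat \<Rightarrow> 'a::euclidean_space set set \<Rightarrow> bool" where
  "combinatorial_manifold d M \<longleftrightarrow>
     simplicial_complex M \<and>
     (\<forall>k\<ge>0. \<forall>\<sigma>\<in>M. k simplex \<sigma> \<longrightarrow> pl_sphere (int d - k - 1) (\<Union>(link M \<sigma>)))"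

definition generic_pl :: "'a::euclidean_space set set \<Rightarrow> ('a \<Rightarrow> real) \<Rightarrow> bool" where
  "generic_pl M f \<longleftrightarrow>
     (\<forall>\<sigma>\<in>M. affine_fun_on \<sigma> f) \<and>
     (\<forall>v w. {v} \<in> M \<and> {w} \<in> M \<and> v \<noteq> w \<longrightarrow> f v \<noteq> f w)"

text \<open>Charts take values in \<^term>\<open>Euclidean_space d\<close>, whose points are the sequences
  \<open>x :: nat \<Rightarrow> real\<close> with \<open>x i = 0\<close> for \<open>i \<ge> d\<close>; the coordinates \<open>x\<^sub>1, \<dots>, x\<^sub>d\<close> are thus
  \<open>x 0, \<dots>, x (d - 1)\<close>.  On an open set, which need not be a compact polyhedron, being PL
  is a local condition: every point of \<open>U\<close> has a neighbourhood in \<open>U\<close> that is a compact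
  polyhedron with a triangulation on whose simplices the map is affine.\<close>

definition pl_chart ::
  "nat \<Rightarrow> 'a::euclidean_space set \<Rightarrow> 'a set \<Rightarrow> ('a \<Rightarrow> nat \<Rightarrow> real) \<Rightarrow> bool" where
  "pl_chart d X U \<phi> \<longleftrightarrow>
     openin (top_of_set X) U \<and>
     (\<exists>V. openin (Euclidean_space d) V \<and>
          homeomorphic_map (top_of_set U) (subtopology (Euclidean_space d) V) \<phi>) \<and>
     (\<forall>x\<in>U. \<exists>T W. simplicial_complex T \<and> \<Union>T \<subseteq> U \<and>
          openin (top_of_set U) W \<and> x \<in> W \<and> W \<subseteq> \<Union>T \<and>
          (\<forall>\<sigma>\<in>T. \<forall>i<d. affine_fun_on \<sigma> (\<lambda>y. \<phi> y i)))"

definition strongly_regular ::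
  "nat \<Rightarrow> 'a::euclidean_space set set \<Rightarrow> ('a \<Rightarrow> real) \<Rightarrow> 'a \<Rightarrow> bool" where
  "strongly_regular d M f p \<longleftrightarrow>
     (\<exists>U \<phi>. pl_chart d (\<Union>M) U \<phi> \<and> p \<in> U \<and> \<phi> p = (\<lambda>_. 0) \<and>
            (\<forall>q\<in>U. f q = f p + \<phi> q (d - 1)))"

text \<open>An unknotted \<open>(n, n-1)\<close>-sphere pair: \<open>T\<close> separates \<open>S\<close> into the balls \<open>A\<close> and \<open>B\<close>.\<close>

definition unknotted_sphere_pair ::
  "int \<Rightarrow> 'a::euclidean_space set \<Rightarrow> 'a set \<Rightarrow> bool" where
  "unknotted_sphere_pair n S T \<longleftrightarrow>
     pl_sphere n S \<and> pl_sphere (n - 1) T \<and> T \<subseteq> S \<and>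
     (\<exists>A B. pl_ball n A \<and> pl_ball n B \<and> A \<union> B = S \<and> A \<inter> B = T)"

end

theory Submission
  imports Defs
begin

text \<open>Both conditions on \<open>v\<close> are equivalent to the existence of a conic parametrisation of
  \<open>\<real>\<^sup>d\<close> by the link \<open>S\<close>: a PL map \<open>\<psi>\<close> on \<open>S\<close> that meets every open ray from the origin exactly
  once and whose last coordinate has the sign of \<open>f - a\<close>.  A strongly regular chart, restricted to a
  small homothetic copy of \<open>S\<close> about \<open>v\<close>, is such a map; conversely \<open>\<psi>\<close> extends to a chart of
  the open star by coning, once its last coordinate is made equal to \<open>f - a\<close>.

  Radial projection is not PL, so its role is played by a change of weights.  If \<open>\<psi>\<close> is affine on
  the simplices of a triangulation, replace its value at each vertex \<open>s\<close> by \<open>\<mu>\<^sub>s \<psi> s\<close> with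
  \<open>\<mu>\<^sub>s > 0\<close> and extend affinely.  The new map is \<open>\<Lambda> \<cdot> (\<psi> \<circ> \<rho>)\<close> with \<open>\<Lambda> > 0\<close> and \<open>\<rho>\<close> a bijection
  preserving every simplex, so it is conic again.  With suitable weights it lands in the boundary
  of a suspension of the model simplex, which exhibits the two balls and the sphere between them.

  In the other direction the two balls are mapped to the two halves of that suspension, after
  the homeomorphisms have been made to agree on the common boundary by the Alexander trick.
  That this boundary is the whole frontier of both balls follows from invariance of domain.\<close>

subsection \<open>Triangulations and affine maps\<close>

text \<open>The height of a conic map need only have the sign of \<open>f - a\<close>, because
  weights repair the rest: on a common triangulation both heights are affine on simplices, so
  weighting the vertices by the positive ratios of the two heights makes them equal everywhere. This
  leaves the freedom to build \<open>\<psi>\<close> from the two balls, where \<open>f\<close> is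
  known only up to sign.

  The suspension replaces the boundary of a \<open>d\<close>-simplex because each half of it
  projects along the axis, by a single affine map, bijectively onto the model simplex, with the
  equator going to the frontier.

  The definition of an unknotted pair says neither that the common part bounds the balls nor that
  the balls lie on different sides of the level \<open>a\<close>. For the second point, each ball
  without its boundary is connected, so \<open>f - a\<close> has constant sign there. Genericity
  gives both signs on the link: a point of the level set is a convex combination of link vertices
  whose values all differ from \<open>a\<close>.

  All models lie in \<open>span D\<close> for a set \<open>D\<close> of \<open>d\<close> basis
  vectors of the ambient space; the last of them is the axis.\<close>

lemma polytopes_triangulable:
  fixes \<P> :: "'a::euclidean_space set set"
  assumes fin: "finite \<P>" and poly: "\<And>P. P \<in> \<P> \<Longrightarrow> polytope P"
  obtains T where "simplicial_complex T" "\<Union>T = \<Union>\<P>" "\<And>K. K \<in> T \<Longrightarrow> \<exists>P\<in>\<P>. K \<subseteq> P"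
proof -
  have "\<exists>H. finite H \<and> P = (\<Inter>(a,b)\<in>H. {x. a \<bullet> x \<le> b})" if P: "P \<in> \<P>" for P
  proof -
    obtain F where F: "finite F" "P = \<Inter>F" "\<forall>h\<in>F. \<exists>a b. a \<noteq> 0 \<and> h = {x. a \<bullet> x \<le> b}"
      using polytope_imp_polyhedron[OF poly[OF P]] unfolding polyhedron_def by blast
    then obtain a b where ab: "\<And>h. h \<in> F \<Longrightarrow> h = {x. a h \<bullet> x \<le> b h}" by metis
    have "P = (\<Inter>(a,b)\<in>(\<lambda>h. (a h, b h)) ` F. {x. a \<bullet> x \<le> b})"
      using F(2) ab by auto
    then show ?thesis using F(1) by blast
  qed
  then obtain H where finH: "\<And>P. P \<in> \<P> \<Longrightarrow> finite (H P)"
    and H: "\<And>P. P \<in> \<P> \<Longrightarrow> P = (\<Inter>(a,b)\<in>H P. {x. a \<bullet> x \<le> b})"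
    by metis
  \<comment> \<open>The half-spaces of all polytopes together cut a cube around them into cells. By
    \<open>sign\<close>, two points of a cell never lie strictly on opposite sides of one of the
    hyperplanes.\<close>
  define I where "I = (\<Union>P\<in>\<P>. H P)"
  have finI: "finite I" using fin finH by (simp add: I_def)
  have "bounded (\<Union>\<P>)"
    using fin by (intro bounded_Union) (auto intro: poly polytope_imp_bounded)
  then obtain u where u: "\<Union>\<P> \<subseteq> cbox (-u) u"
    using bounded_subset_cbox_symmetric by blast
  obtain \<G> where \<G>U: "\<Union>\<G> = cbox (-u) u" and fin\<G>: "finite \<G>"
    and poly\<G>: "\<And>X. X \<in> \<G> \<Longrightarrow> polytope X"
    and face\<G>: "\<And>X Y. X \<in> \<G> \<Longrightarrow> Y \<in> \<G> \<Longrightarrow> X \<inter> Y face_of X"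
    and sign: "\<And>X x y a b. \<lbrakk>X \<in> \<G>; x \<in> X; y \<in> X; (a,b) \<in> I\<rbrakk> \<Longrightarrow>
          a \<bullet> x \<le> b \<and> a \<bullet> y \<le> b \<or> a \<bullet> x \<ge> b \<and> a \<bullet> y \<ge> b"
    apply (rule exE [OF cell_subdivision_lemma[of "{cbox (-u) u}" "int DIM('a)" I]])
    using finI by (auto simp: polytope_interval aff_dim_le_DIM face_of_refl convex_box)
  \<comment> \<open>Faces of cells are collected, not only cells: a polytope of low dimension may
    contain no cell at all.\<close>
  define \<F> where "\<F> = {F. (\<exists>C\<in>\<G>. F face_of C) \<and> (\<exists>P\<in>\<P>. F \<subseteq> P)}"
  have fin\<F>: "finite \<F>"
  proof (rule finite_subset)
    show "\<F> \<subseteq> (\<Union>C\<in>\<G>. {F. F face_of C})" by (auto simp: \<F>_def)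
    show "finite (\<Union>C\<in>\<G>. {F. F face_of C})"
      using fin\<G> poly\<G> finite_polytope_faces by blast
  qed
  have poly\<F>: "polytope F" if "F \<in> \<F>" for F
    using that poly\<G> face_of_polytope_polytope by (auto simp: \<F>_def)
  have face\<F>: "F \<inter> F' face_of F" if FF: "F \<in> \<F>" "F' \<in> \<F>" for F F'
  proof -
    obtain C C' where C: "C \<in> \<G>" "F face_of C" "C' \<in> \<G>" "F' face_of C'"
      using FF unfolding \<F>_def by blast
    then show ?thesis
      using face_of_Int_subface[of C C' F F'] face\<G>[of C C'] face\<G>[of C' C]
      by (simp add: Int_commute)
  qed
  have Un: "\<Union>\<F> = \<Union>\<P>"
  proof
    show "\<Union>\<F> \<subseteq> \<Union>\<P>" by (auto simp: \<F>_def)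
    show "\<Union>\<P> \<subseteq> \<Union>\<F>"
    proof
      fix x assume "x \<in> \<Union>\<P>"
      then obtain P where P: "P \<in> \<P>" "x \<in> P" by blast
      then obtain C where C: "C \<in> \<G>" "x \<in> C" using u \<G>U by blast
      \<comment> \<open>\<open>F\<close> is the face of \<open>C\<close> cut out by the hyperplanes
        through \<open>x\<close>. On it the inequalities tight at \<open>x\<close> stay equalities,
        and by \<open>sign\<close> those strict at \<open>x\<close> cannot be violated, so
        \<open>F\<close> lies in \<open>P\<close>.\<close>
      define F where "F = \<Inter>(insert C ((\<lambda>(a,b). C \<inter> {y. a \<bullet> y = b}) ` {(a,b)\<in>I. a \<bullet> x = b}))"
      have cC: "convex C" using poly\<G>[OF C(1)] polytope_imp_convex by blast
      have "C \<inter> {y. a \<bullet> y = b} face_of C" if ab: "(a,b) \<in> I" "a \<bullet> x = b" for a b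
      proof (cases "\<forall>y\<in>C. a \<bullet> y \<le> b")
        case True
        then show ?thesis using face_of_Int_supporting_hyperplane_le[OF cC] by blast
      next
        case False
        then obtain z where z: "z \<in> C" "a \<bullet> z > b" by force
        then have "\<forall>y\<in>C. a \<bullet> y \<ge> b" using sign[OF C(1) z(1) _ ab(1)] by fastforce
        then show ?thesis using face_of_Int_supporting_hyperplane_ge[OF cC] by blast
      qed
      then have "F face_of C"
        unfolding F_def by (intro face_of_Inter) (auto simp: face_of_refl cC)
      moreover have "F \<subseteq> P"
      proof
        fix y assume y: "y \<in> F"
        have "a \<bullet> y \<le> b" if ab: "(a,b) \<in> H P" for a b
        proof (cases "a \<bullet> x = b")
          case True
          then have "(a,b) \<in> {(a,b)\<in>I. a \<bullet> x = b}" using ab P by (auto simp: I_def)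
          then show ?thesis using y unfolding F_def by fastforce
        next
          case False
          moreover have "a \<bullet> x \<le> b" using H[OF P(1)] P(2) ab by auto
          moreover have "y \<in> C" using y by (simp add: F_def)
          ultimately show ?thesis
            using sign[OF C(1,2), of y a b] ab P by (auto simp: I_def)
        qed
        then show "y \<in> P" using H[OF P(1)] by auto
      qed
      moreover have "x \<in> F" using C by (auto simp: F_def)
      ultimately show "x \<in> \<Union>\<F>" using C(1) P(1) unfolding \<F>_def by blast
    qed
  qed
  obtain T where T: "simplicial_complex T" "\<Union>T = \<Union>\<F>" "\<And>K. K \<in> T \<Longrightarrow> \<exists>C. C \<in> \<F> \<and> K \<subseteq> C"
    using simplicial_subdivision_of_cell_complex[OF fin\<F> poly\<F> face\<F>] by metis
  show ?thesis
  proof (rule that[OF T(1)])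
    show "\<Union>T = \<Union>\<P>" using T(2) Un by simp
    show "\<exists>P\<in>\<P>. K \<subseteq> P" if K: "K \<in> T" for K
    proof -
      obtain C where "C \<in> \<F>" "K \<subseteq> C" using T(3)[OF K] by blast
      then show ?thesis unfolding \<F>_def by blast
    qed
  qed
qed

lemma affine_fun_on_subset: "affine_fun_on S h \<Longrightarrow> T \<subseteq> S \<Longrightarrow> affine_fun_on T h"
  unfolding affine_fun_on_def by blast

lemma affine_fun_on_cong: "affine_fun_on S h \<Longrightarrow> (\<And>x. x \<in> S \<Longrightarrow> k x = h x) \<Longrightarrow> affine_fun_on S k"
  unfolding affine_fun_on_def by auto

lemma affine_fun_on_linear: "linear L \<Longrightarrow> affine_fun_on S L"
  unfolding affine_fun_on_def by (rule exI[of _ L], rule exI[of _ 0]) auto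

lemma affine_fun_on_const: "affine_fun_on S (\<lambda>x. c)"
  unfolding affine_fun_on_def by (rule exI[of _ "\<lambda>x. 0"], rule exI[of _ c]) (auto simp: linear_zero)

lemma affine_fun_on_ident: "affine_fun_on S (\<lambda>x. x)"
  by (rule affine_fun_on_linear) (rule linear_id[unfolded id_def])

lemma affine_fun_on_add:
  assumes "affine_fun_on S h" "affine_fun_on S k"
  shows "affine_fun_on S (\<lambda>x. h x + k x)"
proof -
  obtain L c L' c' where "linear L" "\<forall>x\<in>S. h x = L x + c" "linear L'" "\<forall>x\<in>S. k x = L' x + c'"
    using assms unfolding affine_fun_on_def by blast
  then show ?thesis unfolding affine_fun_on_def
    by (intro exI[of _ "\<lambda>x. L x + L' x"] exI[of _ "c + c'"]) (auto intro: linear_compose_add)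
qed

lemma affine_fun_on_compose_linear:
  assumes "affine_fun_on S h" "linear k"
  shows "affine_fun_on S (\<lambda>x. k (h x))"
proof -
  obtain L c where "linear L" "\<forall>x\<in>S. h x = L x + c"
    using assms unfolding affine_fun_on_def by blast
  then show ?thesis unfolding affine_fun_on_def
    by (intro exI[of _ "\<lambda>x. k (L x)"] exI[of _ "k c"])
       (auto simp: linear_add[OF assms(2)] intro: linear_compose[unfolded o_def] assms(2))
qed

lemma affine_fun_on_compose:
  assumes "affine_fun_on S h" "affine_fun_on (h ` S) k"
  shows "affine_fun_on S (\<lambda>x. k (h x))"
proof -
  obtain L c where "linear L" "\<forall>y\<in>h ` S. k y = L y + c"
    using assms(2) unfolding affine_fun_on_def by blast
  then show ?thesis
    using affine_fun_on_add[OF affine_fun_on_compose_linear[OF assms(1), of L] affine_fun_on_const[of _ c]]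
    by (auto elim: affine_fun_on_cong)
qed

lemma affine_fun_on_scaleR_const: "affine_fun_on S u \<Longrightarrow> affine_fun_on S (\<lambda>x. u x *\<^sub>R b)"
  by (rule affine_fun_on_compose_linear) (auto intro: linearI simp: scaleR_add_left)

lemma affine_fun_on_scaleR: "affine_fun_on S u \<Longrightarrow> affine_fun_on S (\<lambda>x. b *\<^sub>R u x)"
  by (rule affine_fun_on_compose_linear) (auto intro: linearI simp: algebra_simps)

lemma affine_fun_on_sum:
  "(\<And>i. i \<in> I \<Longrightarrow> affine_fun_on S (h i)) \<Longrightarrow> affine_fun_on S (\<lambda>x. \<Sum>i\<in>I. h i x)"
proof (induction I rule: infinite_finite_induct)
  case (insert i I)
  then show ?case by (simp add: affine_fun_on_add)
qed (auto simp: affine_fun_on_const)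

lemma affine_fun_on_Pair:
  assumes "affine_fun_on S h" "affine_fun_on S k"
  shows "affine_fun_on S (\<lambda>x. (h x, k x))"
proof -
  have "affine_fun_on S (\<lambda>x. (h x, 0) + (0, k x))"
    by (intro affine_fun_on_add affine_fun_on_compose_linear[OF assms(1), of "\<lambda>y. (y, 0)"]
        affine_fun_on_compose_linear[OF assms(2), of "\<lambda>y. (0, y)"]) (auto intro: linearI)
  then show ?thesis by simp
qed

lemma affine_fun_on_convex_sum:
  assumes h: "affine_fun_on S h" and S: "(\<Sum>i\<in>I. u i) = (1::real)" "\<And>i. i \<in> I \<Longrightarrow> p i \<in> S" "(\<Sum>i\<in>I. u i *\<^sub>R p i) \<in> S"
  shows "h (\<Sum>i\<in>I. u i *\<^sub>R p i) = (\<Sum>i\<in>I. u i *\<^sub>R h (p i))"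
proof -
  obtain L c where L: "linear L" and h: "\<And>x. x\<in>S \<Longrightarrow> h x = L x + c"
    using h unfolding affine_fun_on_def by blast
  have "h (\<Sum>i\<in>I. u i *\<^sub>R p i) = (\<Sum>i\<in>I. u i *\<^sub>R L (p i)) + (\<Sum>i\<in>I. u i) *\<^sub>R c"
    using S L by (simp add: h linear_sum linear_cmul)
  also have "\<dots> = (\<Sum>i\<in>I. u i *\<^sub>R h (p i))"
    using S(2) by (simp add: h scaleR_add_right sum.distrib scaleR_sum_left)
  finally show ?thesis .
qed

lemma affine_fun_on_segment:
  assumes h: "affine_fun_on S h" and "x \<in> S" "y \<in> S" "(1 - t) *\<^sub>R x + t *\<^sub>R y \<in> S"
  shows "h ((1 - t) *\<^sub>R x + t *\<^sub>R y) = (1 - t) *\<^sub>R h x + t *\<^sub>R h y"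
proof -
  obtain L c where L: "linear L" and h: "\<And>x. x\<in>S \<Longrightarrow> h x = L x + c"
    using h unfolding affine_fun_on_def by blast
  show ?thesis
    unfolding h[OF assms(2)] h[OF assms(3)] h[OF assms(4)] linear_add[OF L] linear_cmul[OF L]
    by (simp add: algebra_simps)
qed

lemma affine_fun_on_continuous:
  fixes h :: "'a::euclidean_space \<Rightarrow> 'b::real_normed_vector"
  assumes "affine_fun_on S h" shows "continuous_on S h"
proof -
  obtain L c where "linear L" "\<forall>x\<in>S. h x = L x + c"
    using assms unfolding affine_fun_on_def by blast
  then have "continuous_on S (\<lambda>x. L x + c)"
    by (intro continuous_intros linear_continuous_on linear_conv_bounded_linear[THEN iffD1])
  then show ?thesis using \<open>\<forall>x\<in>S. h x = L x + c\<close> continuous_on_cong by force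
qed

lemma polytope_affine_preimage:
  fixes h :: "'a::euclidean_space \<Rightarrow> 'b::euclidean_space"
  assumes h: "affine_fun_on P h" and P: "polytope P" and Q: "polyhedron Q"
  shows "polytope (P \<inter> h -` Q)"
proof -
  obtain L c where L: "linear L" "\<forall>x\<in>P. h x = L x + c"
    using assms unfolding affine_fun_on_def by blast
  obtain F where F: "finite F" "Q = \<Inter>F" "\<forall>s\<in>F. \<exists>a b. a \<noteq> 0 \<and> s = {x. a \<bullet> x \<le> b}"
    using Q unfolding polyhedron_def by blast
  have "polyhedron {x. L x + c \<in> s}" if s: "s \<in> F" for s
  proof -
    obtain a b where sab: "s = {x. a \<bullet> x \<le> b}" using F(3) s by meson
    \<comment> \<open>The normal of a half-space is pulled back by the adjoint of \<open>L\<close>;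
      the result may be zero.\<close>
    have "{x. L x + c \<in> s} = {x. adjoint L a \<bullet> x \<le> b - a \<bullet> c}"
      using adjoint_works[OF L(1), of _ a]
      by (auto simp: sab inner_add_right inner_commute algebra_simps)
    then show ?thesis using polyhedron_halfspace_le by simp
  qed
  then have "polyhedron (\<Inter>s\<in>F. {x. L x + c \<in> s})"
    using F(1) by auto
  moreover have "P \<inter> h -` Q = P \<inter> (\<Inter>s\<in>F. {x. L x + c \<in> s})"
    using L(2) F(2) by auto
  ultimately show ?thesis using P polytope_Int_polyhedron by metis
qed

lemma polytope_affine_image:
  fixes h :: "'a::euclidean_space \<Rightarrow> 'b::euclidean_space"
  assumes h: "affine_fun_on P h" and P: "polytope P"
  shows "polytope (h ` P)"
proof -
  obtain L c where L: "linear L" "\<forall>x\<in>P. h x = L x + c"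
    using assms unfolding affine_fun_on_def by blast
  then have "h ` P = (+) c ` L ` P" by (force simp: image_image add.commute)
  then show ?thesis using polytope_linear_image[OF L(1) P] polytope_translation_eq by metis
qed

text \<open>The set where two affine maps agree is convex. Identities on simplices are later reduced
  to their vertices in this way.\<close>

lemma affine_fun_on_hull_eq:
  fixes h k :: "'a::real_vector \<Rightarrow> 'b::real_vector"
  assumes "affine_fun_on (convex hull C) h" "affine_fun_on (convex hull C) k"
    "\<And>x. x \<in> C \<Longrightarrow> h x = k x" "x \<in> convex hull C"
  shows "h x = k x"
proof -
  obtain L c L' c' where L: "linear L" "\<forall>x\<in>convex hull C. h x = L x + c" "linear L'" "\<forall>x\<in>convex hull C. k x = L' x + c'"
    using assms unfolding affine_fun_on_def by blast
  have "convex {x. L x + c = L' x + c'}"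
  proof (rule convexI, simp)
    fix x y and u w :: real
    assume *: "L x + c = L' x + c'" "L y + c = L' y + c'" "u + w = 1"
    have "L (u *\<^sub>R x + w *\<^sub>R y) + (u + w) *\<^sub>R c = u *\<^sub>R (L x + c) + w *\<^sub>R (L y + c)"
      by (simp add: linear_add linear_cmul L algebra_simps)
    also have "\<dots> = u *\<^sub>R (L' x + c') + w *\<^sub>R (L' y + c')" using * by simp
    also have "\<dots> = L' (u *\<^sub>R x + w *\<^sub>R y) + (u + w) *\<^sub>R c'"
      by (simp add: linear_add linear_cmul L algebra_simps)
    finally show "L (u *\<^sub>R x + w *\<^sub>R y) + c = L' (u *\<^sub>R x + w *\<^sub>R y) + c'" using * by simp
  qed
  moreover have "C \<subseteq> {x. L x + c = L' x + c'}"
  proof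
    fix y assume y: "y \<in> C"
    then have "y \<in> convex hull C" by (rule hull_inc)
    then show "y \<in> {x. L x + c = L' x + c'}" using L(2,4) assms(3)[OF y] by simp
  qed
  ultimately have "convex hull C \<subseteq> {x. L x + c = L' x + c'}" by (simp add: hull_minimal)
  then show ?thesis using L(2,4) assms(4) by force
qed

text \<open>Once a point \<open>p\<close> of \<open>C\<close> is translated to the origin, the other
  points become linearly independent, so their values can be prescribed.\<close>

lemma affine_extension:
  fixes w :: "'a::euclidean_space \<Rightarrow> 'b::real_vector"
  assumes "\<not> affine_dependent C"
  shows "\<exists>h. affine_fun_on UNIV h \<and> (\<forall>x\<in>C. h x = w x)"
proof (cases "C = {}")
  case False
  then obtain p where p: "p \<in> C" by blast
  have ind: "independent ((\<lambda>x. x - p) ` (C - {p}))"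
    using affine_dependent_iff_dependent2[OF p] assms by simp
  obtain L where L: "linear L" "\<forall>y\<in>(\<lambda>x. x - p) ` (C - {p}). L y = w (y + p) - w p"
    using linear_independent_extend[OF ind, of "\<lambda>y. w (y + p) - w p"] by blast
  have "affine_fun_on UNIV (\<lambda>x. L x + (w p - L p))"
    using L(1) unfolding affine_fun_on_def by blast
  moreover have "L x + (w p - L p) = w x" if "x \<in> C" for x
  proof (cases "x = p")
    case False
    then have "L (x - p) = w x - w p" using L(2) that by simp
    then show ?thesis by (simp add: linear_diff[OF L(1)] algebra_simps)
  qed simp
  ultimately show ?thesis by blast
qed (use affine_fun_on_const in blast)

subsection \<open>PL maps\<close>

text \<open>The polytopes on the right may overlap in any way, so restrictions, compositions and
  unions of PL maps can be treated by intersecting or collecting pieces.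
  \<open>polytopes_triangulable\<close> recovers a complex, each of whose simplices lies in a single
  piece.\<close>

lemma pl_on_iff_polytopes:
  "pl_on X h \<longleftrightarrow> (\<exists>\<P>. finite \<P> \<and> \<Union>\<P> = X \<and> (\<forall>P\<in>\<P>. polytope P \<and> affine_fun_on P h))"
proof
  assume "pl_on X h"
  then obtain T where T: "simplicial_complex T" "\<Union>T = X" "\<forall>\<sigma>\<in>T. affine_fun_on \<sigma> h"
    unfolding pl_on_def by blast
  then have "finite T" "\<forall>\<sigma>\<in>T. polytope \<sigma>"
    unfolding simplicial_complex_def by (auto dest: simplex_imp_polytope)
  then show "\<exists>\<P>. finite \<P> \<and> \<Union>\<P> = X \<and> (\<forall>P\<in>\<P>. polytope P \<and> affine_fun_on P h)"
    using T(2,3) by (intro exI[of _ T]) simp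
next
  assume "\<exists>\<P>. finite \<P> \<and> \<Union>\<P> = X \<and> (\<forall>P\<in>\<P>. polytope P \<and> affine_fun_on P h)"
  then obtain \<P> where P: "finite \<P>" "\<Union>\<P> = X" "\<And>P. P \<in> \<P> \<Longrightarrow> polytope P" "\<And>P. P\<in>\<P> \<Longrightarrow> affine_fun_on P h"
    by blast
  obtain T where T: "simplicial_complex T" "\<Union>T = \<Union>\<P>" "\<And>K. K \<in> T \<Longrightarrow> \<exists>P\<in>\<P>. K \<subseteq> P"
    using polytopes_triangulable[OF P(1,3)] by blast
  have "affine_fun_on K h" if "K \<in> T" for K
    using T(3)[OF that] P(4) by (auto intro: affine_fun_on_subset)
  then show "pl_on X h" unfolding pl_on_def using T(1,2) P(2) by (intro exI[of _ T]) simp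
qed

lemma pl_onI:
  assumes "finite \<P>" "\<Union>\<P> = X" "\<And>P. P \<in> \<P> \<Longrightarrow> polytope P" "\<And>P. P\<in>\<P> \<Longrightarrow> affine_fun_on P h"
  shows "pl_on X h"
  unfolding pl_on_iff_polytopes using assms by blast

lemma pl_onE:
  assumes "pl_on X h"
  obtains \<P> where "finite \<P>" "\<Union>\<P> = X" "\<And>P. P \<in> \<P> \<Longrightarrow> polytope P" "\<And>P. P\<in>\<P> \<Longrightarrow> affine_fun_on P h"
  using assms unfolding pl_on_iff_polytopes by blast

lemma pl_on_cong:
  assumes "pl_on X h" "\<And>x. x \<in> X \<Longrightarrow> k x = h x" shows "pl_on X k"
proof -
  obtain T where "simplicial_complex T" "\<Union>T = X" "\<forall>\<sigma>\<in>T. affine_fun_on \<sigma> h"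
    using assms(1) unfolding pl_on_def by blast
  then show ?thesis unfolding pl_on_def using assms(2)
    by (intro exI[of _ T]) (auto intro: affine_fun_on_cong)
qed

lemma pl_on_compact:
  assumes "pl_on X h" shows "compact X"
proof (rule pl_onE[OF assms])
  fix \<P> assume P: "finite \<P>" "\<Union>\<P> = X" "\<And>P. P \<in> \<P> \<Longrightarrow> polytope P"
  show "compact X" unfolding P(2)[symmetric]
    using P(1) by (rule compact_Union) (simp add: P(3) polytope_imp_compact)
qed

lemma pl_on_continuous:
  assumes "pl_on X h" shows "continuous_on X h"
proof (rule pl_onE[OF assms])
  fix \<P> assume P: "finite \<P>" "\<Union>\<P> = X" "\<And>P. P \<in> \<P> \<Longrightarrow> polytope P" "\<And>P. P\<in>\<P> \<Longrightarrow> affine_fun_on P h"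
  have "continuous_on (\<Union>P\<in>\<P>. P) h"
    using P by (intro continuous_on_closed_Union affine_fun_on_continuous polytope_imp_closed) auto
  then show "continuous_on X h" using P(2) by simp
qed

text \<open>The pieces are intersections of a piece for \<open>h\<close> with a piece for
  \<open>k\<close>. A triangulation for the pair serves both maps, which is how simplices are later
  obtained on which two maps are affine at once.\<close>

lemma pl_on_Pair:
  assumes "pl_on X h" "pl_on X k"
  shows "pl_on X (\<lambda>x. (h x, k x))"
proof (rule pl_onE[OF assms(1)], rule pl_onE[OF assms(2)])
  fix \<P> \<Q>
  assume P: "finite \<P>" "\<Union>\<P> = X" "\<And>P. P \<in> \<P> \<Longrightarrow> polytope P" "\<And>P. P\<in>\<P> \<Longrightarrow> affine_fun_on P h"
    and Q: "finite \<Q>" "\<Union>\<Q> = X" "\<And>P. P \<in> \<Q> \<Longrightarrow> polytope P" "\<And>P. P\<in>\<Q> \<Longrightarrow> affine_fun_on P k"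
  show ?thesis
  proof (rule pl_onI)
    show "finite ((\<lambda>(P,Q). P \<inter> Q) ` (\<P> \<times> \<Q>))" using P(1) Q(1) by blast
    show "\<Union>((\<lambda>(P,Q). P \<inter> Q) ` (\<P> \<times> \<Q>)) = X"
    proof
      show "X \<subseteq> \<Union>((\<lambda>(P,Q). P \<inter> Q) ` (\<P> \<times> \<Q>))"
      proof
        fix x assume "x \<in> X"
        then obtain A B where "A \<in> \<P>" "B \<in> \<Q>" "x \<in> A" "x \<in> B" using P(2) Q(2) by blast
        then show "x \<in> \<Union>((\<lambda>(P,Q). P \<inter> Q) ` (\<P> \<times> \<Q>))" by (auto intro!: bexI[of _ "(A,B)"])
      qed
    qed (use P(2) in auto)
    fix R assume "R \<in> (\<lambda>(P,Q). P \<inter> Q) ` (\<P> \<times> \<Q>)"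
    then obtain A B where R: "A \<in> \<P>" "B \<in> \<Q>" "R = A \<inter> B" by auto
    show "polytope R" using R P Q by (simp add: polytope_Int)
    show "affine_fun_on R (\<lambda>x. (h x, k x))"
      using R P(4) Q(4) by (auto intro!: affine_fun_on_Pair intro: affine_fun_on_subset)
  qed
qed

lemma pl_on_compose:
  fixes h :: "'a::euclidean_space \<Rightarrow> 'b::euclidean_space"
  assumes "pl_on X h" "pl_on Y k" "h ` X \<subseteq> Y"
  shows "pl_on X (\<lambda>x. k (h x))"
proof (rule pl_onE[OF assms(1)], rule pl_onE[OF assms(2)])
  fix \<P> \<Q>
  assume P: "finite \<P>" "\<Union>\<P> = X" "\<And>P. P \<in> \<P> \<Longrightarrow> polytope P" "\<And>P. P\<in>\<P> \<Longrightarrow> affine_fun_on P h"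
    and Q: "finite \<Q>" "\<Union>\<Q> = Y" "\<And>P. P \<in> \<Q> \<Longrightarrow> polytope P" "\<And>P. P\<in>\<Q> \<Longrightarrow> affine_fun_on P k"
  show ?thesis
  proof (rule pl_onI)
    show "finite ((\<lambda>(P,Q). P \<inter> h -` Q) ` (\<P> \<times> \<Q>))" using P(1) Q(1) by blast
    show "\<Union>((\<lambda>(P,Q). P \<inter> h -` Q) ` (\<P> \<times> \<Q>)) = X"
    proof
      show "X \<subseteq> \<Union>((\<lambda>(P,Q). P \<inter> h -` Q) ` (\<P> \<times> \<Q>))"
      proof
        fix x assume "x \<in> X"
        then obtain A B where "A \<in> \<P>" "B \<in> \<Q>" "x \<in> A" "h x \<in> B" using P(2) Q(2) assms(3) by blast
        then show "x \<in> \<Union>((\<lambda>(P,Q). P \<inter> h -` Q) ` (\<P> \<times> \<Q>))" by (auto intro!: bexI[of _ "(A,B)"])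
      qed
    qed (use P(2) in auto)
    fix R assume "R \<in> (\<lambda>(P,Q). P \<inter> h -` Q) ` (\<P> \<times> \<Q>)"
    then obtain A B where R: "A \<in> \<P>" "B \<in> \<Q>" "R = A \<inter> h -` B" by auto
    show "polytope R" using R P Q by (simp add: polytope_affine_preimage polytope_imp_polyhedron)
    show "affine_fun_on R (\<lambda>x. k (h x))"
    proof (rule affine_fun_on_compose[of _ h k])
      show "affine_fun_on R h" using R P(4) by (auto intro: affine_fun_on_subset)
      show "affine_fun_on (h ` R) k" using R by (auto intro: affine_fun_on_subset[OF Q(4)])
    qed
  qed
qed

lemma pl_on_affine:
  assumes "pl_on X h" "affine_fun_on (h ` X) k"
  shows "pl_on X (\<lambda>x. k (h x))"
proof -
  obtain T where T: "simplicial_complex T" "\<Union>T = X" "\<forall>\<sigma>\<in>T. affine_fun_on \<sigma> h"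
    using assms(1) unfolding pl_on_def by blast
  have "affine_fun_on \<sigma> (\<lambda>x. k (h x))" if \<sigma>: "\<sigma> \<in> T" for \<sigma>
  proof (rule affine_fun_on_compose[of _ h k])
    show "affine_fun_on \<sigma> h" using T(3) \<sigma> by blast
    have "h ` \<sigma> \<subseteq> h ` X" using T(2) \<sigma> by blast
    then show "affine_fun_on (h ` \<sigma>) k" by (rule affine_fun_on_subset[OF assms(2)])
  qed
  then show ?thesis unfolding pl_on_def using T by blast
qed

lemma pl_on_ident: "pl_on X h \<Longrightarrow> pl_on X (\<lambda>x. x)"
  unfolding pl_on_def using affine_fun_on_ident by blast

lemma affine_fun_on_imp_pl_on: "pl_on X (\<lambda>x. x) \<Longrightarrow> affine_fun_on X h \<Longrightarrow> pl_on X h"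
  using pl_on_affine[of X "\<lambda>x. x" h] by simp

text \<open>\<open>pl_on Y k\<close> for an arbitrary \<open>k\<close> just expresses that
  \<open>Y\<close> is a compact polyhedron; the restriction is then a composition with the
  inclusion.\<close>

lemma pl_on_subset: "pl_on X h \<Longrightarrow> pl_on Y k \<Longrightarrow> Y \<subseteq> X \<Longrightarrow> pl_on Y h"
  using pl_on_compose[of Y "\<lambda>x. x" X h] pl_on_ident by fastforce

lemma pl_on_add:
  assumes "pl_on X h" "pl_on X k"
  shows "pl_on X (\<lambda>x. h x + k x :: 'b::euclidean_space)"
proof -
  have "linear (\<lambda>z::'b \<times> 'b. fst z + snd z)" by (rule linearI) (auto simp: algebra_simps)
  then show ?thesis
    using pl_on_affine[OF pl_on_Pair[OF assms] affine_fun_on_linear, of "\<lambda>z. fst z + snd z"] by simp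
qed

lemma pl_on_scaleR_const: "pl_on X u \<Longrightarrow> pl_on X (\<lambda>x. u x *\<^sub>R b)"
  by (rule pl_on_affine[of X u "\<lambda>t. t *\<^sub>R b"])
     (auto intro!: affine_fun_on_scaleR_const affine_fun_on_ident)

lemma pl_on_uminus: "pl_on X h \<Longrightarrow> pl_on X (\<lambda>x. - h x)"
  by (rule pl_on_affine[of X h uminus]) (auto intro!: affine_fun_on_linear linearI)

lemma pl_on_const: "pl_on X h \<Longrightarrow> pl_on X (\<lambda>x. c)"
  using pl_on_affine[of X h "\<lambda>x. c"] affine_fun_on_const by blast

lemma pl_on_Un:
  assumes "pl_on X h" "pl_on Y h" shows "pl_on (X \<union> Y) h"
proof (rule pl_onE[OF assms(1)], rule pl_onE[OF assms(2)])
  fix \<P> \<Q>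
  assume P: "finite \<P>" "\<Union>\<P> = X" "\<And>P. P \<in> \<P> \<Longrightarrow> polytope P" "\<And>P. P\<in>\<P> \<Longrightarrow> affine_fun_on P h"
    and Q: "finite \<Q>" "\<Union>\<Q> = Y" "\<And>P. P \<in> \<Q> \<Longrightarrow> polytope P" "\<And>P. P\<in>\<Q> \<Longrightarrow> affine_fun_on P h"
  show ?thesis
    by (rule pl_onI[of "\<P> \<union> \<Q>"]) (use P Q in auto)
qed

lemma pl_on_vimage:
  assumes "pl_on X h" "pl_on X u" "polyhedron Q"
  shows "pl_on (X \<inter> u -` Q) h"
proof (rule pl_onE[OF pl_on_Pair[OF assms(1,2)]])
  fix \<P>
  assume P: "finite \<P>" "\<Union>\<P> = X" "\<And>P. P \<in> \<P> \<Longrightarrow> polytope P" "\<And>P. P\<in>\<P> \<Longrightarrow> affine_fun_on P (\<lambda>x. (h x, u x))"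
  have u: "affine_fun_on P u" and h: "affine_fun_on P h" if "P \<in> \<P>" for P
    using affine_fun_on_compose_linear[OF P(4)[OF that] linear_snd]
      affine_fun_on_compose_linear[OF P(4)[OF that] linear_fst] by simp_all
  show ?thesis
  proof (rule pl_onI)
    show "finite ((\<lambda>P. P \<inter> u -` Q) ` \<P>)" using P by blast
    show "\<Union>((\<lambda>P. P \<inter> u -` Q) ` \<P>) = X \<inter> u -` Q" using P by blast
    fix R assume "R \<in> (\<lambda>P. P \<inter> u -` Q) ` \<P>"
    then obtain P where R: "P \<in> \<P>" "R = P \<inter> u -` Q" by blast
    show "polytope R" using R u P(3) assms(3) by (simp add: polytope_affine_preimage)
    show "affine_fun_on R h" using R(2) by (auto intro: affine_fun_on_subset[OF h[OF R(1)]])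
  qed
qed

lemma polyhedron_real:
  "polyhedron {c..}" "polyhedron {..c}" "polyhedron {c}" for c :: real
proof -
  have e: "{c..} = {x. 1 \<bullet> x \<ge> c}" "{..c} = {x. 1 \<bullet> x \<le> c}" by auto
  show 1: "polyhedron {c..}" "polyhedron {..c}"
    unfolding e by (rule polyhedron_halfspace_ge polyhedron_halfspace_le)+
  have "{c} = {c..} \<inter> {..c}" by auto
  then show "polyhedron {c}" using 1 by simp
qed

lemma pl_on_max:
  fixes u w :: "'a::euclidean_space \<Rightarrow> real"
  assumes "pl_on X u" "pl_on X w"
  shows "pl_on X (\<lambda>x. max (u x) (w x))"
proof -
  let ?m = "\<lambda>x. max (u x) (w x)"
  have d: "pl_on X (\<lambda>x. u x + - w x)" by (intro pl_on_add pl_on_uminus assms)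
  have "pl_on (X \<inter> (\<lambda>x. u x + - w x) -` {0..}) ?m"
    by (rule pl_on_cong[OF pl_on_vimage[OF assms(1) d polyhedron_real(1)]]) auto
  moreover have "pl_on (X \<inter> (\<lambda>x. u x + - w x) -` {..0}) ?m"
    by (rule pl_on_cong[OF pl_on_vimage[OF assms(2) d polyhedron_real(2)]]) auto
  moreover have "X = (X \<inter> (\<lambda>x. u x + - w x) -` {0..}) \<union> (X \<inter> (\<lambda>x. u x + - w x) -` {..0})" by auto
  ultimately show ?thesis using pl_on_Un by metis
qed

lemma pl_on_abs:
  fixes u :: "'a::euclidean_space \<Rightarrow> real"
  assumes "pl_on X u" shows "pl_on X (\<lambda>x. \<bar>u x\<bar>)"
  by (rule pl_on_cong[OF pl_on_max[OF assms pl_on_uminus[OF assms]]]) auto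

lemma pl_on_Max:
  assumes "finite I" "I \<noteq> {}" "\<And>i. i \<in> I \<Longrightarrow> pl_on X (u i :: 'b::euclidean_space \<Rightarrow> real)"
  shows "pl_on X (\<lambda>x. Max ((\<lambda>i. u i x) ` I))"
  using assms
proof (induction I rule: finite_ne_induct)
  case (insert i I)
  have "pl_on X (\<lambda>x. max (u i x) (Max ((\<lambda>i. u i x) ` I)))"
    using insert by (intro pl_on_max) auto
  then show ?case using insert by simp
qed simp

lemma affine_fun_on_convex_hull_image:
  assumes "affine_fun_on (convex hull C) h"
  shows "h ` (convex hull C) = convex hull (h ` C)"
proof -
  obtain L c where L: "linear L" "\<forall>x\<in>convex hull C. h x = L x + c"
    using assms unfolding affine_fun_on_def by blast
  have "h ` (convex hull C) = (+) c ` L ` (convex hull C)"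
    using L(2) by (force simp: image_image add.commute)
  also have "\<dots> = convex hull ((+) c ` L ` C)"
    by (simp add: convex_hull_linear_image[OF L(1)] convex_hull_translation)
  also have "(+) c ` L ` C = h ` C"
    using L(2) hull_inc[of _ C convex] by (force simp: image_image add.commute)
  finally show ?thesis .
qed

text \<open>A dependence among the images would give a Radon partition, hence a point common to the
  hulls of two disjoint sets of images. Injectivity pulls it back to a point common to the hulls of
  two disjoint subsets of \<open>C\<close>, which affine independence forbids.\<close>

lemma affine_independent_inj_image:
  fixes h :: "'a::euclidean_space \<Rightarrow> 'b::euclidean_space"
  assumes h: "affine_fun_on (convex hull C) h" and inj: "inj_on h (convex hull C)"
    and C: "\<not> affine_dependent C"
  shows "\<not> affine_dependent (h ` C)"
proof
  assume dep: "affine_dependent (h ` C)"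
  have "finite C" using C by (rule aff_independent_finite)
  then obtain M P where MP: "M \<inter> P = {}" "M \<union> P = h ` C" "(convex hull M) \<inter> (convex hull P) \<noteq> {}"
    using Radon_partition[OF _ dep] by blast
  have sub: "C \<inter> h -` M \<subseteq> C" "C \<inter> h -` P \<subseteq> C" by auto
  have "h ` (C \<inter> h -` A) = h ` C \<inter> A" for A by auto
  then have im: "h ` (C \<inter> h -` M) = M" "h ` (C \<inter> h -` P) = P"
    unfolding MP(2)[symmetric] by auto
  have hull: "convex hull M = h ` (convex hull (C \<inter> h -` M))" "convex hull P = h ` (convex hull (C \<inter> h -` P))"
    using affine_fun_on_convex_hull_image[OF affine_fun_on_subset[OF h hull_mono[OF sub(1)]]]
      affine_fun_on_convex_hull_image[OF affine_fun_on_subset[OF h hull_mono[OF sub(2)]]] im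
    by simp_all
  obtain x y where x: "x \<in> convex hull (C \<inter> h -` M)" and y: "y \<in> convex hull (C \<inter> h -` P)" and "h x = h y"
    using MP(3) unfolding hull by blast
  moreover have "x \<in> convex hull C" "y \<in> convex hull C"
    using x y hull_mono[OF sub(1)] hull_mono[OF sub(2)] by blast+
  ultimately have "x = y" using inj by (meson inj_onD)
  moreover have "\<not> affine_dependent ((C \<inter> h -` M) \<union> (C \<inter> h -` P))"
    using C affine_independent_subset sub by (metis Un_least)
  moreover have "(C \<inter> h -` M) \<inter> (C \<inter> h -` P) = {}" using MP(1) by auto
  ultimately show False using x y convex_hull_Int[of "C \<inter> h -` M" "C \<inter> h -` P"] by auto
qed

text \<open>On a simplex of a triangulation for \<open>h\<close>, the images of the vertices are
  affinely independent, so some affine \<open>k\<close> sends them back. The composite of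
  \<open>h\<close> and \<open>k\<close> fixes the vertices and therefore the whole simplex, so the
  inverse agrees with \<open>k\<close> on its image.\<close>

lemma pl_on_inverse:
  fixes h :: "'a::euclidean_space \<Rightarrow> 'b::euclidean_space"
  assumes h: "pl_on X h" and inj: "inj_on h X"
  shows "pl_on (h ` X) (inv_into X h)"
proof -
  obtain T where T: "simplicial_complex T" "\<Union>T = X" "\<forall>\<sigma>\<in>T. affine_fun_on \<sigma> h"
    using h unfolding pl_on_def by blast
  show ?thesis
  proof (rule pl_onI)
    show "finite ((`) h ` T)" using T unfolding simplicial_complex_def by blast
    show "\<Union>((`) h ` T) = h ` X" using T by blast
    fix R assume "R \<in> (`) h ` T"
    then obtain \<sigma> where \<sigma>: "\<sigma> \<in> T" "R = h ` \<sigma>" by blast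
    then obtain n where "n simplex \<sigma>" using T unfolding simplicial_complex_def by blast
    then obtain C where C: "finite C" "\<not> affine_dependent C" "\<sigma> = convex hull C"
      unfolding simplex by blast
    have a: "affine_fun_on (convex hull C) h" using T \<sigma> C by blast
    show "polytope R" using a polytope_affine_image polytope_convex_hull C \<sigma> by blast
    have i: "inj_on h (convex hull C)" using inj T(2) \<sigma> C inj_on_subset by (metis Union_upper)
    obtain k where k: "affine_fun_on UNIV k" "\<forall>y\<in>h ` C. k y = inv_into X h y"
      using affine_extension[OF affine_independent_inj_image[OF a i C(2)]] by blast
    have sub: "convex hull C \<subseteq> X" using T \<sigma> C by blast
    have kh: "k (h x) = x" if x: "x \<in> convex hull C" for x
    proof (rule affine_fun_on_hull_eq[OF _ affine_fun_on_ident _ x])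
      show "affine_fun_on (convex hull C) (\<lambda>x. k (h x))"
        using affine_fun_on_compose[OF a] affine_fun_on_subset[OF k(1)] by blast
      show "k (h y) = y" if "y \<in> C" for y
        using k(2) that inj sub hull_inc[OF that] by (auto simp: inv_into_f_f subset_iff)
    qed
    show "affine_fun_on R (inv_into X h)"
    proof (rule affine_fun_on_cong[OF affine_fun_on_subset[OF k(1)]])
      fix y assume "y \<in> R"
      then obtain x where x: "x \<in> convex hull C" "y = h x" using \<sigma> C by blast
      then show "inv_into X h y = k y" using kh[OF x(1)] inj sub by (auto simp: inv_into_f_f subset_iff)
    qed auto
  qed
qed

lemma pl_on_homeomorphism:
  fixes h :: "'a::euclidean_space \<Rightarrow> 'b::euclidean_space"
  assumes h: "pl_on X h" and inj: "inj_on h X"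
  shows "homeomorphism X (h ` X) h (inv_into X h)"
  using pl_on_continuous[OF h] pl_on_continuous[OF pl_on_inverse[OF h inj]] inj
  by (auto simp: homeomorphism_def inv_into_f_f f_inv_into_f image_image)

lemma pl_homeomorphicI:
  fixes h :: "'a::euclidean_space \<Rightarrow> 'b::euclidean_space"
  assumes "pl_on X h" "inj_on h X" "h ` X = Y"
  shows "pl_homeomorphic X Y"
  unfolding pl_homeomorphic_def
  using pl_on_homeomorphism[OF assms(1,2)] pl_on_inverse[OF assms(1,2)] assms by blast

lemma pl_homeomorphicE:
  assumes "pl_homeomorphic X Y"
  obtains h where "pl_on X h" "inj_on h X" "h ` X = Y"
  using assms unfolding pl_homeomorphic_def homeomorphism_def by (metis inj_on_inverseI)

subsection \<open>Reweighting vertices\<close>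

text \<open>The vertices of a simplex can be recognised from the complex alone, as the points whose
  singletons belong to it. Values can thus be assigned to vertices once, consistently for all
  simplices.\<close>

lemma simplicial_complex_vertices:
  assumes K: "simplicial_complex K" and \<sigma>: "\<sigma> \<in> K"
  shows "\<not> affine_dependent {s\<in>\<sigma>. {s} \<in> K}" "\<sigma> = convex hull {s\<in>\<sigma>. {s} \<in> K}" "finite {s\<in>\<sigma>. {s} \<in> K}"
proof -
  obtain n where "n simplex \<sigma>" using assms unfolding simplicial_complex_def by blast
  then obtain C where C: "finite C" "\<not> affine_dependent C" "\<sigma> = convex hull C"
    unfolding simplex by blast
  have "C = {s\<in>\<sigma>. {s} \<in> K}"
  proof (intro equalityI subsetI)
    fix s assume s: "s \<in> C"
    then have "convex hull {s} face_of \<sigma>"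
      using face_of_convex_hull_affine_independent[OF C(2)] C(3) by blast
    then have "{s} \<in> K" using K \<sigma> unfolding simplicial_complex_def by auto
    then show "s \<in> {s\<in>\<sigma>. {s} \<in> K}" using s C(3) hull_inc by fastforce
  next
    fix s assume s: "s \<in> {s\<in>\<sigma>. {s} \<in> K}"
    then have "\<sigma> \<inter> {s} face_of \<sigma>" using K \<sigma> unfolding simplicial_complex_def by blast
    then have "{s} face_of convex hull C" using s C(3) by (simp add: Int_absorb1)
    then obtain c where c: "c \<subseteq> C" "{s} = convex hull c"
      using face_of_convex_hull_affine_independent[OF C(2)] by blast
    then have "c \<subseteq> {s}" "c \<noteq> {}" using hull_subset[of c convex] by auto
    then show "s \<in> C" using c(1) by blast
  qed
  then show "\<not> affine_dependent {s\<in>\<sigma>. {s} \<in> K}" "\<sigma> = convex hull {s\<in>\<sigma>. {s} \<in> K}" "finite {s\<in>\<sigma>. {s} \<in> K}"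
    using C by auto
qed

lemma simplicial_complex_Int:
  "simplicial_complex K \<Longrightarrow> \<sigma> \<in> K \<Longrightarrow> \<tau> \<in> K \<Longrightarrow> \<sigma> \<inter> \<tau> \<in> K"
  unfolding simplicial_complex_def by blast

lemma simplicial_complex_convex: "simplicial_complex M \<Longrightarrow> \<sigma> \<in> M \<Longrightarrow> convex \<sigma>"
  using convex_simplex unfolding simplicial_complex_def by blast

lemma simplicial_complex_affine_eq:
  assumes K: "simplicial_complex K" and \<sigma>: "\<sigma> \<in> K"
    and "affine_fun_on \<sigma> h" "affine_fun_on \<sigma> k" "\<And>s. s \<in> \<sigma> \<Longrightarrow> {s} \<in> K \<Longrightarrow> h s = k s" "x \<in> \<sigma>"
  shows "h x = k x"
  using affine_fun_on_hull_eq[of "{s\<in>\<sigma>. {s} \<in> K}" h k x]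
    simplicial_complex_vertices(2)[OF K \<sigma>] assms(3-) by auto

text \<open>The choice is harmless: on \<open>\<Union>K\<close> the value is determined by the
  vertices, and off it the function is never of interest. The general target type admits both scalar
  weights and weighted points.\<close>

definition simplicial_extension :: "'a::euclidean_space set set \<Rightarrow> ('a \<Rightarrow> 'b::real_vector) \<Rightarrow> 'a \<Rightarrow> 'b" where
  "simplicial_extension K w =
     (SOME h. (\<forall>\<sigma>\<in>K. affine_fun_on \<sigma> h) \<and> (\<forall>s. {s} \<in> K \<longrightarrow> h s = w s))"

text \<open>Affine extensions over two simplices agree on the intersection, because that is again a
  simplex of \<open>K\<close> and they agree at its vertices.\<close>

lemma simplicial_extension:
  fixes w :: "'a::euclidean_space \<Rightarrow> 'b::real_vector"
  assumes K: "simplicial_complex K"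
  shows "\<And>\<sigma>. \<sigma> \<in> K \<Longrightarrow> affine_fun_on \<sigma> (simplicial_extension K w)"
    "\<And>s. {s} \<in> K \<Longrightarrow> simplicial_extension K w s = w s"
proof -
  have "\<exists>h. affine_fun_on UNIV h \<and> (\<forall>s\<in>\<sigma>. {s} \<in> K \<longrightarrow> h s = w s)" if "\<sigma> \<in> K" for \<sigma>
    using affine_extension[OF simplicial_complex_vertices(1)[OF K that], of w] by blast
  then obtain a where a: "\<And>\<sigma>. \<sigma> \<in> K \<Longrightarrow> affine_fun_on UNIV (a \<sigma>)"
      "\<And>\<sigma> s. \<sigma> \<in> K \<Longrightarrow> s \<in> \<sigma> \<Longrightarrow> {s} \<in> K \<Longrightarrow> a \<sigma> s = w s"
    by metis
  define h where "h x = a (SOME \<sigma>. \<sigma> \<in> K \<and> x \<in> \<sigma>) x" for x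
  have h: "h x = a \<sigma> x" if \<sigma>: "\<sigma> \<in> K" "x \<in> \<sigma>" for x \<sigma>
  proof -
    define \<tau> where "\<tau> = (SOME \<sigma>. \<sigma> \<in> K \<and> x \<in> \<sigma>)"
    have \<tau>: "\<tau> \<in> K \<and> x \<in> \<tau>" unfolding \<tau>_def by (rule someI[of _ \<sigma>]) (use \<sigma> in blast)
    have "a \<tau> x = a \<sigma> x"
      by (rule simplicial_complex_affine_eq[OF K simplicial_complex_Int[OF K, of \<tau> \<sigma>]])
         (use \<tau> \<sigma> a in \<open>auto intro: affine_fun_on_subset\<close>)
    then show ?thesis unfolding h_def \<tau>_def .
  qed
  have "\<forall>\<sigma>\<in>K. affine_fun_on \<sigma> h"
    using h a(1) by (metis affine_fun_on_cong affine_fun_on_subset subset_UNIV)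
  moreover have "\<forall>s. {s} \<in> K \<longrightarrow> h s = w s" using h a(2) by auto
  ultimately have ex: "\<exists>h. (\<forall>\<sigma>\<in>K. affine_fun_on \<sigma> h) \<and> (\<forall>s. {s} \<in> K \<longrightarrow> h s = w s)" by blast
  show "\<And>\<sigma>. \<sigma> \<in> K \<Longrightarrow> affine_fun_on \<sigma> (simplicial_extension K w)"
    "\<And>s. {s} \<in> K \<Longrightarrow> simplicial_extension K w s = w s"
    using someI_ex[OF ex] unfolding simplicial_extension_def by blast+
qed

lemma simplicial_extension_eq:
  assumes K: "simplicial_complex K" and u: "\<And>\<sigma>. \<sigma> \<in> K \<Longrightarrow> affine_fun_on \<sigma> u"
    and "\<And>s. {s} \<in> K \<Longrightarrow> u s = w s" and x: "x \<in> \<Union>K"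
  shows "simplicial_extension K w x = u x"
proof -
  obtain \<sigma> where \<sigma>: "\<sigma> \<in> K" "x \<in> \<sigma>" using x by blast
  show ?thesis
    by (rule simplicial_complex_affine_eq[OF K \<sigma>(1) simplicial_extension(1)[OF K \<sigma>(1)] u[OF \<sigma>(1)] _ \<sigma>(2)])
       (simp add: simplicial_extension(2)[OF K] assms(3))
qed

text \<open>On a simplex, \<open>reweight\<close> multiplies barycentric coordinates by \<open>\<mu>\<close> and renormalises.\<close>

definition reweight :: "'a::euclidean_space set set \<Rightarrow> ('a \<Rightarrow> real) \<Rightarrow> 'a \<Rightarrow> 'a" where
  "reweight K \<mu> x =
     (1 / simplicial_extension K \<mu> x) *\<^sub>R simplicial_extension K (\<lambda>s. \<mu> s *\<^sub>R s) x"

text \<open>If \<open>x\<close> has barycentric coordinates \<open>c s\<close>, the extended weight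
  at \<open>x\<close> is the sum of the \<open>c s * \<mu> s\<close>, and \<open>reweight\<close>
  has these products, divided by their sum, as coordinates.\<close>

lemma reweight_mem:
  assumes K: "simplicial_complex K" and \<mu>: "\<And>s. {s} \<in> K \<Longrightarrow> \<mu> s > 0" and \<sigma>: "\<sigma> \<in> K" and x: "x \<in> \<sigma>"
  shows "simplicial_extension K \<mu> x > 0" "reweight K \<mu> x \<in> \<sigma>"
proof -
  define V where "V = {s\<in>\<sigma>. {s} \<in> K}"
  have V: "\<sigma> = convex hull V" "finite V" and VK: "\<And>s. s \<in> V \<Longrightarrow> {s} \<in> K"
    using simplicial_complex_vertices[OF K \<sigma>] unfolding V_def by auto
  obtain c where c: "\<And>s. s\<in>V \<Longrightarrow> 0 \<le> c s" "sum c V = 1" "(\<Sum>s\<in>V. c s *\<^sub>R s) = x"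
    using x V(1) unfolding convex_hull_finite[OF V(2)] by auto
  have ext: "simplicial_extension K w x = (\<Sum>s\<in>V. c s *\<^sub>R w s)" for w :: "'a \<Rightarrow> 'b::real_vector"
  proof -
    have "simplicial_extension K w (\<Sum>s\<in>V. c s *\<^sub>R s) = (\<Sum>s\<in>V. c s *\<^sub>R simplicial_extension K w s)"
      by (rule affine_fun_on_convex_sum[OF simplicial_extension(1)[OF K \<sigma>] c(2)])
         (use c(3) x in \<open>auto simp: V_def\<close>)
    then show ?thesis using c(3) VK by (simp add: simplicial_extension(2)[OF K])
  qed
  obtain s where s: "s \<in> V" "c s > 0"
    using c(1,2) by (metis less_eq_real_def sum.neutral zero_neq_one)
  have "0 < c s * \<mu> s" using s \<mu> VK by simp
  also have "c s * \<mu> s \<le> (\<Sum>s\<in>V. c s * \<mu> s)"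
    using member_le_sum[of s V "\<lambda>s. c s * \<mu> s"] s V(2) c(1) \<mu> VK by (simp add: less_imp_le)
  finally have pos: "0 < (\<Sum>s\<in>V. c s * \<mu> s)" .
  then show L: "simplicial_extension K \<mu> x > 0" using ext[of \<mu>] by simp
  let ?L = "\<Sum>s\<in>V. c s * \<mu> s"
  have "reweight K \<mu> x = (\<Sum>s\<in>V. (c s * \<mu> s / ?L) *\<^sub>R s)"
    unfolding reweight_def ext by (simp add: scaleR_sum_right)
  moreover have "(\<Sum>s\<in>V. (c s * \<mu> s / ?L) *\<^sub>R s) \<in> convex hull V"
    unfolding convex_hull_finite[OF V(2)]
    using c(1) pos \<mu> VK
    by (intro CollectI exI[of _ "\<lambda>s. c s * \<mu> s / ?L"])
       (auto simp: sum_divide_distrib[symmetric] less_imp_le)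
  ultimately show "reweight K \<mu> x \<in> \<sigma>" using V(1) by simp
qed

text \<open>If \<open>u x = L x + c\<close> on a simplex, the left side is \<open>L\<close> of the
  extended weighted points plus the extended weight times \<open>c\<close>; dividing by the extended
  weight gives \<open>u\<close> at the reweighted point. Neither the factor nor
  \<open>reweight\<close> depends on \<open>u\<close>, so one change of weights acts in parallel on
  a map and on its gauge.\<close>

lemma simplicial_extension_reweight:
  fixes u :: "'a::euclidean_space \<Rightarrow> 'b::real_vector"
  assumes K: "simplicial_complex K" and \<mu>: "\<And>s. {s} \<in> K \<Longrightarrow> \<mu> s > 0"
    and u: "\<And>\<sigma>. \<sigma> \<in> K \<Longrightarrow> affine_fun_on \<sigma> u" and x: "x \<in> \<Union>K"
  shows "simplicial_extension K (\<lambda>s. \<mu> s *\<^sub>R u s) x =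
         simplicial_extension K \<mu> x *\<^sub>R u (reweight K \<mu> x)"
proof -
  obtain \<sigma> where \<sigma>: "\<sigma> \<in> K" "x \<in> \<sigma>" using x by blast
  let ?M = "simplicial_extension K \<mu>" and ?R = "simplicial_extension K (\<lambda>s. \<mu> s *\<^sub>R s)"
  obtain L c where L: "linear L" "\<forall>x\<in>\<sigma>. u x = L x + c"
    using u[OF \<sigma>(1)] unfolding affine_fun_on_def by blast
  have pos: "?M x > 0" and mem: "reweight K \<mu> x \<in> \<sigma>"
    using reweight_mem[where \<mu>=\<mu>, OF K \<mu> \<sigma>] by blast+
  have "simplicial_extension K (\<lambda>s. \<mu> s *\<^sub>R u s) x = L (?R x) + ?M x *\<^sub>R c"
    by (rule simplicial_complex_affine_eq[OF K \<sigma>(1) _ _ _ \<sigma>(2)])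
       (use L \<sigma> in \<open>auto intro!: affine_fun_on_add affine_fun_on_compose_linear[OF _ L(1)]
          affine_fun_on_scaleR_const simplicial_extension(1)[OF K]
          simp: simplicial_extension(2)[OF K] linear_cmul scaleR_add_right\<close>)
  also have "\<dots> = ?M x *\<^sub>R u (reweight K \<mu> x)"
    using L mem pos by (simp add: reweight_def linear_cmul scaleR_add_right)
  finally show ?thesis .
qed

text \<open>Multiplying barycentric coordinates by \<open>\<mu>\<close> and then by
  \<open>1 / \<mu>\<close> restores them up to a common factor, which the normalisation removes. The
  extensions for the reciprocal weights take the part of \<open>u\<close> in
  \<open>simplicial_extension_reweight\<close>.\<close>

lemma reweight_inverse:
  assumes K: "simplicial_complex K" and \<mu>: "\<And>s. {s} \<in> K \<Longrightarrow> \<mu> s > 0" and x: "x \<in> \<Union>K"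
  shows "reweight K (\<lambda>s. 1 / \<mu> s) (reweight K \<mu> x) = x"
proof -
  obtain \<sigma> where \<sigma>: "\<sigma> \<in> K" "x \<in> \<sigma>" using x by blast
  let ?M = "simplicial_extension K \<mu> x" and ?y = "reweight K \<mu> x"
  have pos: "?M > 0"
    using reweight_mem(1)[where \<mu>=\<mu>, OF K \<mu> \<sigma>] by blast
  have "?M *\<^sub>R simplicial_extension K (\<lambda>s. (1 / \<mu> s) *\<^sub>R s) ?y =
        simplicial_extension K (\<lambda>s. \<mu> s *\<^sub>R simplicial_extension K (\<lambda>s. (1 / \<mu> s) *\<^sub>R s) s) x"
    by (rule simplicial_extension_reweight[symmetric, OF K \<mu> simplicial_extension(1)[OF K] x])
  also have "\<dots> = x"
  proof (rule simplicial_extension_eq[OF K affine_fun_on_ident _ x])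
    fix s assume s: "{s} \<in> K"
    then show "s = \<mu> s *\<^sub>R simplicial_extension K (\<lambda>s. (1 / \<mu> s) *\<^sub>R s) s"
      using \<mu>[OF s] by (simp add: simplicial_extension(2)[OF K s])
  qed
  finally have 1: "?M *\<^sub>R simplicial_extension K (\<lambda>s. (1 / \<mu> s) *\<^sub>R s) ?y = x" .
  have "?M *\<^sub>R simplicial_extension K (\<lambda>s. 1 / \<mu> s) ?y =
        simplicial_extension K (\<lambda>s. \<mu> s *\<^sub>R simplicial_extension K (\<lambda>s. 1 / \<mu> s) s) x"
    by (rule simplicial_extension_reweight[symmetric, OF K \<mu> simplicial_extension(1)[OF K] x])
  also have "\<dots> = 1"
  proof (rule simplicial_extension_eq[OF K affine_fun_on_const _ x])
    fix s assume s: "{s} \<in> K"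
    then show "1 = \<mu> s *\<^sub>R simplicial_extension K (\<lambda>s. 1 / \<mu> s) s"
      using \<mu>[OF s] by (simp add: simplicial_extension(2)[OF K s])
  qed
  finally have 2: "?M * simplicial_extension K (\<lambda>s. 1 / \<mu> s) ?y = 1" by simp
  then have "1 / simplicial_extension K (\<lambda>s. 1 / \<mu> s) ?y = ?M"
    using pos by (metis nonzero_eq_divide_eq mult_zero_right zero_neq_one)
  then show ?thesis unfolding reweight_def[of _ "\<lambda>s. 1 / \<mu> s"] using 1 by simp
qed

lemma reweight_bij:
  assumes K: "simplicial_complex K" and \<mu>: "\<And>s. {s} \<in> K \<Longrightarrow> \<mu> s > 0"
  shows "bij_betw (reweight K \<mu>) (\<Union>K) (\<Union>K)"
proof (rule bij_betw_byWitness[where f' = "reweight K (\<lambda>s. 1 / \<mu> s)"])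
  show "\<forall>x\<in>\<Union>K. reweight K (\<lambda>s. 1 / \<mu> s) (reweight K \<mu> x) = x"
    using reweight_inverse[of K \<mu>, OF K \<mu>] by blast
  show "\<forall>x\<in>\<Union>K. reweight K \<mu> (reweight K (\<lambda>s. 1 / \<mu> s) x) = x"
    using reweight_inverse[of K "\<lambda>s. 1 / \<mu> s", OF K] \<mu> by simp
  show "reweight K \<mu> ` \<Union>K \<subseteq> \<Union>K" using reweight_mem(2)[of K \<mu>, OF K \<mu>] by blast
  show "reweight K (\<lambda>s. 1 / \<mu> s) ` \<Union>K \<subseteq> \<Union>K"
    using reweight_mem(2)[of K "\<lambda>s. 1 / \<mu> s", OF K] \<mu> by fastforce
qed

text \<open>Injectivity on open rays from the origin, stated without choosing a sphere to project
  to; \<open>t = 1\<close> gives ordinary injectivity. That \<open>\<psi>\<close> avoids the origin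
  is expressed separately, by the value of \<open>ray_span\<close>.\<close>

definition conic_inj :: "'a set \<Rightarrow> ('a \<Rightarrow> 'b::real_vector) \<Rightarrow> bool" where
  "conic_inj X \<psi> \<longleftrightarrow> (\<forall>x\<in>X. \<forall>y\<in>X. \<forall>t>0. \<psi> x = t *\<^sub>R \<psi> y \<longrightarrow> x = y)"

definition ray_span :: "'b::real_vector set \<Rightarrow> 'b set" where
  "ray_span Y = {t *\<^sub>R y | t y. t > 0 \<and> y \<in> Y}"

lemma conic_inj_reweight:
  fixes \<psi> :: "'a::euclidean_space \<Rightarrow> 'b::real_vector"
  assumes K: "simplicial_complex K" and \<mu>: "\<And>s. {s} \<in> K \<Longrightarrow> \<mu> s > 0"
    and aff: "\<And>\<sigma>. \<sigma> \<in> K \<Longrightarrow> affine_fun_on \<sigma> \<psi>" and \<psi>: "conic_inj (\<Union>K) \<psi>"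
  defines "h \<equiv> simplicial_extension K (\<lambda>s. \<mu> s *\<^sub>R \<psi> s)"
  shows "conic_inj (\<Union>K) h" "ray_span (h ` \<Union>K) = ray_span (\<psi> ` \<Union>K)"
proof -
  let ?r = "reweight K \<mu>" and ?M = "simplicial_extension K \<mu>"
  have h: "h x = ?M x *\<^sub>R \<psi> (?r x)" if "x \<in> \<Union>K" for x
    unfolding h_def using simplicial_extension_reweight[OF K \<mu> aff that] .
  have M: "?M x > 0" and r: "?r x \<in> \<Union>K" if "x \<in> \<Union>K" for x
    using reweight_mem[of K \<mu>, OF K \<mu>] that by blast+
  have bij: "bij_betw ?r (\<Union>K) (\<Union>K)" using reweight_bij[of K \<mu>, OF K \<mu>] .
  show "conic_inj (\<Union>K) h"
    unfolding conic_inj_def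
  proof (intro ballI allI impI)
    fix x y and t :: real assume *: "x \<in> \<Union>K" "y \<in> \<Union>K" "0 < t" "h x = t *\<^sub>R h y"
    have "\<psi> (?r x) = (1 / ?M x) *\<^sub>R h x" using h[OF *(1)] M[OF *(1)] by simp
    also have "\<dots> = (t * ?M y / ?M x) *\<^sub>R \<psi> (?r y)" using *(4) h[OF *(2)] by simp
    finally have "?r x = ?r y"
      using \<psi> r[OF *(1)] r[OF *(2)] M[OF *(1)] M[OF *(2)] *(3) unfolding conic_inj_def
      by (meson divide_pos_pos mult_pos_pos)
    then show "x = y" using bij *(1,2) by (meson bij_betw_imp_inj_on inj_onD)
  qed
  show "ray_span (h ` \<Union>K) = ray_span (\<psi> ` \<Union>K)"
  proof (intro equalityI subsetI)
    fix z assume "z \<in> ray_span (h ` \<Union>K)"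
    then obtain t x where z: "t > 0" "x \<in> \<Union>K" "z = t *\<^sub>R h x" unfolding ray_span_def by blast
    then have "z = (t * ?M x) *\<^sub>R \<psi> (?r x)" using h by simp
    moreover have "t * ?M x > 0" using z M by simp
    ultimately show "z \<in> ray_span (\<psi> ` \<Union>K)" unfolding ray_span_def using r[OF z(2)] by blast
  next
    fix z assume "z \<in> ray_span (\<psi> ` \<Union>K)"
    then obtain t y where z: "t > 0" "y \<in> \<Union>K" "z = t *\<^sub>R \<psi> y" unfolding ray_span_def by blast
    obtain x where x: "x \<in> \<Union>K" "y = ?r x" using bij z(2) unfolding bij_betw_def by blast
    then have "z = (t / ?M x) *\<^sub>R h x" using h z(3) M[OF x(1)] by simp
    moreover have "t / ?M x > 0" using z M[OF x(1)] by simp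
    ultimately show "z \<in> ray_span (h ` \<Union>K)" unfolding ray_span_def using x(1) by blast
  qed
qed

text \<open>The weights \<open>1 / N (\<psi> s)\<close> make the gauge equal to 1 at the vertices.
  Since \<open>N\<close> of \<open>\<psi>\<close> is affine on the simplices of \<open>K\<close> as
  well, the gauge of the reweighted map is the extension of its vertex values, hence 1 everywhere.
  This is a PL substitute for dividing \<open>\<psi>\<close> by its gauge, with an image on the same
  rays.\<close>

lemma pl_on_normalize:
  fixes \<psi> :: "'a::euclidean_space \<Rightarrow> 'b::euclidean_space" and N :: "'b \<Rightarrow> real"
  assumes \<psi>: "pl_on X \<psi>" and inj: "conic_inj X \<psi>"
    and N\<psi>: "pl_on X (\<lambda>x. N (\<psi> x))" and pos: "\<And>x. x \<in> X \<Longrightarrow> N (\<psi> x) > 0"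
    and hom: "\<And>t y. t > 0 \<Longrightarrow> N (t *\<^sub>R y) = t * N y"
  obtains h where "pl_on X h" "inj_on h X" "h ` X = {y \<in> ray_span (\<psi> ` X). N y = 1}"
proof -
  obtain K where K: "simplicial_complex K" "\<Union>K = X" "\<forall>\<sigma>\<in>K. affine_fun_on \<sigma> (\<lambda>x. (\<psi> x, N (\<psi> x)))"
    using pl_on_Pair[OF \<psi> N\<psi>] unfolding pl_on_def by blast
  have a1: "\<And>\<sigma>. \<sigma> \<in> K \<Longrightarrow> affine_fun_on \<sigma> \<psi>" and a2: "\<And>\<sigma>. \<sigma> \<in> K \<Longrightarrow> affine_fun_on \<sigma> (\<lambda>x. N (\<psi> x))"
    using K(3) affine_fun_on_compose_linear[OF _ linear_fst] affine_fun_on_compose_linear[OF _ linear_snd]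
    by fastforce+
  define \<mu> where "\<mu> s = 1 / N (\<psi> s)" for s
  have \<mu>: "\<And>s. {s} \<in> K \<Longrightarrow> \<mu> s > 0" using pos K(2) by (auto simp: \<mu>_def)
  define h where "h = simplicial_extension K (\<lambda>s. \<mu> s *\<^sub>R \<psi> s)"
  have inj': "conic_inj X \<psi>" "conic_inj (\<Union>K) \<psi>" using inj K(2) by auto
  have ch: "conic_inj X h" "ray_span (h ` X) = ray_span (\<psi> ` X)"
    using conic_inj_reweight[of K \<mu> \<psi>, OF K(1) \<mu> a1 inj'(2)] K(2) by (auto simp: h_def)
  have Nh: "N (h x) = 1" if x: "x \<in> X" for x
  proof -
    have xK: "x \<in> \<Union>K" using x K by blast
    obtain \<sigma> where "\<sigma> \<in> K" "x \<in> \<sigma>" using xK by blast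
    then have M: "simplicial_extension K \<mu> x > 0" using reweight_mem(1)[of K \<mu>, OF K(1) \<mu>] by simp
    have "h x = simplicial_extension K \<mu> x *\<^sub>R \<psi> (reweight K \<mu> x)"
      unfolding h_def using simplicial_extension_reweight[of K \<mu> \<psi>, OF K(1) \<mu> a1 xK] .
    then have "N (h x) = simplicial_extension K \<mu> x * N (\<psi> (reweight K \<mu> x))"
      using hom[OF M] by simp
    also have "\<dots> = simplicial_extension K (\<lambda>s. \<mu> s *\<^sub>R N (\<psi> s)) x"
      using simplicial_extension_reweight[of K \<mu> "\<lambda>x. N (\<psi> x)", OF K(1) \<mu> a2 xK] by simp
    also have "\<dots> = 1"
    proof (rule simplicial_extension_eq[OF K(1) affine_fun_on_const _ xK])
      fix s assume "{s} \<in> K"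
      then have "s \<in> X" using K(2) by blast
      then show "1 = \<mu> s *\<^sub>R N (\<psi> s)" using pos[of s] by (simp add: \<mu>_def)
    qed
    finally show ?thesis .
  qed
  show ?thesis
  proof
    show "pl_on X h" unfolding pl_on_def
      using K(1,2) simplicial_extension(1)[OF K(1)] h_def by blast
    show "inj_on h X"
      using ch(1) unfolding conic_inj_def inj_on_def by (metis scaleR_one zero_less_one)
    show "h ` X = {y \<in> ray_span (\<psi> ` X). N y = 1}"
    proof (intro equalityI subsetI)
      fix y assume "y \<in> h ` X"
      then obtain x where "x \<in> X" "y = 1 *\<^sub>R h x" by auto
      then show "y \<in> {y \<in> ray_span (\<psi> ` X). N y = 1}"
        using Nh unfolding ch(2)[symmetric] by (auto simp: ray_span_def intro!: exI[of _ 1])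
    next
      fix y assume y: "y \<in> {y \<in> ray_span (\<psi> ` X). N y = 1}"
      then obtain t x where t: "t > 0" "x \<in> X" "y = t *\<^sub>R h x"
        unfolding ch(2)[symmetric] unfolding ray_span_def by blast
      then have "t = 1" using y hom Nh by simp
      then show "y \<in> h ` X" using t by auto
    qed
  qed
qed

subsection \<open>The gauge of a model simplex\<close>

text \<open>The model simplex is \<open>{x \<in> span D. x\<^sub>i \<ge> - 1, \<Sum>x\<^sub>i \<le> 1}\<close>, which has the origin in its relative
  interior; its gauge is the maximum of the functionals that equal \<open>1\<close> on its facets.\<close>

definition simplex_gauge :: "'a::euclidean_space set \<Rightarrow> 'a \<Rightarrow> real" where
  "simplex_gauge D x = Max (insert (\<Sum>i\<in>D. x \<bullet> i) ((\<lambda>i. - (x \<bullet> i)) ` D))"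

definition model_simplex :: "'a::euclidean_space set \<Rightarrow> 'a set" where
  "model_simplex D = {x \<in> span D. simplex_gauge D x \<le> 1}"

definition model_sphere :: "'a::euclidean_space set \<Rightarrow> 'a set" where
  "model_sphere D = {x \<in> span D. simplex_gauge D x = 1}"

context
  fixes D :: "'a::euclidean_space set"
  assumes D: "D \<subseteq> Basis"
begin

lemma finite_subset_Basis: "finite D"
  using D finite_Basis finite_subset by blast

lemma simplex_gauge_le_iff: "simplex_gauge D x \<le> c \<longleftrightarrow> (\<Sum>i\<in>D. x \<bullet> i) \<le> c \<and> (\<forall>i\<in>D. - (x \<bullet> i) \<le> c)"
  unfolding simplex_gauge_def using finite_subset_Basis by (subst Max_le_iff) auto

lemma simplex_gauge_less_iff: "simplex_gauge D x < c \<longleftrightarrow> (\<Sum>i\<in>D. x \<bullet> i) < c \<and> (\<forall>i\<in>D. - (x \<bullet> i) < c)"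
  unfolding simplex_gauge_def using finite_subset_Basis by (subst Max_less_iff) auto

lemma simplex_gauge_scaleR:
  assumes "t > 0" shows "simplex_gauge D (t *\<^sub>R x) = t * simplex_gauge D x"
proof -
  have "simplex_gauge D (t *\<^sub>R x) \<le> c \<longleftrightarrow> t * simplex_gauge D x \<le> c" for c
  proof -
    have "simplex_gauge D (t *\<^sub>R x) \<le> c \<longleftrightarrow> simplex_gauge D x \<le> c / t"
      using assms by (simp add: simplex_gauge_le_iff sum_distrib_left[symmetric] pos_le_divide_eq mult.commute)
    then show ?thesis using assms by (simp add: pos_le_divide_eq mult.commute)
  qed
  then show ?thesis by (meson dual_order.antisym order_refl)
qed

lemma simplex_gauge_0: "simplex_gauge D 0 = 0"
  unfolding simplex_gauge_def using finite_subset_Basis by (intro Max_eqI) auto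

text \<open>The functionals whose maximum is taken add up to zero, so they cannot all be
  negative.\<close>

lemma simplex_gauge_nonneg: "simplex_gauge D x \<ge> 0"
proof (rule ccontr)
  assume "\<not> simplex_gauge D x \<ge> 0"
  then have "(\<Sum>i\<in>D. x \<bullet> i) < 0" "\<forall>i\<in>D. - (x \<bullet> i) < 0"
    using simplex_gauge_less_iff[of x 0] by auto
  then show False using sum_nonneg[of D "\<lambda>i. x \<bullet> i"] by fastforce
qed

lemma span_subset_Basis_iff: "x \<in> span D \<longleftrightarrow> (\<forall>i\<in>Basis. i \<notin> D \<longrightarrow> x \<bullet> i = 0)"
  using span_substd_basis[OF D] by blast

lemma simplex_gauge_pos:
  assumes x: "x \<in> span D" "x \<noteq> 0" shows "simplex_gauge D x > 0"
proof (rule ccontr)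
  assume "\<not> simplex_gauge D x > 0"
  then have "(\<Sum>i\<in>D. x \<bullet> i) \<le> 0" and nn: "\<forall>i\<in>D. x \<bullet> i \<ge> 0" using simplex_gauge_le_iff[of x 0] by auto
  then have "(\<Sum>i\<in>D. x \<bullet> i) = 0" using sum_nonneg[of D "\<lambda>i. x \<bullet> i"] by fastforce
  then have "\<forall>i\<in>D. x \<bullet> i = 0" using sum_nonneg_eq_0_iff[OF finite_subset_Basis, of "\<lambda>i. x \<bullet> i"] nn by auto
  then have "\<forall>i\<in>Basis. x \<bullet> i = 0" using x(1) span_subset_Basis_iff by blast
  then show False using x(2) euclidean_all_zero_iff by blast
qed

lemma simplex_gauge_cong: "(\<And>i. i \<in> D \<Longrightarrow> x \<bullet> i = y \<bullet> i) \<Longrightarrow> simplex_gauge D x = simplex_gauge D y"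
  unfolding simplex_gauge_def by (metis (mono_tags, lifting) image_cong sum.cong)

lemma pl_on_simplex_gauge:
  fixes h :: "'b::euclidean_space \<Rightarrow> 'a"
  assumes h: "pl_on X h"
  shows "pl_on X (\<lambda>x. simplex_gauge D (h x))"
proof -
  have c: "pl_on X (\<lambda>x. h x \<bullet> i)" for i
    by (rule pl_on_affine[OF h]) (intro affine_fun_on_linear linearI, auto simp: inner_add_left)
  have s: "pl_on X (\<lambda>x. h x \<bullet> (\<Sum>i\<in>D. i))" by (rule c)
  have "simplex_gauge D (h x) = max (h x \<bullet> (\<Sum>i\<in>D. i)) (Max ((\<lambda>i. - (h x \<bullet> i)) ` D))" if "D \<noteq> {}" for x
    unfolding simplex_gauge_def using finite_subset_Basis that by (simp add: inner_sum_right)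
  moreover have "simplex_gauge D (h x) = h x \<bullet> (\<Sum>i\<in>D. i)" if "D = {}" for x
    unfolding simplex_gauge_def using that by simp
  moreover have "pl_on X (\<lambda>x. max (h x \<bullet> (\<Sum>i\<in>D. i)) (Max ((\<lambda>i. - (h x \<bullet> i)) ` D)))" if "D \<noteq> {}"
    using finite_subset_Basis that by (intro pl_on_max s pl_on_Max pl_on_uminus c)
  ultimately show ?thesis using s by (cases "D = {}") auto
qed

text \<open>The standard simplex is translated so that its corner \<open>0\<close> goes to the point
  with all coordinates \<open>-1\<close>, and scaled. The factor \<open>card D + 1\<close> is the
  one for which coordinate sum 1 goes to coordinate sum 1, since the translation lowers the sum by
  \<open>card D\<close>.\<close>

lemma model_simplex_eq:
  "model_simplex D =
     (\<lambda>x. - (\<Sum>i\<in>D. i) + (real (card D) + 1) *\<^sub>R x) ` (convex hull (insert 0 D))"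
proof -
  let ?n = "real (card D) + 1" and ?o = "\<Sum>i\<in>D. i"
  have n: "?n > 0" by simp
  have o: "?o \<bullet> i = (if i \<in> D then 1 else 0)" if "i \<in> Basis" for i
  proof -
    have "?o \<bullet> i = (\<Sum>j\<in>D. if j = i then 1 else 0)"
      unfolding inner_sum_left using D that by (intro sum.cong) (auto simp: inner_Basis)
    then show ?thesis using finite_subset_Basis by simp
  qed
  have oD: "?o \<bullet> i = 1" if "i \<in> D" for i using o[of i] D that by auto
  have mem: "- ?o + ?n *\<^sub>R x \<in> model_simplex D \<longleftrightarrow> x \<in> convex hull (insert 0 D)" for x
  proof -
    have "(\<Sum>i\<in>D. (- ?o + ?n *\<^sub>R x) \<bullet> i) = (\<Sum>i\<in>D. - 1 + ?n * (x \<bullet> i))"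
      by (intro sum.cong refl) (simp add: inner_add_left inner_diff_left oD)
    also have "\<dots> = - real (card D) + ?n * (\<Sum>i\<in>D. x \<bullet> i)"
      by (simp add: sum.distrib sum_distrib_left sum_subtractf)
    finally have s: "(\<Sum>i\<in>D. (- ?o + ?n *\<^sub>R x) \<bullet> i) = - real (card D) + ?n * (\<Sum>i\<in>D. x \<bullet> i)" .
    have "(\<Sum>i\<in>D. (- ?o + ?n *\<^sub>R x) \<bullet> i) \<le> 1 \<longleftrightarrow> ?n * (\<Sum>i\<in>D. x \<bullet> i) \<le> ?n * 1"
      unfolding s by (simp add: algebra_simps)
    also have "\<dots> \<longleftrightarrow> (\<Sum>i\<in>D. x \<bullet> i) \<le> 1" using n by (rule mult_le_cancel_left_pos)
    finally have 1: "(\<Sum>i\<in>D. (- ?o + ?n *\<^sub>R x) \<bullet> i) \<le> 1 \<longleftrightarrow> (\<Sum>i\<in>D. x \<bullet> i) \<le> 1" .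
    have 2: "- ((- ?o + ?n *\<^sub>R x) \<bullet> i) \<le> 1 \<longleftrightarrow> 0 \<le> x \<bullet> i" if "i \<in> D" for i
      using n by (simp add: inner_add_left inner_diff_left oD[OF that] zero_le_mult_iff)
    have 3: "(- ?o + ?n *\<^sub>R x) \<bullet> i = 0 \<longleftrightarrow> x \<bullet> i = 0" if "i \<in> Basis" "i \<notin> D" for i
      using n that by (simp add: inner_add_left inner_diff_left o)
    show ?thesis
      unfolding model_simplex_def substd_simplex[OF D] mem_Collect_eq simplex_gauge_le_iff span_subset_Basis_iff
      using 1 2 3 D by (smt (verit) subsetD)
  qed
  show ?thesis
  proof (intro equalityI subsetI)
    fix y assume y: "y \<in> model_simplex D"
    have "y = - ?o + ?n *\<^sub>R ((1 / ?n) *\<^sub>R (?o + y))" using n by simp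
    then show "y \<in> (\<lambda>x. - ?o + ?n *\<^sub>R x) ` (convex hull (insert 0 D))"
      using mem y by (metis (no_types, lifting) imageI)
  qed (use mem in auto)
qed

lemma independent_insert_0: "\<not> affine_dependent (insert 0 D)"
proof -
  have "independent D" using D independent_Basis independent_mono by blast
  then show ?thesis
    using affine_dependent_iff_dependent[of 0 D] D nonzero_Basis by auto
qed

lemma model_simplex: "int (card D) simplex (model_simplex D)"
proof -
  let ?h = "\<lambda>x. - (\<Sum>i\<in>D. i) + (real (card D) + 1) *\<^sub>R x"
  have inj: "inj ?h" by (auto simp: inj_on_def)
  have h: "affine_fun_on S ?h" for S
    by (intro affine_fun_on_add affine_fun_on_const affine_fun_on_scaleR affine_fun_on_ident)
  have 1: "\<not> affine_dependent (?h ` insert 0 D)"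
    using affine_independent_inj_image[OF h _ independent_insert_0] inj inj_on_subset by blast
  have "card (?h ` insert 0 D) = card (insert 0 D)"
    using inj inj_on_subset by (intro card_image) blast
  also have "\<dots> = card D + 1"
  proof -
    have "0 \<notin> D" using D nonzero_Basis by blast
    then show ?thesis using finite_subset_Basis by simp
  qed
  finally have "int (card (?h ` insert 0 D)) = int (card D) + 1" by simp
  then show ?thesis
    unfolding model_simplex_eq affine_fun_on_convex_hull_image[OF h]
    by (intro simplex_convex_hull conjI 1)
qed

text \<open>The points of gauge below 1 form a relatively open set. Conversely, a relative interior
  point other than \<open>0\<close> can be pushed outward along its ray without leaving the simplex,
  which multiplies its gauge by a factor above 1.\<close>

lemma rel_frontier_model_simplex: "rel_frontier (model_simplex D) = model_sphere D"
proof -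
  have cl: "closure (model_simplex D) = model_simplex D"
    using model_simplex closed_simplex closure_closed by blast
  have "{x \<in> span D. simplex_gauge D x < 1} \<subseteq> rel_interior (model_simplex D)"
  proof (rule rel_interior_maximal)
    show "{x \<in> span D. simplex_gauge D x < 1} \<subseteq> model_simplex D" by (auto simp: model_simplex_def)
    have op: "open {x. simplex_gauge D x < 1}"
    proof -
      have "{x. simplex_gauge D x < 1} = {x. (\<Sum>i\<in>D. x \<bullet> i) < 1} \<inter> (\<Inter>i\<in>D. {x. - (x \<bullet> i) < 1})"
        by (auto simp: simplex_gauge_less_iff)
      then show ?thesis using finite_subset_Basis
        by (auto intro!: open_Int open_INT open_Collect_less continuous_intros)
    qed
    have "affine hull (model_simplex D) \<subseteq> span D"
      by (rule hull_minimal) (auto simp: model_simplex_def subspace_imp_affine)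
    moreover have "{x \<in> span D. simplex_gauge D x < 1} \<subseteq> affine hull (model_simplex D)"
      using hull_subset[of "model_simplex D" affine] by (auto simp: model_simplex_def)
    ultimately have "{x \<in> span D. simplex_gauge D x < 1} = affine hull (model_simplex D) \<inter> {x. simplex_gauge D x < 1}"
      by auto
    then show "openin (top_of_set (affine hull model_simplex D)) {x \<in> span D. simplex_gauge D x < 1}"
      using op by (metis openin_open_Int)
  qed
  moreover have "\<forall>x\<in>rel_interior (model_simplex D). simplex_gauge D x < 1"
  proof
    fix x assume x: "x \<in> rel_interior (model_simplex D)"
    show "simplex_gauge D x < 1"
  proof (cases "x = 0")
    case False
    have xm: "x \<in> model_simplex D" using x rel_interior_subset by blast
    obtain e where e: "e > 0" "ball x e \<inter> affine hull (model_simplex D) \<subseteq> model_simplex D"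
      using x unfolding mem_rel_interior_ball by blast
    have z: "0 \<in> model_simplex D" by (simp add: model_simplex_def simplex_gauge_0 span_zero)
    \<comment> \<open>The factor \<open>1 + t\<close> moves \<open>x\<close> by
      \<open>e / 2\<close>, so the new point is still in the ball.\<close>
    define t where "t = e / (2 * norm x)"
    have t: "t > 0" using e False by (simp add: t_def)
    have "(1 + t) *\<^sub>R x \<in> affine hull (model_simplex D)"
    proof -
      have "(- t) *\<^sub>R 0 + (1 + t) *\<^sub>R x \<in> affine hull (model_simplex D)"
        by (rule mem_affine[OF affine_affine_hull]) (use z xm hull_inc in auto)
      then show ?thesis by simp
    qed
    moreover have "(1 + t) *\<^sub>R x \<in> ball x e"
      using e False by (simp add: dist_norm t_def scaleR_add_left)
    ultimately have "simplex_gauge D ((1 + t) *\<^sub>R x) \<le> 1" using e(2) by (auto simp: model_simplex_def)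
    then have "(1 + t) * simplex_gauge D x \<le> 1" using simplex_gauge_scaleR[of "1 + t" x] t by simp
    then have le: "simplex_gauge D x + t * simplex_gauge D x \<le> 1" by (simp add: algebra_simps)
    show ?thesis
    proof (cases "simplex_gauge D x = 0")
      case False
      then have "t * simplex_gauge D x > 0" using t simplex_gauge_nonneg[of x] by simp
      then show ?thesis using le by linarith
    qed simp
    qed (simp add: simplex_gauge_0)
  qed
  moreover have "model_simplex D = {x \<in> span D. simplex_gauge D x < 1} \<union> model_sphere D"
    "{x \<in> span D. simplex_gauge D x < 1} \<inter> model_sphere D = {}"
    by (auto simp: model_simplex_def model_sphere_def)
  ultimately show ?thesis
    unfolding rel_frontier_def cl using rel_interior_subset[of "model_simplex D"]
    by (auto simp: model_sphere_def)
qed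

end

lemma simplex_affine_iso:
  fixes \<Delta> :: "'a::euclidean_space set" and \<Delta>' :: "'b::euclidean_space set"
  assumes "n simplex \<Delta>" "n simplex \<Delta>'"
  obtains h where "affine_fun_on UNIV h" "inj_on h \<Delta>" "h ` \<Delta> = \<Delta>'"
proof -
  obtain C where C: "finite C" "\<not> affine_dependent C" "int (card C) = n + 1" "\<Delta> = convex hull C"
    using assms(1) unfolding simplex by blast
  obtain C' where C': "finite C'" "\<not> affine_dependent C'" "int (card C') = n + 1" "\<Delta>' = convex hull C'"
    using assms(2) unfolding simplex by blast
  have "card C = card C'" using C(3) C'(3) by simp
  then obtain b where b: "bij_betw b C C'" using finite_same_card_bij[OF C(1) C'(1)] by blast
  obtain h where h: "affine_fun_on UNIV h" "\<forall>x\<in>C. h x = b x" using affine_extension[OF C(2)] by blast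
  obtain k where k: "affine_fun_on UNIV k" "\<forall>y\<in>C'. k y = inv_into C b y"
    using affine_extension[OF C'(2)] by blast
  have hC: "affine_fun_on (convex hull C) h" using h(1) affine_fun_on_subset by blast
  have "h ` C = C'" using b h(2) unfolding bij_betw_def by (metis image_cong)
  then have im: "h ` \<Delta> = \<Delta>'" unfolding C(4) C'(4) using affine_fun_on_convex_hull_image[OF hC] by simp
  have "k (h x) = x" if x: "x \<in> \<Delta>" for x
  proof (rule affine_fun_on_hull_eq[OF _ affine_fun_on_ident])
    show "affine_fun_on (convex hull C) (\<lambda>x. k (h x))"
      using affine_fun_on_compose[OF hC] affine_fun_on_subset[OF k(1)] by blast
    show "x \<in> convex hull C" using x C by simp
    show "k (h y) = y" if y: "y \<in> C" for y
      using y b h(2) k(2) unfolding bij_betw_def by (metis image_eqI inv_into_f_f)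
  qed
  then have "inj_on h \<Delta>" by (rule inj_on_inverseI)
  then show ?thesis using that h(1) im by blast
qed

lemma pl_ball_model:
  fixes X :: "'a::euclidean_space set" and D :: "'a set"
  assumes D: "D \<subseteq> Basis" and X: "pl_ball (int (card D)) X"
  obtains h where "pl_on X h" "inj_on h X" "h ` X = model_simplex D"
proof -
  obtain \<Delta> :: "'a set" where \<Delta>: "int (card D) simplex \<Delta>" "pl_homeomorphic X \<Delta>"
    using X unfolding pl_ball_def by blast
  obtain g where g: "pl_on X g" "inj_on g X" "g ` X = \<Delta>" using pl_homeomorphicE[OF \<Delta>(2)] .
  obtain k where k: "affine_fun_on UNIV k" "inj_on k \<Delta>" "k ` \<Delta> = model_simplex D"
    using simplex_affine_iso[OF \<Delta>(1) model_simplex[OF D]] .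
  show ?thesis
  proof
    show "pl_on X (\<lambda>x. k (g x))" using pl_on_affine[OF g(1)] affine_fun_on_subset[OF k(1)] by blast
    show "inj_on (\<lambda>x. k (g x)) X" using comp_inj_on[of g X k] g k by (simp add: o_def)
    show "(\<lambda>x. k (g x)) ` X = model_simplex D" using g(3) k(3) by (metis image_image)
  qed
qed

subsection \<open>Spheres separated into two balls\<close>

text \<open>If a point \<open>a\<close> were missed, removing it would turn the target sphere into
  an affine space \<open>V\<close> of the same dimension. By invariance of domain the image in
  \<open>V\<close> would be open, and by compactness closed, so it would be all of \<open>V\<close>;
  but only a point is a bounded nonempty affine space.\<close>

lemma sphere_self_embedding_surj:
  fixes f :: "'a::euclidean_space \<Rightarrow> 'b::euclidean_space"
  assumes U: "convex U" "bounded U" and W: "convex W" "bounded W"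
    and dim: "aff_dim U = aff_dim W" "aff_dim U \<ge> 1"
    and f: "continuous_on (rel_frontier U) f" "inj_on f (rel_frontier U)" "f ` rel_frontier U \<subseteq> rel_frontier W"
  shows "f ` rel_frontier U = rel_frontier W"
proof (rule ccontr)
  assume "f ` rel_frontier U \<noteq> rel_frontier W"
  then obtain a where a: "a \<in> rel_frontier W" "a \<notin> f ` rel_frontier U" using f(3) by blast
  obtain V :: "'b set" where V: "affine V" "aff_dim V = aff_dim W - 1"
    using choose_affine_subset[of "UNIV :: 'b set" "aff_dim W - 1"] dim aff_dim_le_DIM[of W]
    by auto
  have "rel_frontier W - {a} homeomorphic V"
    by (rule homeomorphic_punctured_sphere_affine_gen) (use W a V in auto)
  then obtain g k where gk: "homeomorphism (rel_frontier W - {a}) V g k"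
    unfolding homeomorphic_def by blast
  have fim: "f ` rel_frontier U \<subseteq> rel_frontier W - {a}" using f(3) a by blast
  define F where "F = g \<circ> f"
  have Fc: "continuous_on (rel_frontier U) F"
    unfolding F_def by (intro continuous_on_compose f(1))
      (meson fim gk continuous_on_subset homeomorphism_def)
  have Fi: "inj_on F (rel_frontier U)"
    unfolding F_def
  proof (rule comp_inj_on[OF f(2)])
    show "inj_on g (f ` rel_frontier U)"
      using gk fim by (metis homeomorphism_apply1 inj_on_inverseI inj_on_subset)
  qed
  have FV: "F ` rel_frontier U \<subseteq> V"
    unfolding F_def using gk fim homeomorphism_image1 by fastforce
  have "openin (top_of_set V) (F ` rel_frontier U)"
    by (rule invariance_of_domain_sphere_affine_set_gen[OF Fc Fi _ U(2,1) V(1)])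
       (use FV V dim in auto)
  moreover have cpt: "compact (F ` rel_frontier U)"
    using Fc U by (intro compact_continuous_image compact_rel_frontier_bounded)
  then have "closedin (top_of_set V) (F ` rel_frontier U)"
    using FV by (simp add: closed_subset compact_imp_closed)
  moreover have "connected V" using V(1) affine_imp_convex convex_connected by blast
  ultimately have "F ` rel_frontier U = {} \<or> F ` rel_frontier U = V"
    unfolding connected_clopen by blast
  moreover have ne: "rel_frontier U \<noteq> {}"
  proof
    assume "rel_frontier U = {}"
    then have "affine U" by (simp add: rel_frontier_eq_empty)
    then have "U = {} \<or> (\<exists>a. U = {a})" using U(2) affine_bounded_eq_trivial by blast
    then show False using dim(2) by auto
  qed
  ultimately have FV': "F ` rel_frontier U = V" by blast
  then have "bounded V" using cpt compact_imp_bounded by metis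
  \<comment> \<open>This leaves the case of a single point. Injectivity would then make the frontier
    of \<open>U\<close> a single point too, which never happens.\<close>
  then obtain b where "V = {b}" using V(1) affine_bounded_eq_trivial FV' ne by (metis image_is_empty)
  then have "\<forall>x\<in>rel_frontier U. \<forall>y\<in>rel_frontier U. x = y"
    using FV' Fi by (metis image_eqI inj_onD singletonD)
  then obtain c where "rel_frontier U = {c}" using ne by blast
  then show False using rel_frontier_not_sing[OF U(2)] by blast
qed

text \<open>\<open>S - B\<close> is open in the sphere \<open>S\<close>, so \<open>h\<close> maps \<open>A - T\<close> into the relative interior, which
  leaves the whole frontier to \<open>h ` T\<close>; as \<open>T\<close> is a sphere of the same dimension as the frontier, it
  cannot be larger.\<close>

lemma ball_boundary:
  fixes h :: "'a::euclidean_space \<Rightarrow> 'b::euclidean_space"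
    and U :: "'c::euclidean_space set" and W :: "'d::euclidean_space set"
  assumes S: "S homeomorphic rel_frontier U" "convex U" "bounded U"
    and A: "homeomorphism A \<Delta> h h'" "convex \<Delta>" "compact \<Delta>"
    and T: "T homeomorphic rel_frontier W" "convex W" "bounded W"
    and dim: "aff_dim U = aff_dim \<Delta> + 1" "aff_dim W = aff_dim \<Delta>" "aff_dim \<Delta> \<ge> 1"
    and AB: "A \<union> B = S" "A \<inter> B = T" "closed B"
  shows "h ` T = rel_frontier \<Delta>"
proof -
  obtain k' k where k: "homeomorphism S (rel_frontier U) k' k" using S(1) unfolding homeomorphic_def by blast
  obtain m m' where m: "homeomorphism T (rel_frontier W) m m'" using T(1) unfolding homeomorphic_def by blast
  define R where "R = rel_frontier U \<inter> k -` (- B)"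
  have kc: "continuous_on (rel_frontier U) k" using k homeomorphism_def by blast
  have "openin (top_of_set (rel_frontier U)) R"
    unfolding R_def using continuous_openin_preimage_gen[OF kc, of "- B"] AB(3) by blast
  have kR: "k ` R = A - T"
  proof -
    have "k ` R = k ` rel_frontier U \<inter> - B" unfolding R_def by auto
    also have "k ` rel_frontier U = S" using k by (simp add: homeomorphism_def)
    also have "S \<inter> - B = A - T" using AB(1,2) by blast
    finally show ?thesis .
  qed
  have kinj: "inj_on k (rel_frontier U)" using k by (metis homeomorphism_apply2 inj_on_inverseI)
  have hc: "continuous_on A h" and hinj: "inj_on h A" and hA: "h ` A = \<Delta>"
    using A(1) by (auto simp: homeomorphism_def intro: inj_on_inverseI)
  have RU: "R \<subseteq> rel_frontier U" by (auto simp: R_def)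
  have op: "openin (top_of_set (affine hull \<Delta>)) ((h \<circ> k) ` R)"
  proof (rule invariance_of_domain_sphere_affine_set_gen[OF _ _ _ S(3,2) affine_affine_hull])
    show "continuous_on R (h \<circ> k)"
      by (rule continuous_on_compose) (use kc hc RU kR in \<open>auto intro: continuous_on_subset\<close>)
    show "inj_on (h \<circ> k) R"
      by (rule comp_inj_on) (use kinj hinj RU kR in \<open>auto intro: inj_on_subset\<close>)
    have "(h \<circ> k) ` R \<subseteq> \<Delta>" using kR hA by (auto simp: image_comp[symmetric])
    then show "h \<circ> k \<in> R \<rightarrow> affine hull \<Delta>" using hull_subset[of \<Delta> affine] by blast
    show "aff_dim (affine hull \<Delta>) < aff_dim U" using dim by simp
  qed fact
  have hAT: "(h \<circ> k) ` R = h ` (A - T)" using kR by (metis image_comp)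
  have "h ` (A - T) \<subseteq> rel_interior \<Delta>"
    by (rule rel_interior_maximal) (use op hAT hA in auto)
  moreover have TA: "T \<subseteq> A" using AB by blast
  moreover have fr: "rel_frontier \<Delta> = \<Delta> - rel_interior \<Delta>"
    unfolding rel_frontier_def using A(3) by (simp add: compact_imp_closed)
  ultimately have sub: "rel_frontier \<Delta> \<subseteq> h ` T" using hA by blast
  have h'h: "h' (h x) = x" if "x \<in> A" for x using A(1) that homeomorphism_apply1 by metis
  have h'im: "h' ` rel_frontier \<Delta> \<subseteq> T" using sub h'h TA by fastforce
  have h'c: "continuous_on (rel_frontier \<Delta>) h'"
    using A(1) fr by (metis Diff_subset continuous_on_subset homeomorphism_def)
  have h'inj: "inj_on h' (rel_frontier \<Delta>)"
    using A(1) fr by (metis Diff_subset homeomorphism_apply2 inj_on_inverseI inj_on_subset)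
  have mc: "continuous_on T m" and minj: "inj_on m T" and mT: "m ` T = rel_frontier W"
    using m by (auto simp: homeomorphism_def intro: inj_on_inverseI)
  \<comment> \<open>The inverse of \<open>h\<close> embeds the frontier in \<open>T\<close>, which
    \<open>m\<close> identifies with a sphere of the same dimension. This embedding is therefore
    onto, so no point of \<open>T\<close> is left over.\<close>
  have "(m \<circ> h') ` rel_frontier \<Delta> = rel_frontier W"
  proof (rule sphere_self_embedding_surj)
    show "continuous_on (rel_frontier \<Delta>) (m \<circ> h')"
      by (rule continuous_on_compose[OF h'c continuous_on_subset[OF mc h'im]])
    show "inj_on (m \<circ> h') (rel_frontier \<Delta>)"
      by (rule comp_inj_on[OF h'inj inj_on_subset[OF minj h'im]])
    show "(m \<circ> h') ` rel_frontier \<Delta> \<subseteq> rel_frontier W"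
      using h'im mT by (auto simp: image_comp[symmetric])
  qed (use A T dim compact_imp_bounded in auto)
  have "h ` T \<subseteq> rel_frontier \<Delta>"
  proof
    fix y assume "y \<in> h ` T"
    then obtain t where t: "t \<in> T" "y = h t" by blast
    then obtain z where z: "z \<in> rel_frontier \<Delta>" "m t = m (h' z)"
      using \<open>(m \<circ> h') ` rel_frontier \<Delta> = rel_frontier W\<close> mT by (metis comp_apply imageE imageI)
    then have "t = h' z" using minj t(1) h'im by (meson image_subset_iff inj_onD)
    then have "y = z" using z(1) A(1) fr t(2) by (metis DiffD1 homeomorphism_apply2)
    then show "y \<in> rel_frontier \<Delta>" using z by simp
  qed
  then show ?thesis using sub by blast
qed

subsection \<open>The star of a vertex\<close>

context
  fixes M :: "'a::euclidean_space set set" and v :: 'a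
  assumes M: "simplicial_complex M" and vM: "{v} \<in> M"
begin

lemma link_obtain:
  assumes "s \<in> \<Union>(link M {v})"
  obtains \<sigma> \<tau> where "\<sigma> \<in> M" "v \<in> \<sigma>" "s \<in> \<sigma>" "\<tau> \<in> M" "\<tau> \<in> link M {v}" "v \<notin> \<tau>" "s \<in> \<tau>"
proof -
  obtain \<tau> where \<tau>: "\<tau> \<in> link M {v}" "s \<in> \<tau>" using assms by blast
  then obtain \<rho> where "\<tau> \<in> M" "v \<notin> \<tau>" "\<rho> \<in> M" "{v} face_of \<rho>" "\<tau> face_of \<rho>"
    unfolding link_def by blast
  then show ?thesis using that[of \<rho> \<tau>] \<tau> face_of_imp_subset by blast
qed

lemma star_segment_mem:
  assumes "\<sigma> \<in> M" "v \<in> \<sigma>" "s \<in> \<sigma>" "0 \<le> t" "t \<le> 1"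
  shows "v + t *\<^sub>R (s - v) \<in> \<sigma>"
proof -
  have "(1 - t) *\<^sub>R v + t *\<^sub>R s \<in> \<sigma>"
    using simplicial_complex_convex[OF M assms(1)] assms unfolding convex_alt by blast
  then show ?thesis by (simp add: algebra_simps)
qed

text \<open>\<open>\<sigma> \<inter> \<rho>\<close> is a face of \<open>\<sigma>\<close>, and a face
  that contains an interior point of the segment from \<open>v\<close> to \<open>s\<close> contains
  its endpoints, in particular \<open>v\<close>. It follows later that the open star is the
  complement of the simplices that miss \<open>v\<close>.\<close>

lemma star_avoids:
  assumes s: "s \<in> \<Union>(link M {v})" and t: "0 \<le> t" "t < 1" and \<rho>: "\<rho> \<in> M" "v \<notin> \<rho>"
  shows "v + t *\<^sub>R (s - v) \<notin> \<rho>"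
proof
  assume mem: "v + t *\<^sub>R (s - v) \<in> \<rho>"
  obtain \<sigma> \<tau> where \<sigma>: "\<sigma> \<in> M" "v \<in> \<sigma>" "s \<in> \<sigma>" "v \<notin> \<tau>" "s \<in> \<tau>" using link_obtain[OF s] by metis
  then have sv: "s \<noteq> v" by blast
  have t0: "0 < t" using t mem \<rho>(2) by (cases "t = 0") auto
  have face: "\<sigma> \<inter> \<rho> face_of \<sigma>" using M \<sigma>(1) \<rho>(1) unfolding simplicial_complex_def by blast
  have "v + t *\<^sub>R (s - v) = (1 - t) *\<^sub>R v + t *\<^sub>R s" by (simp add: algebra_simps)
  then have "v + t *\<^sub>R (s - v) \<in> open_segment v s"
    using t t0 sv unfolding in_segment by blast
  moreover have "v + t *\<^sub>R (s - v) \<in> \<sigma> \<inter> \<rho>" using mem star_segment_mem[OF \<sigma>(1-3)] t by auto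
  ultimately have "v \<in> \<sigma> \<inter> \<rho>" using face_ofD[OF face _ \<sigma>(2,3)] by blast
  then show False using \<rho>(2) by blast
qed

text \<open>If two points of the link lay on one ray from \<open>v\<close>, the nearer one would be
  interior to the segment from \<open>v\<close> to the other. It could then not belong to a simplex
  that misses \<open>v\<close>.\<close>

lemma conic_inj_link: "conic_inj (\<Union>(link M {v})) (\<lambda>s. s - v)"
proof -
  have *: "x = y" if x: "x \<in> \<Union>(link M {v})" and y: "y \<in> \<Union>(link M {v})" and t: "0 < t" "t \<le> 1" "x - v = t *\<^sub>R (y - v)"
    for x y and t :: real
  proof (cases "t = 1")
    case True then show ?thesis using t(3) by simp
  next
    case False
    obtain \<tau> where "\<tau> \<in> M" "v \<notin> \<tau>" "x \<in> \<tau>" using link_obtain[OF x] by metis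
    moreover have "x = v + t *\<^sub>R (y - v)" using t(3) by (metis add.commute diff_add_cancel)
    ultimately show ?thesis using star_avoids[OF y, of t \<tau>] t False by auto
  qed
  show ?thesis
    unfolding conic_inj_def
  proof (intro ballI allI impI)
    fix x y and t :: real
    assume xy: "x \<in> \<Union>(link M {v})" "y \<in> \<Union>(link M {v})" "0 < t" "x - v = t *\<^sub>R (y - v)"
    show "x = y"
    proof (cases "t \<le> 1")
      case True then show ?thesis using * xy by blast
    next
      case False
      have "y - v = (1 / t) *\<^sub>R (x - v)" using xy(3,4) by simp
      then show ?thesis using *[OF xy(2,1), of "1 / t"] False xy(3) by simp
    qed
  qed
qed

lemma link_not_vertex: "s \<in> \<Union>(link M {v}) \<Longrightarrow> s \<noteq> v"
  using link_obtain by metis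

text \<open>\<open>\<sigma>\<close> is the join of \<open>v\<close> with the opposite face, spanned
  by its other vertices, and that face belongs to the link.\<close>

lemma star_cone_obtain:
  assumes \<sigma>: "\<sigma> \<in> M" "v \<in> \<sigma>" and x: "x \<in> \<sigma>" "x \<noteq> v"
  obtains t s where "0 < t" "t \<le> 1" "s \<in> \<Union>(link M {v})" "x = v + t *\<^sub>R (s - v)"
proof -
  define C where "C = {s\<in>\<sigma>. {s} \<in> M}"
  have C: "\<not> affine_dependent C" "\<sigma> = convex hull C" "v \<in> C"
    using simplicial_complex_vertices[OF M \<sigma>(1)] \<sigma>(2) vM unfolding C_def by auto
  define \<tau> where "\<tau> = convex hull (C - {v})"
  have ne: "C - {v} \<noteq> {}"
  proof
    assume "C - {v} = {}"
    then have "C = {v}" using C(3) by blast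
    then show False using x C(2) by auto
  qed
  have "x \<in> convex hull (insert v (C - {v}))" using x C by (simp add: insert_absorb)
  then obtain u t s where u: "0 \<le> u" "0 \<le> t" "u + t = 1" "s \<in> \<tau>" "x = u *\<^sub>R v + t *\<^sub>R s"
    unfolding convex_hull_insert[OF ne] \<tau>_def by blast
  then have u': "u = 1 - t" by simp
  have f1: "\<tau> face_of \<sigma>"
    unfolding \<tau>_def C(2) using face_of_convex_hull_affine_independent[OF C(1)] by blast
  have "convex hull {v} face_of \<sigma>"
    unfolding C(2) using face_of_convex_hull_affine_independent[OF C(1)] C(3) by blast
  then have f2: "{v} face_of \<sigma>" by simp
  have \<tau>M: "\<tau> \<in> M" using M f1 \<sigma>(1) unfolding simplicial_complex_def by blast
  have "v \<notin> affine hull (C - {v})" using C(1,3) unfolding affine_dependent_def by blast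
  then have "v \<notin> \<tau>" unfolding \<tau>_def using convex_hull_subset_affine_hull by blast
  then have "\<tau> \<in> link M {v}" unfolding link_def using \<tau>M f1 f2 \<sigma>(1) by blast
  then have s: "s \<in> \<Union>(link M {v})" using u(4) by blast
  have "t \<noteq> 0" using u(5) u' x(2) by auto
  moreover have "x = v + t *\<^sub>R (s - v)" using u(5) u' by (simp add: algebra_simps)
  ultimately show ?thesis using that[of t s] u s by auto
qed

lemma pl_on_link:
  assumes "\<And>\<sigma>. \<sigma> \<in> M \<Longrightarrow> affine_fun_on \<sigma> h"
  shows "pl_on (\<Union>(link M {v})) h"
proof (rule pl_onI[OF _ refl])
  have sub: "link M {v} \<subseteq> M" unfolding link_def by blast
  then show "finite (link M {v})" using M finite_subset unfolding simplicial_complex_def by blast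
  fix P assume "P \<in> link M {v}"
  then have P: "P \<in> M" using sub by blast
  then obtain n where "n simplex P" using M unfolding simplicial_complex_def by blast
  then show "polytope P" by (rule simplex_imp_polytope)
  show "affine_fun_on P h" using assms P by blast
qed

end

subsection \<open>From a conic parametrisation to an unknotted pair\<close>

text \<open>For a unit vector \<open>e\<close> orthogonal to \<open>span D\<close>, the unit sphere
  of this gauge in \<open>span (insert e D)\<close> is the suspension of
  \<open>model_sphere D\<close> with the two apices \<open>e\<close> and \<open>- e\<close>.\<close>

definition suspension_gauge :: "'a::euclidean_space set \<Rightarrow> 'a \<Rightarrow> 'a \<Rightarrow> real" where
  "suspension_gauge D e x = simplex_gauge D x + \<bar>x \<bullet> e\<bar>"

context
  fixes D :: "'a::euclidean_space set" and e :: 'a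
  assumes D: "D \<subseteq> Basis" and e: "e \<in> Basis" "e \<notin> D"
begin

lemma insert_subset_Basis: "insert e D \<subseteq> Basis"
  using D e by blast

lemma apex_inner_base: "i \<in> D \<Longrightarrow> e \<bullet> i = 0" "i \<in> D \<Longrightarrow> i \<bullet> e = 0"
  using D e inner_Basis by (metis subsetD)+

lemma apex_inner_apex: "e \<bullet> e = 1"
  using e(1) by simp

lemma inner_apex_span: "x \<in> span D \<Longrightarrow> x \<bullet> e = 0"
  using span_subset_Basis_iff[OF D] e by blast

lemma span_insert_iff: "x \<in> span D \<longleftrightarrow> x \<in> span (insert e D) \<and> x \<bullet> e = 0"
  using span_subset_Basis_iff[OF D, of x] span_subset_Basis_iff[OF insert_subset_Basis, of x] e by auto

lemma simplex_gauge_shift: "simplex_gauge D (x + c *\<^sub>R e) = simplex_gauge D x"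
  by (rule simplex_gauge_cong[OF D]) (simp add: inner_add_left apex_inner_base)

lemma suspension_gauge_scaleR: "t > 0 \<Longrightarrow> suspension_gauge D e (t *\<^sub>R x) = t * suspension_gauge D e x"
  by (simp add: suspension_gauge_def simplex_gauge_scaleR[OF D] abs_mult distrib_left)

lemma suspension_gauge_pos:
  assumes "x \<in> span (insert e D)" "x \<noteq> 0" shows "suspension_gauge D e x > 0"
proof (cases "x \<bullet> e = 0")
  case True
  then show ?thesis
    using assms span_insert_iff simplex_gauge_pos[OF D] by (simp add: suspension_gauge_def)
next
  case False
  then show ?thesis using simplex_gauge_nonneg[OF D, of x] by (simp add: suspension_gauge_def)
qed

lemma suspension_gauge_0: "suspension_gauge D e 0 = 0"
  by (simp add: suspension_gauge_def simplex_gauge_0[OF D])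

text \<open>Each half of the suspension is a graph over the model simplex: the height over
  \<open>z\<close> has absolute value \<open>1 - simplex_gauge D z\<close>, and
  \<open>\<sigma>\<close> selects the half. The projection is affine, so it preserves PL maps
  without further subdivision.\<close>

lemma suspension_projection:
  assumes \<sigma>: "\<sigma> = 1 \<or> \<sigma> = - 1"
  defines "Y \<equiv> {y \<in> span (insert e D). suspension_gauge D e y = 1 \<and> \<sigma> * (y \<bullet> e) \<ge> 0}"
  shows "inj_on (\<lambda>y. y + (- (y \<bullet> e)) *\<^sub>R e) Y" "(\<lambda>y. y + (- (y \<bullet> e)) *\<^sub>R e) ` Y = model_simplex D"
proof -
  let ?p = "\<lambda>y. y + (- (y \<bullet> e)) *\<^sub>R e"
  let ?l = "\<lambda>z. z + (\<sigma> * (1 - simplex_gauge D z)) *\<^sub>R e"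
  have ss: "\<sigma> * \<sigma> = 1" using \<sigma> by auto
  have lp: "?l (?p y) = y" if "y \<in> Y" for y
  proof -
    have "simplex_gauge D y + \<sigma> * (y \<bullet> e) = 1"
      using that \<sigma> by (auto simp: Y_def suspension_gauge_def abs_if split: if_splits)
    then have "1 - simplex_gauge D (?p y) = \<sigma> * (y \<bullet> e)" unfolding simplex_gauge_shift by simp
    then have "?l (?p y) = ?p y + (\<sigma> * (\<sigma> * (y \<bullet> e))) *\<^sub>R e" by simp
    also have "\<sigma> * (\<sigma> * (y \<bullet> e)) = y \<bullet> e" using ss by (simp add: mult.assoc[symmetric])
    finally show ?thesis by simp
  qed
  have es: "e \<in> span (insert e D)" by (simp add: span_base)
  have p: "?p y \<in> model_simplex D" if "y \<in> Y" for y
  proof -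
    have "?p y \<in> span D" unfolding span_insert_iff
      using that es by (auto simp: Y_def inner_add_left apex_inner_apex inner_diff_left intro!: span_diff span_scale)
    moreover have "simplex_gauge D (?p y) \<le> 1"
      unfolding simplex_gauge_shift using that by (auto simp: Y_def suspension_gauge_def)
    ultimately show ?thesis by (simp add: model_simplex_def)
  qed
  have l: "?l z \<in> Y" "?p (?l z) = z" if "z \<in> model_simplex D" for z
  proof -
    have z: "z \<in> span D" "simplex_gauge D z \<le> 1" "z \<bullet> e = 0"
      using that inner_apex_span by (auto simp: model_simplex_def)
    have le: "?l z \<bullet> e = \<sigma> * (1 - simplex_gauge D z)"
      using z(3) by (simp add: inner_add_left apex_inner_apex)
    have "\<bar>\<sigma> * (1 - simplex_gauge D z)\<bar> = 1 - simplex_gauge D z" using \<sigma> z(2) by auto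
    then have "suspension_gauge D e (?l z) = 1"
      unfolding suspension_gauge_def simplex_gauge_shift le by simp
    moreover have "?l z \<in> span (insert e D)"
      using z(1) es span_insert_iff by (intro span_add span_scale) auto
    moreover have "\<sigma> * (?l z \<bullet> e) \<ge> 0" unfolding le using z(2) ss by (simp add: mult.assoc[symmetric])
    ultimately show "?l z \<in> Y" by (simp add: Y_def)
    show "?p (?l z) = z" unfolding le by simp
  qed
  show "inj_on ?p Y" using lp by (rule inj_on_inverseI)
  show "?p ` Y = model_simplex D" using p l by (metis (no_types, lifting) image_subsetI imageI subsetI subset_antisym)
qed

text \<open>\<open>Q\<close> will be a closed half-line or the origin, so that the two hemispheres
  and the equator are treated together. Invariance of \<open>Q\<close> under positive factors is
  what lets the condition on the height survive a change along rays.\<close>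

lemma conic_normalize_restrict:
  fixes \<psi> :: "'b::euclidean_space \<Rightarrow> 'a"
  assumes \<psi>: "pl_on S \<psi>" "conic_inj S \<psi>" "ray_span (\<psi> ` S) = span (insert e D) - {0}"
    and Q: "polyhedron Q" "\<And>t r. t > 0 \<Longrightarrow> r \<in> Q \<Longrightarrow> t * r \<in> Q"
  obtains h where "pl_on {x\<in>S. \<psi> x \<bullet> e \<in> Q} h" "inj_on h {x\<in>S. \<psi> x \<bullet> e \<in> Q}"
    "h ` {x\<in>S. \<psi> x \<bullet> e \<in> Q} = {y \<in> span (insert e D). suspension_gauge D e y = 1 \<and> y \<bullet> e \<in> Q}"
proof -
  let ?X = "{x\<in>S. \<psi> x \<bullet> e \<in> Q}"
  have pe: "pl_on S (\<lambda>x. \<psi> x \<bullet> e)"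
    by (rule pl_on_affine[OF \<psi>(1)]) (intro affine_fun_on_linear linearI, auto simp: inner_add_left)
  have "?X = S \<inter> (\<lambda>x. \<psi> x \<bullet> e) -` Q" by auto
  then have X: "pl_on ?X \<psi>" using pl_on_vimage[OF \<psi>(1) pe Q(1)] by simp
  have Xi: "conic_inj ?X \<psi>" using \<psi>(2) unfolding conic_inj_def by blast
  have XN: "pl_on ?X (\<lambda>x. suspension_gauge D e (\<psi> x))"
    unfolding suspension_gauge_def
    by (intro pl_on_add pl_on_simplex_gauge[OF D X] pl_on_abs pl_on_affine[OF X, of "\<lambda>y. y \<bullet> e"]
        affine_fun_on_linear linearI) (auto simp: inner_add_left)
  have mem: "\<psi> x \<in> span (insert e D) - {0}" if "x \<in> S" for x
  proof -
    have "1 *\<^sub>R \<psi> x \<in> ray_span (\<psi> ` S)" unfolding ray_span_def using that zero_less_one by blast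
    then show ?thesis using \<psi>(3) by simp
  qed
  have pos: "suspension_gauge D e (\<psi> x) > 0" if "x \<in> ?X" for x
    using mem[of x] that suspension_gauge_pos by auto
  obtain h where h: "pl_on ?X h" "inj_on h ?X"
     "h ` ?X = {y \<in> ray_span (\<psi> ` ?X). suspension_gauge D e y = 1}"
    using pl_on_normalize[OF X Xi XN pos suspension_gauge_scaleR] by blast
  have "ray_span (\<psi> ` ?X) = {y \<in> span (insert e D) - {0}. y \<bullet> e \<in> Q}"
  proof (intro equalityI subsetI)
    fix y assume "y \<in> ray_span (\<psi> ` ?X)"
    then obtain t x where t: "t > 0" "x \<in> ?X" "y = t *\<^sub>R \<psi> x" unfolding ray_span_def by blast
    then have "y \<in> ray_span (\<psi> ` S)" unfolding ray_span_def by blast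
    then show "y \<in> {y \<in> span (insert e D) - {0}. y \<bullet> e \<in> Q}" using \<psi>(3) t Q(2) by auto
  next
    fix y assume y: "y \<in> {y \<in> span (insert e D) - {0}. y \<bullet> e \<in> Q}"
    then have "y \<in> ray_span (\<psi> ` S)" using \<psi>(3) by blast
    then obtain t x where t: "t > 0" "x \<in> S" "y = t *\<^sub>R \<psi> x" unfolding ray_span_def by blast
    have "(1 / t) * (y \<bullet> e) \<in> Q" using Q(2)[of "1 / t"] t(1) y by simp
    then have "x \<in> ?X" using t by simp
    then show "y \<in> ray_span (\<psi> ` ?X)" unfolding ray_span_def using t by blast
  qed
  then have ray: "\<And>y. y \<in> ray_span (\<psi> ` ?X) \<longleftrightarrow> y \<in> span (insert e D) \<and> y \<noteq> 0 \<and> y \<bullet> e \<in> Q"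
    by simp
  have "h ` ?X = {y \<in> span (insert e D). suspension_gauge D e y = 1 \<and> y \<bullet> e \<in> Q}"
    unfolding h(3)
  proof (rule Collect_cong)
    show "y \<in> ray_span (\<psi> ` ?X) \<and> suspension_gauge D e y = 1 \<longleftrightarrow>
          y \<in> span (insert e D) \<and> suspension_gauge D e y = 1 \<and> y \<bullet> e \<in> Q" for y
      unfolding ray using suspension_gauge_0 by (cases "y = 0") auto
  qed
  then show ?thesis by (rule that[OF h(1,2)])
qed

text \<open>A hemisphere is normalised to half of the suspension and then projected along
  \<open>e\<close>. On the equator the term with \<open>e\<close> vanishes from the suspension
  gauge, so normalisation already ends in the frontier of the model simplex.\<close>

lemma conic_imp_ball_sphere:
  fixes \<psi> :: "'a \<Rightarrow> 'a"
  assumes \<psi>: "pl_on S \<psi>" "conic_inj S \<psi>" "ray_span (\<psi> ` S) = span (insert e D) - {0}"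
  shows "pl_ball (int (card D)) {x\<in>S. \<psi> x \<bullet> e \<ge> 0}" "pl_ball (int (card D)) {x\<in>S. \<psi> x \<bullet> e \<le> 0}"
    "pl_sphere (int (card D) - 1) {x\<in>S. \<psi> x \<bullet> e = 0}"
proof -
  let ?p = "\<lambda>y. y + (- (y \<bullet> e)) *\<^sub>R e"
  have pl: "affine_fun_on Z ?p" for Z
    by (intro affine_fun_on_add affine_fun_on_ident affine_fun_on_scaleR_const affine_fun_on_linear linearI)
       (auto simp: inner_add_left)
  have ball: "pl_ball (int (card D)) {x\<in>S. \<psi> x \<bullet> e \<in> Q}"
    if \<sigma>: "\<sigma> = 1 \<or> \<sigma> = - 1" and Q: "polyhedron Q" "\<And>r. r \<in> Q \<longleftrightarrow> \<sigma> * r \<ge> 0" for \<sigma> :: real and Q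
  proof -
    have cone: "t * r \<in> Q" if "t > 0" "r \<in> Q" for t r
      using that \<sigma> unfolding Q(2) by (auto simp: mult_le_0_iff)
    obtain h where h: "pl_on {x\<in>S. \<psi> x \<bullet> e \<in> Q} h" "inj_on h {x\<in>S. \<psi> x \<bullet> e \<in> Q}"
      "h ` {x\<in>S. \<psi> x \<bullet> e \<in> Q} = {y \<in> span (insert e D). suspension_gauge D e y = 1 \<and> y \<bullet> e \<in> Q}"
      using conic_normalize_restrict[OF \<psi> Q(1) cone] by blast
    have h3: "h ` {x\<in>S. \<psi> x \<bullet> e \<in> Q} = {y \<in> span (insert e D). suspension_gauge D e y = 1 \<and> \<sigma> * (y \<bullet> e) \<ge> 0}"
      using h(3) Q(2) by simp
    have "pl_homeomorphic {x\<in>S. \<psi> x \<bullet> e \<in> Q} (model_simplex D)"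
    proof (rule pl_homeomorphicI)
      show "pl_on {x\<in>S. \<psi> x \<bullet> e \<in> Q} (\<lambda>x. ?p (h x))" using pl_on_affine[OF h(1) pl] .
      show "inj_on (\<lambda>x. ?p (h x)) {x\<in>S. \<psi> x \<bullet> e \<in> Q}"
        using comp_inj_on[OF h(2), of ?p] suspension_projection(1)[OF \<sigma>] h3 by (simp add: o_def)
      have "(\<lambda>x. ?p (h x)) ` {x\<in>S. \<psi> x \<bullet> e \<in> Q} = ?p ` (h ` {x\<in>S. \<psi> x \<bullet> e \<in> Q})"
        by (simp only: image_image)
      then show "(\<lambda>x. ?p (h x)) ` {x\<in>S. \<psi> x \<bullet> e \<in> Q} = model_simplex D"
        unfolding h3 suspension_projection(2)[OF \<sigma>] .
    qed
    then show ?thesis unfolding pl_ball_def using model_simplex[OF D] by blast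
  qed
  show "pl_ball (int (card D)) {x\<in>S. \<psi> x \<bullet> e \<ge> 0}"
    using ball[of 1 "{0..}"] polyhedron_real by simp
  show "pl_ball (int (card D)) {x\<in>S. \<psi> x \<bullet> e \<le> 0}"
    using ball[of "-1" "{..0}"] polyhedron_real by simp
  obtain h where h: "pl_on {x\<in>S. \<psi> x \<bullet> e \<in> {0}} h" "inj_on h {x\<in>S. \<psi> x \<bullet> e \<in> {0}}"
      "h ` {x\<in>S. \<psi> x \<bullet> e \<in> {0}} = {y \<in> span (insert e D). suspension_gauge D e y = 1 \<and> y \<bullet> e \<in> {0}}"
    using conic_normalize_restrict[OF \<psi> polyhedron_real(3)[of 0]] by auto
  have "{y \<in> span (insert e D). suspension_gauge D e y = 1 \<and> y \<bullet> e \<in> {0}} = model_sphere D"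
    using span_insert_iff by (auto simp: model_sphere_def suspension_gauge_def)
  then have "pl_homeomorphic {x\<in>S. \<psi> x \<bullet> e = 0} (rel_frontier (model_simplex D))"
    using pl_homeomorphicI[OF h] rel_frontier_model_simplex[OF D] by simp
  then show "pl_sphere (int (card D) - 1) {x\<in>S. \<psi> x \<bullet> e = 0}"
    unfolding pl_sphere_def using model_simplex[OF D] by auto
qed

end

subsection \<open>A strongly regular chart is conic near the vertex\<close>

text \<open>\<open>b\<close> numbers the vectors of \<open>D\<close>. This and the next lemma make
  \<open>span D\<close>, where the spheres are modelled, interchangeable with the coordinate
  sequences in which charts take their values.\<close>

lemma span_Basis_sum:
  fixes y :: "'a::euclidean_space"
  assumes D: "D \<subseteq> Basis" and y: "y \<in> span D" and b: "bij_betw b {..<d} D"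
  shows "(\<Sum>i<d. (y \<bullet> b i) *\<^sub>R b i) = y"
proof -
  have "(\<Sum>i<d. (y \<bullet> b i) *\<^sub>R b i) = (\<Sum>i\<in>D. (y \<bullet> i) *\<^sub>R i)"
    using sum.reindex_bij_betw[OF b, of "\<lambda>i. (y \<bullet> i) *\<^sub>R i"] .
  also have "\<dots> = (\<Sum>i\<in>Basis. (y \<bullet> i) *\<^sub>R i)"
    using D y span_subset_Basis_iff[OF D] by (intro sum.mono_neutral_left) auto
  finally show ?thesis by (simp add: euclidean_representation)
qed

lemma sum_Basis_inner:
  fixes b :: "nat \<Rightarrow> 'a::euclidean_space"
  assumes D: "D \<subseteq> Basis" and b: "bij_betw b {..<d} D" and j: "j < d"
  shows "(\<Sum>i<d. c i *\<^sub>R b i) \<bullet> b j = c j"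
proof -
  have B: "b i \<in> Basis" if "i < d" for i using b D that bij_betwE by blast
  have inj: "inj_on b {..<d}" using b bij_betw_imp_inj_on by blast
  have "(\<Sum>i<d. c i *\<^sub>R b i) \<bullet> b j = (\<Sum>i<d. if i = j then c i else 0)"
    unfolding inner_sum_left
  proof (intro sum.cong refl)
    fix i assume i: "i \<in> {..<d}"
    then show "c i *\<^sub>R b i \<bullet> b j = (if i = j then c i else 0)"
      using B j inj_onD[OF inj, of i j] by (auto simp: inner_Basis)
  qed
  then show ?thesis using j by simp
qed

text \<open>Close to \<open>v\<close> every simplex of the triangulation contains \<open>v\<close>,
  so the chart is homogeneous about \<open>v\<close>. Its injectivity then becomes injectivity on
  rays, and openness of its image makes it meet every ray. The factor \<open>c\<close> is the ratio
  of the homothety that shrinks the link into this region.\<close>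

lemma strongly_regular_imp_conic:
  fixes M :: "'a::euclidean_space set set" and f :: "'a \<Rightarrow> real"
  assumes M: "simplicial_complex M" and vM: "{v} \<in> M"
    and f: "\<And>\<sigma>. \<sigma> \<in> M \<Longrightarrow> affine_fun_on \<sigma> f"
    and D: "D \<subseteq> Basis" and b: "bij_betw b {..<d} D" and d: "d > 0"
    and reg: "strongly_regular d M f v"
  defines "S \<equiv> \<Union>(link M {v})"
  obtains \<psi> :: "'a \<Rightarrow> 'a" and c where "c > 0" "pl_on S \<psi>" "conic_inj S \<psi>" "ray_span (\<psi> ` S) = span D - {0}"
    "\<And>s. s \<in> S \<Longrightarrow> \<psi> s \<bullet> b (d - 1) = c * (f s - f v)"
proof -
  obtain U \<phi> where chart: "pl_chart d (\<Union>M) U \<phi>" and vU: "v \<in> U" and \<phi>v: "\<phi> v = (\<lambda>_. 0)"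
    and f\<phi>: "\<And>q. q \<in> U \<Longrightarrow> f q = f v + \<phi> q (d - 1)"
    using reg unfolding strongly_regular_def by blast
  obtain V where opU: "openin (top_of_set (\<Union>M)) U" and opV: "openin (Euclidean_space d) V"
    and hom: "homeomorphic_map (top_of_set U) (subtopology (Euclidean_space d) V) \<phi>"
    using chart unfolding pl_chart_def by blast
  obtain T W where T: "simplicial_complex T" "\<Union>T \<subseteq> U" "openin (top_of_set U) W" "v \<in> W" "W \<subseteq> \<Union>T"
    "\<forall>\<sigma>\<in>T. \<forall>i<d. affine_fun_on \<sigma> (\<lambda>y. \<phi> y i)"
    using chart vU unfolding pl_chart_def by meson
  \<comment> \<open>The chart, with its coordinates read as coefficients of the vectors in
    \<open>D\<close>.\<close>
  define \<Phi> where "\<Phi> x = (\<Sum>i<d. \<phi> x i *\<^sub>R b i)" for x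
  have \<Phi>b: "\<Phi> x \<bullet> b j = \<phi> x j" if "j < d" for x j
    unfolding \<Phi>_def using sum_Basis_inner[OF D b that] .
  have \<Phi>v: "\<Phi> v = 0" by (simp add: \<Phi>_def \<phi>v)
  have \<Phi>D: "\<Phi> x \<in> span D" for x
    unfolding \<Phi>_def using b bij_betwE by (intro span_sum span_scale span_base) blast
  have \<Phi>T: "affine_fun_on \<sigma> \<Phi>" if "\<sigma> \<in> T" for \<sigma>
    unfolding \<Phi>_def using T(6) that by (intro affine_fun_on_sum affine_fun_on_scaleR_const) auto
  have \<phi>top: "\<phi> x i = 0" if "x \<in> U" "i \<ge> d" for x i
  proof -
    have "\<phi> ` U \<subseteq> topspace (Euclidean_space d)"
      using homeomorphic_imp_surjective_map[OF hom] by auto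
    then show ?thesis using that by (auto simp: topspace_Euclidean_space)
  qed
  have \<phi>inj: "inj_on \<phi> U" using homeomorphic_imp_injective_map[OF hom] by simp
  have \<Phi>inj: "x = y" if xy: "x \<in> U" "y \<in> U" "\<Phi> x = \<Phi> y" for x y
  proof -
    have "\<phi> x i = \<phi> y i" for i
      using \<Phi>b[of i x] \<Phi>b[of i y] \<phi>top[OF xy(1), of i] \<phi>top[OF xy(2), of i] xy(3) by (cases "i < d") auto
    then show ?thesis using inj_onD[OF \<phi>inj _ xy(1,2)] by blast
  qed
  have "openin (top_of_set (\<Union>M)) W" using T(3) opU openin_trans by blast
  then obtain O1 where O1: "open O1" "W = \<Union>M \<inter> O1" unfolding openin_open by blast
  \<comment> \<open>Off these finitely many closed simplices, every simplex of \<open>T\<close> or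
    \<open>M\<close> through a point also contains \<open>v\<close>, so segments to \<open>v\<close>
    stay in single simplices.\<close>
  define bad where "bad = {\<sigma>\<in>T. v \<notin> \<sigma>} \<union> {\<sigma>\<in>M. v \<notin> \<sigma>}"
  have "closed (\<Union>bad)"
  proof (rule closed_Union)
    show "finite bad" using T(1) M unfolding bad_def simplicial_complex_def by auto
    show "\<forall>\<sigma>\<in>bad. closed \<sigma>"
      using T(1) M closed_simplex unfolding bad_def simplicial_complex_def by blast
  qed
  then have "open (O1 - \<Union>bad)" using O1(1) by blast
  moreover have "v \<in> O1 - \<Union>bad" using T(4) O1(2) by (auto simp: bad_def)
  ultimately obtain \<delta> where \<delta>: "\<delta> > 0" "ball v \<delta> \<subseteq> O1 - \<Union>bad" by (meson open_contains_ball)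
  define W0 where "W0 = \<Union>M \<inter> ball v \<delta>"
  have W0W: "W0 \<subseteq> W" using \<delta>(2) O1(2) by (auto simp: W0_def)
  then have W0U: "W0 \<subseteq> U" using T(2,5) by blast
  have W0T: "\<exists>\<sigma>\<in>T. v \<in> \<sigma> \<and> x \<in> \<sigma>" and W0M: "\<exists>\<sigma>\<in>M. v \<in> \<sigma> \<and> x \<in> \<sigma>" if x: "x \<in> W0" for x
  proof -
    have nb: "x \<notin> \<Union>bad" using \<delta>(2) x by (auto simp: W0_def)
    obtain \<sigma> where "\<sigma> \<in> T" "x \<in> \<sigma>" using x W0W T(5) by blast
    then show "\<exists>\<sigma>\<in>T. v \<in> \<sigma> \<and> x \<in> \<sigma>" using nb unfolding bad_def by blast
    obtain \<sigma> where "\<sigma> \<in> M" "x \<in> \<sigma>" using x by (auto simp: W0_def)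
    then show "\<exists>\<sigma>\<in>M. v \<in> \<sigma> \<and> x \<in> \<sigma>" using nb unfolding bad_def by blast
  qed
  \<comment> \<open>A segment from \<open>v\<close> to \<open>x\<close> lies in one simplex of
    \<open>T\<close>, on which \<open>\<Phi>\<close> is affine, and \<open>\<Phi> v = 0\<close>.
    Only contractions are allowed, since enlarging could leave the neighbourhood.\<close>
  have homog: "\<Phi> (v + u *\<^sub>R (x - v)) = u *\<^sub>R \<Phi> x" "v + u *\<^sub>R (x - v) \<in> W0"
    if x: "x \<in> W0" and u: "0 \<le> u" "u \<le> 1" for x u
  proof -
    obtain \<sigma> where \<sigma>: "\<sigma> \<in> T" "v \<in> \<sigma>" "x \<in> \<sigma>" using W0T[OF x] by blast
    then have "convex \<sigma>" using T(1) convex_simplex unfolding simplicial_complex_def by blast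
    then have "(1 - u) *\<^sub>R v + u *\<^sub>R x \<in> \<sigma>" using \<sigma> u unfolding convex_alt by blast
    then have "\<Phi> ((1 - u) *\<^sub>R v + u *\<^sub>R x) = (1 - u) *\<^sub>R \<Phi> v + u *\<^sub>R \<Phi> x"
      by (rule affine_fun_on_segment[OF \<Phi>T[OF \<sigma>(1)] \<sigma>(2,3)])
    moreover have eq: "(1 - u) *\<^sub>R v + u *\<^sub>R x = v + u *\<^sub>R (x - v)" by (simp add: algebra_simps)
    ultimately show "\<Phi> (v + u *\<^sub>R (x - v)) = u *\<^sub>R \<Phi> x" using \<Phi>v by simp
    obtain \<tau> where \<tau>: "\<tau> \<in> M" "v \<in> \<tau>" "x \<in> \<tau>" using W0M[OF x] by blast
    have "v + u *\<^sub>R (x - v) \<in> \<tau>" by (rule star_segment_mem[OF M vM \<tau> u])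
    moreover have "v + u *\<^sub>R (x - v) \<in> ball v \<delta>"
    proof -
      have "u * norm (x - v) \<le> 1 * norm (x - v)" using u by (intro mult_right_mono) auto
      moreover have "norm (x - v) < \<delta>" using x by (simp add: W0_def dist_norm norm_minus_commute)
      ultimately show ?thesis using u by (simp add: dist_norm)
    qed
    ultimately show "v + u *\<^sub>R (x - v) \<in> W0" using \<tau> by (auto simp: W0_def)
  qed
  have Spl: "pl_on S f" unfolding S_def using pl_on_link[OF M vM f] .
  have "bounded S" using pl_on_compact[OF Spl] compact_imp_bounded by blast
  then have "bounded ((\<lambda>s. s - v) ` S)" by (rule bounded_translation_minus)
  then obtain B where B: "B > 0" "\<And>s. s \<in> S \<Longrightarrow> norm (s - v) \<le> B"
    unfolding bounded_pos by blast
  \<comment> \<open>The bound \<open>\<delta> / (2 * B)\<close> brings the whole link within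
    \<open>\<delta> / 2\<close> of \<open>v\<close>; the bound 1 keeps the points on the segments
    from \<open>v\<close> to the link.\<close>
  define \<epsilon> where "\<epsilon> = min 1 (\<delta> / (2 * B))"
  have \<epsilon>: "0 < \<epsilon>" "\<epsilon> \<le> 1" using \<delta>(1) B(1) by (auto simp: \<epsilon>_def)
  define m where "m s = v + \<epsilon> *\<^sub>R (s - v)" for s
  have mM: "\<exists>\<sigma>\<in>M. v \<in> \<sigma> \<and> s \<in> \<sigma> \<and> m s \<in> \<sigma>" if s: "s \<in> S" for s
  proof -
    obtain \<sigma> where \<sigma>: "\<sigma> \<in> M" "v \<in> \<sigma>" "s \<in> \<sigma>"
      using link_obtain[OF M vM, of s] s unfolding S_def by metis
    then show ?thesis using star_segment_mem[OF M vM \<sigma>] \<epsilon> unfolding m_def by (intro bexI[of _ \<sigma>]) auto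
  qed
  have mW0: "m s \<in> W0" if s: "s \<in> S" for s
  proof -
    have "\<epsilon> * norm (s - v) \<le> \<delta> / (2 * B) * B"
      using B s \<delta>(1) \<epsilon> by (intro mult_mono) (auto simp: \<epsilon>_def)
    also have "\<dots> < \<delta>" using B \<delta> by simp
    finally have "m s \<in> ball v \<delta>" using \<epsilon> by (simp add: m_def dist_norm)
    then show ?thesis using mM[OF s] by (auto simp: W0_def)
  qed
  define \<psi> where "\<psi> s = \<Phi> (m s)" for s
  have pl\<psi>: "pl_on S \<psi>"
    unfolding \<psi>_def
  proof (rule pl_on_compose[of S m "\<Union>T" \<Phi>])
    show "pl_on S m"
    proof (rule affine_fun_on_imp_pl_on[OF pl_on_ident[OF Spl]])
      have "affine_fun_on S (\<lambda>s. (v - \<epsilon> *\<^sub>R v) + \<epsilon> *\<^sub>R s)"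
        by (intro affine_fun_on_add affine_fun_on_const affine_fun_on_scaleR affine_fun_on_ident)
      then show "affine_fun_on S m" by (rule affine_fun_on_cong) (simp add: m_def algebra_simps)
    qed
    show "pl_on (\<Union>T) \<Phi>" unfolding pl_on_def using T(1) \<Phi>T by blast
    show "m ` S \<subseteq> \<Union>T" using mW0 W0W T(5) by blast
  qed
  \<comment> \<open>For \<open>t \<le> 1\<close> the point \<open>v + t *\<^sub>R (m y - v)\<close>
    stays in \<open>W0\<close>, so homogeneity and injectivity of the chart apply. Larger
    \<open>t\<close> are reduced to this by exchanging \<open>x\<close> and
    \<open>y\<close>.\<close>
  have key: "x = y" if xy: "x \<in> S" "y \<in> S" "0 < t" "t \<le> 1" "\<psi> x = t *\<^sub>R \<psi> y" for x y t
  proof -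
    have "\<Phi> (m x) = \<Phi> (v + t *\<^sub>R (m y - v))"
      using homog(1)[OF mW0[OF xy(2)], of t] xy by (simp add: \<psi>_def)
    moreover have "v + t *\<^sub>R (m y - v) \<in> U" using homog(2)[OF mW0[OF xy(2)], of t] xy W0U by auto
    moreover have "m x \<in> U" using mW0[OF xy(1)] W0U by blast
    ultimately have "m x = v + t *\<^sub>R (m y - v)" using \<Phi>inj by blast
    then have "\<epsilon> *\<^sub>R (x - v) = \<epsilon> *\<^sub>R (t *\<^sub>R (y - v))" by (simp add: m_def)
    then have "x - v = t *\<^sub>R (y - v)" using \<epsilon> by (metis less_irrefl scaleR_cancel_left)
    then show ?thesis using conic_inj_link[OF M vM] xy(1-3) unfolding conic_inj_def S_def by blast
  qed
  have cj: "conic_inj S \<psi>"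
    unfolding conic_inj_def
  proof (intro ballI allI impI)
    fix x y and t :: real
    assume xy: "x \<in> S" "y \<in> S" "0 < t" "\<psi> x = t *\<^sub>R \<psi> y"
    show "x = y"
    proof (cases "t \<le> 1")
      case True then show ?thesis using key xy by blast
    next
      case False
      have "\<psi> y = (1 / t) *\<^sub>R \<psi> x" using xy(3,4) by simp
      then show ?thesis using key[OF xy(2,1), of "1 / t"] False xy(3) by simp
    qed
  qed
  have ray1: "ray_span (\<psi> ` S) \<subseteq> span D - {0}"
  proof
    fix z assume "z \<in> ray_span (\<psi> ` S)"
    then obtain t s where ts: "t > 0" "s \<in> S" "z = t *\<^sub>R \<psi> s" unfolding ray_span_def by blast
    have "\<psi> s \<noteq> 0"
    proof
      assume "\<psi> s = 0"
      then have "m s = v" using \<Phi>inj[of "m s" v] \<Phi>v mW0[OF ts(2)] W0U vU by (auto simp: \<psi>_def)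
      then have "s = v" using \<epsilon> by (simp add: m_def)
      then show False using link_not_vertex[OF M vM] ts(2) unfolding S_def by blast
    qed
    then show "z \<in> span D - {0}" using ts \<Phi>D by (simp add: \<psi>_def span_scale)
  qed
  \<comment> \<open>The open image of the chart contains a short piece of the line through
    \<open>y\<close>, parametrised by \<open>\<gamma>\<close>. A point \<open>x\<close> mapped to a
    positive multiple of \<open>y\<close> lies on a ray from \<open>v\<close> that passes through a
    point \<open>s\<close> of the link.\<close>
  have ray2: "span D - {0} \<subseteq> ray_span (\<psi> ` S)"
  proof
    fix y assume y: "y \<in> span D - {0}"
    have "openin (top_of_set U) W0"
    proof -
      have "openin (top_of_set (\<Union>M)) W0" unfolding W0_def by (simp add: openin_open_Int)
      then show ?thesis by (rule openin_subset_trans[OF _ W0U openin_imp_subset[OF opU]])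
    qed
    then have "openin (subtopology (Euclidean_space d) V) (\<phi> ` W0)"
      using homeomorphic_imp_open_map[OF hom] unfolding open_map_def by blast
    then have opG: "openin (Euclidean_space d) (\<phi> ` W0)" using opV openin_trans_full by blast
    define \<gamma> where "\<gamma> r = (\<lambda>i. if i < d then r * (y \<bullet> b i) else 0)" for r :: real
    have "continuous_map euclideanreal (Euclidean_space d) \<gamma>"
      unfolding Euclidean_space_def continuous_map_in_subtopology continuous_map_componentwise_UNIV
      by (auto simp: \<gamma>_def intro!: continuous_intros)
    then have "openin euclideanreal {r \<in> topspace euclideanreal. \<gamma> r \<in> \<phi> ` W0}"
      using opG openin_continuous_map_preimage by blast
    then have "open {r. \<gamma> r \<in> \<phi> ` W0}" by simp
    moreover have "v \<in> W0" using \<delta>(1) T(4) O1(2) by (auto simp: W0_def)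
    then have "0 \<in> {r. \<gamma> r \<in> \<phi> ` W0}" using \<phi>v by (auto simp: \<gamma>_def image_iff intro!: bexI[of _ v])
    ultimately obtain \<eta> where \<eta>: "\<eta> > 0" "ball 0 \<eta> \<subseteq> {r. \<gamma> r \<in> \<phi> ` W0}" by (meson open_contains_ball)
    define r where "r = \<eta> / 2"
    have r: "r > 0" using \<eta> by (simp add: r_def)
    have "r \<in> ball 0 \<eta>" using \<eta> by (simp add: r_def)
    then obtain x where x: "x \<in> W0" "\<gamma> r = \<phi> x" using \<eta>(2) by blast
    have "\<Phi> x = (\<Sum>i<d. r *\<^sub>R ((y \<bullet> b i) *\<^sub>R b i))"
      unfolding \<Phi>_def x(2)[symmetric] by (simp add: \<gamma>_def)
    also have "\<dots> = r *\<^sub>R y" unfolding scaleR_sum_right[symmetric] using span_Basis_sum[OF D _ b] y by simp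
    finally have \<Phi>x: "\<Phi> x = r *\<^sub>R y" .
    then have xv: "x \<noteq> v" using \<Phi>v r y by auto
    obtain \<sigma> where \<sigma>: "\<sigma> \<in> M" "v \<in> \<sigma>" "x \<in> \<sigma>" using W0M[OF x(1)] by blast
    obtain t s where ts: "0 < t" "t \<le> 1" "s \<in> S" "x = v + t *\<^sub>R (s - v)"
      using star_cone_obtain[OF M vM \<sigma> xv] unfolding S_def by metis
    \<comment> \<open>\<open>x\<close> and \<open>m s\<close> lie on the same ray from
      \<open>v\<close>. As homogeneity is available for contractions only, the farther of the two
      points is contracted to the nearer.\<close>
    have "y = (t / (\<epsilon> * r)) *\<^sub>R \<psi> s"
    proof (cases "t \<le> \<epsilon>")
      case True
      have "x = v + (t / \<epsilon>) *\<^sub>R (m s - v)" using ts(4) \<epsilon> by (simp add: m_def)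
      then have "\<Phi> x = (t / \<epsilon>) *\<^sub>R \<psi> s"
        using homog(1)[OF mW0[OF ts(3)], of "t / \<epsilon>"] True \<epsilon> ts(1) by (simp add: \<psi>_def)
      then have "(1 / r) *\<^sub>R (r *\<^sub>R y) = (1 / r) *\<^sub>R ((t / \<epsilon>) *\<^sub>R \<psi> s)" using \<Phi>x by simp
      then show ?thesis using r by (simp add: field_simps)
    next
      case False
      have "m s = v + (\<epsilon> / t) *\<^sub>R (x - v)" using ts(1,4) by (simp add: m_def)
      then have "\<psi> s = (\<epsilon> / t) *\<^sub>R \<Phi> x"
        using homog(1)[OF x(1), of "\<epsilon> / t"] False \<epsilon> ts(1) by (simp add: \<psi>_def)
      then show ?thesis using \<Phi>x r \<epsilon> ts(1) by (simp add: field_simps)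
    qed
    moreover have "t / (\<epsilon> * r) > 0" using ts \<epsilon> r by simp
    ultimately show "y \<in> ray_span (\<psi> ` S)" unfolding ray_span_def using ts(3) by blast
  qed
  have fs: "\<psi> s \<bullet> b (d - 1) = \<epsilon> * (f s - f v)" if s: "s \<in> S" for s
  proof -
    obtain \<sigma> where \<sigma>: "\<sigma> \<in> M" "v \<in> \<sigma>" "s \<in> \<sigma>" "m s \<in> \<sigma>" using mM[OF s] by blast
    have eq: "m s = (1 - \<epsilon>) *\<^sub>R v + \<epsilon> *\<^sub>R s" by (simp add: m_def algebra_simps)
    have "f (m s) = (1 - \<epsilon>) * f v + \<epsilon> * f s"
      using affine_fun_on_segment[OF f[OF \<sigma>(1)] \<sigma>(2,3), of \<epsilon>] \<sigma>(4) eq by simp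
    moreover have "f (m s) = f v + \<phi> (m s) (d - 1)" using f\<phi> mW0[OF s] W0U by blast
    moreover have "\<psi> s \<bullet> b (d - 1) = \<phi> (m s) (d - 1)" unfolding \<psi>_def using \<Phi>b d by simp
    ultimately show ?thesis by (simp add: algebra_simps)
  qed
  show ?thesis using that[OF \<epsilon>(1) pl\<psi> cj _ fs] ray1 ray2 by blast
qed

subsection \<open>Coning\<close>

text \<open>\<open>\<alpha>\<close> recovers the cone parameter \<open>t\<close> of a point
  \<open>v + t *\<^sub>R (s - v)\<close>. Its existence expresses that \<open>v\<close> is outside
  the affine hull of \<open>R\<close>, so that affine data on \<open>R\<close> and at
  \<open>v\<close> fit together.\<close>

lemma affine_fun_on_cone:
  fixes \<Phi> h :: "'a::euclidean_space \<Rightarrow> 'b::euclidean_space"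
  assumes R: "polytope R" and h: "affine_fun_on R h"
    and \<alpha>: "affine_fun_on UNIV \<alpha>" "\<alpha> v = (0::real)" "\<And>x. x \<in> R \<Longrightarrow> \<alpha> x = 1"
    and \<Phi>v: "\<Phi> v = 0"
    and \<Phi>: "\<And>s t. s \<in> R \<Longrightarrow> 0 < t \<Longrightarrow> t \<le> 1 \<Longrightarrow> \<Phi> (v + t *\<^sub>R (s - v)) = t *\<^sub>R h s"
  shows "polytope (convex hull (insert v R))" "affine_fun_on (convex hull (insert v R)) \<Phi>"
proof -
  obtain F where F: "finite F" "R = convex hull F" using R unfolding polytope_def by blast
  have "convex hull (insert v R) = convex hull (insert v F)"
    unfolding F(2) using hull_insert[of convex v F] by simp
  moreover have "polytope (convex hull (insert v F))"
    by (rule polytope_convex_hull) (simp add: F(1))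
  ultimately show "polytope (convex hull (insert v R))" by metis
  obtain L c where L: "linear L" and hL: "\<And>x. x\<in>R \<Longrightarrow> h x = L x + c" using h unfolding affine_fun_on_def by blast
  obtain A k where A: "linear A" "\<And>x. \<alpha> x = A x + k" using \<alpha>(1) unfolding affine_fun_on_def by blast
  \<comment> \<open>At \<open>x = v + t *\<^sub>R (s - v)\<close> the value
    \<open>t *\<^sub>R h s\<close> equals \<open>L x + t *\<^sub>R (L v + c) - L v\<close>, and here
    \<open>t\<close> is \<open>\<alpha> x\<close>.\<close>
  have "affine_fun_on (convex hull (insert v R)) (\<lambda>x. (L x + \<alpha> x *\<^sub>R (L v + c)) + (- L v))"
    by (intro affine_fun_on_add affine_fun_on_const affine_fun_on_scaleR_const affine_fun_on_linear L
        affine_fun_on_subset[OF \<alpha>(1)]) auto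
  then show "affine_fun_on (convex hull (insert v R)) \<Phi>"
  proof (rule affine_fun_on_cong)
    fix x assume x: "x \<in> convex hull (insert v R)"
    show "\<Phi> x = (L x + \<alpha> x *\<^sub>R (L v + c)) + (- L v)"
    proof (cases "x = v")
      case True then show ?thesis by (simp add: \<Phi>v \<alpha>(2))
    next
      case False
      then have ne: "R \<noteq> {}" using x by auto
      have "convex R" using R polytope_imp_convex by blast
      then obtain u t s where u: "0 \<le> u" "0 \<le> t" "u + t = 1" "s \<in> R" "x = u *\<^sub>R v + t *\<^sub>R s"
        using x unfolding convex_hull_insert[OF ne] by (auto simp: hull_same)
      have u': "u = 1 - t" using u(3) by simp
      have t: "0 < t" "t \<le> 1" using u False u' by (auto simp: less_le)
      have xe: "x = v + t *\<^sub>R (s - v)" using u(5) u' by (simp add: algebra_simps)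
      have "A v + k = 0" "A s + k = 1" using A(2) \<alpha>(2) \<alpha>(3)[OF u(4)] by auto
      then have "A s - A v = 1" "A v + k = 0" by auto
      moreover have "\<alpha> x = (A v + k) + t * (A s - A v)"
        unfolding xe A(2) by (simp add: linear_add[OF A(1)] linear_cmul[OF A(1)] linear_diff[OF A(1)])
      ultimately have "\<alpha> x = t" by simp
      then show ?thesis
        using \<Phi>[OF u(4) t] hL[OF u(4)]
        by (simp add: xe linear_add[OF L] linear_cmul[OF L] linear_diff[OF L] algebra_simps)
    qed
  qed
qed

text \<open>The map of the Alexander trick. Distance from the origin is measured by the gauge
  instead of a norm, which keeps the extension PL.\<close>

definition cone_extension :: "'a::euclidean_space set \<Rightarrow> ('a \<Rightarrow> 'a) \<Rightarrow> 'a \<Rightarrow> 'a" where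
  "cone_extension D q x =
     (if x = 0 then 0 else simplex_gauge D x *\<^sub>R q ((1 / simplex_gauge D x) *\<^sub>R x))"

context
  fixes D :: "'a::euclidean_space set"
  assumes D: "D \<subseteq> Basis"
begin

lemma pl_on_model:
  "pl_on (model_simplex D) (\<lambda>x. x)" "pl_on (model_sphere D) (\<lambda>x. x)"
proof -
  show 1: "pl_on (model_simplex D) (\<lambda>x. x)"
    by (rule pl_onI[of "{model_simplex D}"])
       (use model_simplex[OF D] simplex_imp_polytope affine_fun_on_ident in auto)
  have "model_sphere D = model_simplex D \<inter> simplex_gauge D -` {1}"
    by (auto simp: model_sphere_def model_simplex_def)
  then show "pl_on (model_sphere D) (\<lambda>x. x)"
    using pl_on_vimage[OF 1 pl_on_simplex_gauge[OF D 1] polyhedron_real(3)] by simp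
qed

lemma model_sphere_obtain:
  assumes x: "x \<in> span D" "x \<noteq> 0"
  obtains s where "s \<in> model_sphere D" "x = simplex_gauge D x *\<^sub>R s" "simplex_gauge D x > 0"
proof -
  have g: "simplex_gauge D x > 0" using simplex_gauge_pos[OF D x] .
  show ?thesis
  proof (rule that[of "(1 / simplex_gauge D x) *\<^sub>R x"])
    show "(1 / simplex_gauge D x) *\<^sub>R x \<in> model_sphere D"
      using simplex_gauge_scaleR[OF D, of "1 / simplex_gauge D x" x] g x by (simp add: model_sphere_def span_scale)
  qed (use g in auto)
qed

context
  fixes q :: "'a \<Rightarrow> 'a"
  assumes q: "pl_on (model_sphere D) q" "inj_on q (model_sphere D)" "q ` model_sphere D = model_sphere D"
begin

lemma cone_extension_scaleR:
  assumes s: "s \<in> model_sphere D" and t: "t > 0"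
  shows "cone_extension D q (t *\<^sub>R s) = t *\<^sub>R q s"
proof -
  have "s \<noteq> 0" using s simplex_gauge_0[OF D] by (auto simp: model_sphere_def)
  moreover have "simplex_gauge D (t *\<^sub>R s) = t"
    using s simplex_gauge_scaleR[OF D t] by (simp add: model_sphere_def)
  ultimately show ?thesis using t by (simp add: cone_extension_def)
qed

lemma cone_extension_gauge:
  assumes x: "x \<in> span D"
  shows "simplex_gauge D (cone_extension D q x) = simplex_gauge D x" "cone_extension D q x \<in> span D"
proof -
  have "simplex_gauge D (cone_extension D q x) = simplex_gauge D x \<and> cone_extension D q x \<in> span D"
  proof (cases "x = 0")
    case False
    obtain s where s: "s \<in> model_sphere D" "x = simplex_gauge D x *\<^sub>R s" "simplex_gauge D x > 0"
      using model_sphere_obtain[OF x False] .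
    have e: "cone_extension D q x = simplex_gauge D x *\<^sub>R q s"
      using cone_extension_scaleR[OF s(1,3)] s(2) by simp
    have "q s \<in> model_sphere D" using q(3) s(1) by blast
    then show ?thesis unfolding e using simplex_gauge_scaleR[OF D s(3), of "q s"]
      by (simp add: model_sphere_def span_scale)
  qed (simp add: cone_extension_def span_zero)
  then show "simplex_gauge D (cone_extension D q x) = simplex_gauge D x" "cone_extension D q x \<in> span D"
    by auto
qed

lemma cone_extension_inj: "inj_on (cone_extension D q) (model_simplex D)"
proof (rule inj_onI)
  fix x y assume xy: "x \<in> model_simplex D" "y \<in> model_simplex D" "cone_extension D q x = cone_extension D q y"
  have sp: "x \<in> span D" "y \<in> span D" using xy by (auto simp: model_simplex_def)
  have g: "simplex_gauge D x = simplex_gauge D y"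
    using cone_extension_gauge(1)[OF sp(1)] cone_extension_gauge(1)[OF sp(2)] xy(3) by simp
  show "x = y"
  proof (cases "x = 0")
    case True
    then show ?thesis using g simplex_gauge_0[OF D] simplex_gauge_pos[OF D sp(2)] by force
  next
    case False
    then have y0: "y \<noteq> 0" using g simplex_gauge_0[OF D] simplex_gauge_pos[OF D sp(1)] by force
    obtain s where s: "s \<in> model_sphere D" "x = simplex_gauge D x *\<^sub>R s" "simplex_gauge D x > 0"
      using model_sphere_obtain[OF sp(1) False] .
    obtain s' where s': "s' \<in> model_sphere D" "y = simplex_gauge D y *\<^sub>R s'" "simplex_gauge D y > 0"
      using model_sphere_obtain[OF sp(2) y0] .
    have "simplex_gauge D x *\<^sub>R q s = simplex_gauge D x *\<^sub>R q s'"
      using cone_extension_scaleR[OF s(1,3)] cone_extension_scaleR[OF s'(1,3)] s(2) s'(2) g xy(3) by simp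
    then have "q s = q s'" using s(3) by simp
    then have "s = s'" using inj_onD[OF q(2)] s(1) s'(1) by blast
    then show ?thesis using s(2) s'(2) g by simp
  qed
qed

lemma cone_extension_image: "cone_extension D q ` model_simplex D = model_simplex D"
proof (intro equalityI subsetI)
  fix y assume "y \<in> cone_extension D q ` model_simplex D"
  then show "y \<in> model_simplex D" using cone_extension_gauge by (auto simp: model_simplex_def)
next
  fix y assume y: "y \<in> model_simplex D"
  show "y \<in> cone_extension D q ` model_simplex D"
  proof (cases "y = 0")
    case True
    then show ?thesis using y by (auto simp: cone_extension_def image_iff intro!: bexI[of _ 0])
  next
    case False
    then obtain s where s: "s \<in> model_sphere D" "y = simplex_gauge D y *\<^sub>R s" "simplex_gauge D y > 0"
      using model_sphere_obtain[of y] y by (auto simp: model_simplex_def)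
    obtain z where z: "z \<in> model_sphere D" "s = q z" using q(3) s(1) by blast
    let ?x = "simplex_gauge D y *\<^sub>R z"
    have "cone_extension D q ?x = y" using cone_extension_scaleR[OF z(1) s(3)] z(2) s(2) by simp
    moreover have "?x \<in> model_simplex D"
      using z(1) y simplex_gauge_scaleR[OF D s(3), of z] by (simp add: model_simplex_def model_sphere_def span_scale)
    ultimately show ?thesis by (metis imageI)
  qed
qed

lemma pl_on_cone_extension: "pl_on (model_simplex D) (cone_extension D q)"
proof (rule pl_onE[OF q(1)])
  fix \<P>
  assume P: "finite \<P>" "\<Union>\<P> = model_sphere D" "\<And>P. P \<in> \<P> \<Longrightarrow> polytope P" "\<And>P. P\<in>\<P> \<Longrightarrow> affine_fun_on P q"
  \<comment> \<open>Normals of the facets: the gauge is the largest of the inner products with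
    them.\<close>
  define A where "A = insert (\<Sum>i\<in>D. i) (uminus ` D)"
  have finA: "finite A" using finite_subset_Basis[OF D] by (simp add: A_def)
  have gA: "\<exists>a\<in>A. x \<bullet> a = simplex_gauge D x" for x
  proof -
    have "simplex_gauge D x \<in> insert (\<Sum>i\<in>D. x \<bullet> i) ((\<lambda>i. - (x \<bullet> i)) ` D)"
      unfolding simplex_gauge_def using finite_subset_Basis[OF D] by (intro Max_in) auto
    then show ?thesis by (auto simp: A_def inner_sum_right)
  qed
  \<comment> \<open>Intersecting a piece of the sphere with a facet hyperplane supplies the affine
    function required for coning: the inner product with \<open>a\<close> is 1 on the base and 0 at
    the apex.\<close>
  define cell where "cell = (\<lambda>(P::'a set,a). convex hull (insert 0 (P \<inter> {x. a \<bullet> x = 1})))"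
  have cell: "polytope (cell (P,a))" "affine_fun_on (cell (P,a)) (cone_extension D q)" if Pa: "P \<in> \<P>" for P a
  proof -
    let ?R = "P \<inter> {x. a \<bullet> x = 1}"
    have R: "polytope ?R" using P(3)[OF Pa] polyhedron_hyperplane polytope_Int_polyhedron by blast
    have h: "affine_fun_on ?R q" using P(4)[OF Pa] by (rule affine_fun_on_subset) auto
    have a: "affine_fun_on UNIV (\<lambda>x. a \<bullet> x)"
      by (intro affine_fun_on_linear linearI) (auto simp: inner_add_right)
    have RS: "?R \<subseteq> model_sphere D" using P(2) Pa by blast
    have c: "cone_extension D q (0 + t *\<^sub>R (s - 0)) = t *\<^sub>R q s" if "s \<in> ?R" "0 < t" "t \<le> 1" for s t
      using cone_extension_scaleR[of s t] that RS by auto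
    have z: "cone_extension D q 0 = 0" by (simp add: cone_extension_def)
    have "polytope (convex hull (insert 0 ?R)) \<and> affine_fun_on (convex hull (insert 0 ?R)) (cone_extension D q)"
      using affine_fun_on_cone[OF R h a _ _ z c] by auto
    then show "polytope (cell (P,a))" "affine_fun_on (cell (P,a)) (cone_extension D q)"
      unfolding cell_def by auto
  qed
  show ?thesis
  proof (rule pl_onI)
    \<comment> \<open>The extra piece \<open>{0}\<close> covers the origin even when the sphere is
      empty.\<close>
    show "finite (insert {0} (cell ` (\<P> \<times> A)))" using P(1) finA by simp
    show "\<Union>(insert {0} (cell ` (\<P> \<times> A))) = model_simplex D"
    proof (intro equalityI subsetI)
      fix x assume "x \<in> \<Union>(insert {0} (cell ` (\<P> \<times> A)))"
      then consider "x = 0" | Q a where "Q \<in> \<P>" "x \<in> convex hull (insert 0 (Q \<inter> {x. a \<bullet> x = 1}))"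
        unfolding cell_def by auto
      moreover have z: "0 \<in> model_simplex D" by (simp add: model_simplex_def simplex_gauge_0[OF D] span_zero)
      moreover have "convex hull (insert 0 (Q \<inter> {x. a \<bullet> x = 1})) \<subseteq> model_simplex D" if "Q \<in> \<P>" for Q a
      proof (rule hull_minimal)
        have "Q \<subseteq> model_sphere D" using P(2) that by blast
        then show "insert 0 (Q \<inter> {x. a \<bullet> x = 1}) \<subseteq> model_simplex D"
          using z by (auto simp: model_simplex_def model_sphere_def)
        show "convex (model_simplex D)" using model_simplex[OF D] convex_simplex by blast
      qed
      ultimately show "x \<in> model_simplex D" by (metis subsetD)
    next
      fix x assume x: "x \<in> model_simplex D"
      show "x \<in> \<Union>(insert {0} (cell ` (\<P> \<times> A)))"
      proof (cases "x = 0")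
        case False
        then obtain s where s: "s \<in> model_sphere D" "x = simplex_gauge D x *\<^sub>R s" "simplex_gauge D x > 0"
          using model_sphere_obtain[of x] x by (auto simp: model_simplex_def)
        obtain Q where Q: "Q \<in> \<P>" "s \<in> Q" using P(2) s(1) by blast
        obtain a where a: "a \<in> A" "s \<bullet> a = 1" using gA[of s] s(1) by (auto simp: model_sphere_def)
        let ?H = "convex hull (insert 0 (Q \<inter> {x. a \<bullet> x = 1}))"
        have "s \<in> ?H" "0 \<in> ?H" using Q a by (auto intro!: hull_inc simp: inner_commute)
        moreover have "simplex_gauge D x \<le> 1" using x by (simp add: model_simplex_def)
        ultimately have "(1 - simplex_gauge D x) *\<^sub>R 0 + simplex_gauge D x *\<^sub>R s \<in> ?H"
          using s(3) convex_convex_hull[of "insert 0 (Q \<inter> {x. a \<bullet> x = 1})"] unfolding convex_alt by force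
        then have "x \<in> cell (Q,a)" using s(2) unfolding cell_def by simp
        then show ?thesis using Q(1) a(1) by blast
      qed simp
    qed
    fix R assume "R \<in> insert {0} (cell ` (\<P> \<times> A))"
    then consider "R = {0}" | Q a where "Q \<in> \<P>" "R = cell (Q,a)" by auto
    then have "polytope R \<and> affine_fun_on R (cone_extension D q)"
    proof cases
      case 1
      have "affine_fun_on R (cone_extension D q)"
        using affine_fun_on_const[of R "cone_extension D q 0"] by (rule affine_fun_on_cong) (simp add: 1)
      then show ?thesis using 1 polytope_sing by simp
    qed (use cell in auto)
    then show "polytope R" "affine_fun_on R (cone_extension D q)" by auto
  qed
qed

end
end

subsection \<open>From an unknotted pair to a conic parametrisation\<close>

text \<open>\<open>A\<close> is lifted to the upper half of the suspension by the inverse of the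
  projection along \<open>e\<close>, and \<open>B\<close> to the lower half once its parametrisation
  has been corrected on the boundary. All values then have suspension gauge 1, so injectivity on
  rays is plain injectivity.\<close>

lemma balls_imp_conic:
  fixes D :: "'a::euclidean_space set" and hA hB :: "'a \<Rightarrow> 'a"
  assumes D: "D \<subseteq> Basis" and e: "e \<in> Basis" "e \<notin> D"
    and A: "pl_on A hA" "inj_on hA A" "hA ` A = model_simplex D"
    and B: "pl_on B hB" "inj_on hB B" "hB ` B = model_simplex D"
    and T: "A \<inter> B = T" "hA ` T = model_sphere D" "hB ` T = model_sphere D"
  obtains G where "pl_on (A \<union> B) G" "conic_inj (A \<union> B) G"
    "ray_span (G ` (A \<union> B)) = span (insert e D) - {0}"
    "\<And>x. x \<in> T \<Longrightarrow> G x \<bullet> e = 0" "\<And>x. x \<in> A - T \<Longrightarrow> G x \<bullet> e > 0" "\<And>x. x \<in> B - T \<Longrightarrow> G x \<bullet> e < 0"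
proof -
  \<comment> \<open>\<open>q\<close> is the discrepancy of the two parametrisations on the common
    boundary; its extension \<open>Q\<close> satisfies \<open>Q (hB x) = hA x\<close> on
    \<open>T\<close>.\<close>
  define q where "q y = hA (inv_into B hB y)" for y
  have TA: "T \<subseteq> A" and TB: "T \<subseteq> B" using T(1) by auto
  have inv: "inv_into B hB (hB x) = x" if "x \<in> B" for x using B(2) that by simp
  have qB: "q (hB x) = hA x" if "x \<in> B" for x by (simp add: q_def inv that)
  have q: "pl_on (model_sphere D) q" "inj_on q (model_sphere D)" "q ` model_sphere D = model_sphere D"
  proof -
    have sub: "model_sphere D \<subseteq> model_simplex D" by (auto simp: model_sphere_def model_simplex_def)
    have "pl_on (model_simplex D) (inv_into B hB)" using pl_on_inverse[OF B(1,2)] B(3) by simp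
    then have i: "pl_on (model_sphere D) (inv_into B hB)"
      by (rule pl_on_subset[OF _ pl_on_model(2)[OF D] sub])
    have im: "inv_into B hB ` model_sphere D = T"
      unfolding T(3)[symmetric] using inv TB by (auto simp: image_image subset_iff)
    then have "inv_into B hB ` model_sphere D \<subseteq> A" using TA by simp
    then show "pl_on (model_sphere D) q" unfolding q_def[abs_def] using pl_on_compose[OF i A(1)] by blast
    have "inj_on (inv_into B hB) (model_sphere D)" using B(3) sub by (simp add: inj_on_inv_into)
    moreover have "inj_on hA T" using A(2) TA inj_on_subset by blast
    ultimately have "inj_on (hA \<circ> inv_into B hB) (model_sphere D)" using im by (intro comp_inj_on) auto
    then show "inj_on q (model_sphere D)" by (simp add: q_def[abs_def] o_def)
    have "q ` model_sphere D = hA ` (inv_into B hB ` model_sphere D)"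
      unfolding q_def[abs_def] by (simp only: image_image)
    then show "q ` model_sphere D = model_sphere D" using im T(2) by simp
  qed
  define Q where "Q = cone_extension D q"
  define g where "g = simplex_gauge D"
  \<comment> \<open>\<open>1 - g\<close> is the height of the suspension above a point of the model
    simplex. Since \<open>Q\<close> preserves the gauge, \<open>g (hB x)\<close> also determines the
    height below \<open>Q (hB x)\<close>.\<close>
  define GA where "GA x = hA x + (1 + - g (hA x)) *\<^sub>R e" for x
  define GB where "GB x = Q (hB x) + (- 1 + g (hB x)) *\<^sub>R e" for x
  define G where "G x = (if x \<in> A then GA x else GB x)" for x
  have hAs: "hA x \<in> span D" "g (hA x) \<le> 1" if "x \<in> A" for x
    using A(3) that by (auto simp: model_simplex_def g_def)
  have hBs: "hB x \<in> span D" "g (hB x) \<le> 1" if "x \<in> B" for x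
    using B(3) that by (auto simp: model_simplex_def g_def)
  have Qs: "Q y \<in> span D" "g (Q y) = g y" if "y \<in> span D" for y
    using cone_extension_gauge[OF D q that] by (auto simp: Q_def g_def)
  have GA_GB: "GA x = GB x" if x: "x \<in> T" for x
  proof -
    have m: "hA x \<in> model_sphere D" "hB x \<in> model_sphere D" using T x by auto
    have "Q (hB x) = hA x"
      using cone_extension_scaleR[OF D q m(2), of 1] qB x TB unfolding Q_def by auto
    then show ?thesis using m by (simp add: GA_def GB_def g_def model_sphere_def)
  qed
  have GB: "G x = GB x" if "x \<in> B" for x using that GA_GB T(1) by (auto simp: G_def)
  have GAe: "GA x \<bullet> e = 1 - g (hA x)" if "x \<in> A" for x
    using inner_apex_span[OF D e hAs(1)[OF that]] e(1) by (simp add: GA_def inner_add_left)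
  have GBe: "GB x \<bullet> e = - (1 - g (hB x))" if "x \<in> B" for x
    using inner_apex_span[OF D e Qs(1)[OF hBs(1)[OF that]]] e(1) by (simp add: GB_def inner_add_left)
  have g1T: "g (hA x) < 1" if x: "x \<in> A" "x \<notin> T" for x
  proof (rule ccontr)
    assume "\<not> g (hA x) < 1"
    then have "hA x \<in> hA ` T" unfolding T(2) using hAs[OF x(1)] by (auto simp: model_sphere_def g_def)
    then show False using x TA A(2) by (metis (no_types, lifting) imageE inj_onD subsetD)
  qed
  have g2T: "g (hB x) < 1" if x: "x \<in> B" "x \<notin> T" for x
  proof (rule ccontr)
    assume "\<not> g (hB x) < 1"
    then have "hB x \<in> hB ` T" unfolding T(3) using hBs[OF x(1)] by (auto simp: model_sphere_def g_def)
    then show False using x TB B(2) by (metis (no_types, lifting) imageE inj_onD subsetD)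
  qed
  have GT: "G x \<bullet> e = 0" if x: "x \<in> T" for x
  proof -
    have "hA x \<in> model_sphere D" "x \<in> A" using T x by auto
    then show ?thesis using GAe[of x] by (simp add: G_def model_sphere_def g_def)
  qed
  have GpA: "G x \<bullet> e > 0" if "x \<in> A - T" for x using that GAe[of x] g1T[of x] by (simp add: G_def)
  have GpB: "G x \<bullet> e < 0" if "x \<in> B - T" for x using that GBe[of x] g2T[of x] GB[of x] by simp
  have pl: "pl_on (A \<union> B) G"
  proof (rule pl_on_Un)
    have "pl_on A GA"
      unfolding GA_def[abs_def] g_def
      by (intro pl_on_add pl_on_scaleR_const pl_on_uminus pl_on_simplex_gauge[OF D] A(1) pl_on_const[OF A(1)])
    then show "pl_on A G" by (rule pl_on_cong) (simp add: G_def)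
    have "pl_on B (\<lambda>x. Q (hB x))"
      unfolding Q_def using pl_on_compose[OF B(1) pl_on_cone_extension[OF D q]] B(3) by blast
    then have "pl_on B GB"
      unfolding GB_def[abs_def] g_def
      by (intro pl_on_add pl_on_scaleR_const pl_on_uminus pl_on_simplex_gauge[OF D] B(1) pl_on_const[OF B(1)])
    then show "pl_on B G" by (rule pl_on_cong) (simp add: GB)
  qed
  have es: "e \<in> span (insert e D)" by (simp add: span_base)
  have GE: "G x \<in> span (insert e D)" "suspension_gauge D e (G x) = 1" if x: "x \<in> A \<union> B" for x
  proof -
    have "G x \<in> span (insert e D) \<and> suspension_gauge D e (G x) = 1"
    proof (cases "x \<in> A")
      case True
      have "suspension_gauge D e (GA x) = 1"
        using GAe[OF True] hAs(2)[OF True] simplex_gauge_shift[OF D e, of "hA x"]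
        unfolding suspension_gauge_def by (simp add: GA_def g_def)
      moreover have "GA x \<in> span (insert e D)"
        unfolding GA_def using hAs(1)[OF True] span_insert_iff[OF D e] es by (intro span_add span_scale) auto
      ultimately show ?thesis using True by (simp add: G_def)
    next
      case False
      then have xB: "x \<in> B" using x by blast
      have "suspension_gauge D e (GB x) = 1"
        using GBe[OF xB] hBs[OF xB] simplex_gauge_shift[OF D e, of "Q (hB x)"] Qs(2)[OF hBs(1)[OF xB]]
        unfolding suspension_gauge_def by (simp add: GB_def g_def)
      moreover have "GB x \<in> span (insert e D)"
        unfolding GB_def using Qs(1)[OF hBs(1)[OF xB]] span_insert_iff[OF D e] es by (intro span_add span_scale) auto
      ultimately show ?thesis using GB[OF xB] by simp
    qed
    then show "G x \<in> span (insert e D)" "suspension_gauge D e (G x) = 1" by auto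
  qed
  have injA: "x = y" if xy: "x \<in> A" "y \<in> A" "G x = G y" for x y
  proof -
    have "g (hA x) = g (hA y)" using GAe[OF xy(1)] GAe[OF xy(2)] xy by (simp add: G_def)
    then have "hA x = hA y" using xy by (simp add: G_def GA_def)
    then show ?thesis using A(2) xy by (meson inj_onD)
  qed
  have injB: "x = y" if xy: "x \<in> B" "y \<in> B" "G x = G y" for x y
  proof -
    have "g (hB x) = g (hB y)" using GBe[OF xy(1)] GBe[OF xy(2)] GB[OF xy(1)] GB[OF xy(2)] xy(3) by simp
    then have "Q (hB x) = Q (hB y)" using GB[OF xy(1)] GB[OF xy(2)] xy(3) by (simp add: GB_def)
    moreover have "hB x \<in> model_simplex D" "hB y \<in> model_simplex D" using B(3) xy by auto
    ultimately have "hB x = hB y" using cone_extension_inj[OF D q] unfolding Q_def by (meson inj_onD)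
    then show ?thesis using B(2) xy by (meson inj_onD)
  qed
  have injAB: "x = y" if xy: "x \<in> A" "y \<in> B" "G x = G y" for x y
  proof (cases "x \<in> T \<or> y \<in> T")
    case True then show ?thesis using injA injB TA TB xy by blast
  next
    case False then show ?thesis using GpA[of x] GpB[of y] xy by simp
  qed
  have inj: "x = y" if "x \<in> A \<union> B" "y \<in> A \<union> B" "G x = G y" for x y
    using that injA injB injAB by (metis Un_iff)
  have ci: "conic_inj (A \<union> B) G"
    unfolding conic_inj_def
  proof (intro ballI allI impI)
    fix x y and t :: real assume xy: "x \<in> A \<union> B" "y \<in> A \<union> B" "0 < t" "G x = t *\<^sub>R G y"
    have "t = 1" using suspension_gauge_scaleR[OF D e xy(3), of "G y"] GE(2)[OF xy(1)] GE(2)[OF xy(2)] xy(4) by simp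
    then show "x = y" using inj xy by simp
  qed
  have onto: "y \<in> G ` (A \<union> B)" if y: "y \<in> span (insert e D)" "suspension_gauge D e y = 1" for y
  proof (cases "y \<bullet> e \<ge> 0")
    case True
    let ?p = "y + (- (y \<bullet> e)) *\<^sub>R e"
    have "?p \<in> (\<lambda>y. y + (- (y \<bullet> e)) *\<^sub>R e) `
        {y \<in> span (insert e D). suspension_gauge D e y = 1 \<and> 1 * (y \<bullet> e) \<ge> 0}"
      by (rule imageI) (use y True in simp)
    then have "?p \<in> model_simplex D"
      using suspension_projection(2)[OF D e, of 1] by simp
    then obtain x where x: "x \<in> A" "?p = hA x" using A(3) by (metis imageE)
    have "g ?p = g y" unfolding g_def using simplex_gauge_shift[OF D e] .
    then have "1 - g (hA x) = y \<bullet> e" using y(2) True x(2) by (simp add: suspension_gauge_def g_def)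
    then have "G x = y" using x by (simp add: G_def GA_def flip: x(2))
    then show ?thesis using x(1) by blast
  next
    case False
    let ?p = "y + (- (y \<bullet> e)) *\<^sub>R e"
    have "?p \<in> (\<lambda>y. y + (- (y \<bullet> e)) *\<^sub>R e) `
        {y \<in> span (insert e D). suspension_gauge D e y = 1 \<and> - 1 * (y \<bullet> e) \<ge> 0}"
      by (rule imageI) (use y False in simp)
    then have "?p \<in> model_simplex D"
      using suspension_projection(2)[OF D e, of "-1"] by simp
    then obtain z where z: "z \<in> model_simplex D" "?p = Q z"
      using cone_extension_image[OF D q] unfolding Q_def by (metis imageE)
    then obtain x where x: "x \<in> B" "z = hB x" using B(3) by (metis imageE)
    have "g ?p = g y" unfolding g_def using simplex_gauge_shift[OF D e] .
    moreover have "g (Q z) = g z" using Qs(2) z(1) by (simp add: model_simplex_def)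
    ultimately have "- 1 + g (hB x) = y \<bullet> e"
      using y(2) False z(2) x(2) by (simp add: suspension_gauge_def g_def)
    then have "GB x = ?p + (y \<bullet> e) *\<^sub>R e" unfolding GB_def z(2) x(2) by simp
    then have "GB x = y" by simp
    then show ?thesis using GB[OF x(1)] x(1) by (metis UnI2 image_eqI)
  qed
  have ray: "ray_span (G ` (A \<union> B)) = span (insert e D) - {0}"
  proof (intro equalityI subsetI)
    fix y assume "y \<in> ray_span (G ` (A \<union> B))"
    then obtain t x where t: "t > 0" "x \<in> A \<union> B" "y = t *\<^sub>R G x" unfolding ray_span_def by blast
    have "G x \<noteq> 0" using GE(2)[OF t(2)] suspension_gauge_0[OF D e] by auto
    then show "y \<in> span (insert e D) - {0}" using t GE(1) by (simp add: span_scale)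
  next
    fix y assume y: "y \<in> span (insert e D) - {0}"
    let ?t = "suspension_gauge D e y"
    have t: "?t > 0" using suspension_gauge_pos[OF D e] y by blast
    have "suspension_gauge D e ((1 / ?t) *\<^sub>R y) = 1"
      using suspension_gauge_scaleR[OF D e, of "1 / ?t" y] t by simp
    then have "(1 / ?t) *\<^sub>R y \<in> G ` (A \<union> B)" using onto y by (simp add: span_scale)
    moreover have "y = ?t *\<^sub>R ((1 / ?t) *\<^sub>R y)" using t by simp
    ultimately show "y \<in> ray_span (G ` (A \<union> B))" unfolding ray_span_def using t by blast
  qed
  show ?thesis by (rule that[OF pl ci ray GT GpA GpB])
qed

subsection \<open>The chart of a conic parametrisation\<close>

text \<open>A simplex \<open>\<rho>\<close> has both \<open>{v}\<close> and \<open>\<tau>\<close> as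
  faces; \<open>\<alpha>\<close> is 1 minus the barycentric coordinate of \<open>v\<close> in it,
  extended to the whole space.\<close>

lemma link_height:
  assumes M: "simplicial_complex M" and vM: "{v} \<in> M" and \<tau>: "\<tau> \<in> link M {v}"
  obtains \<alpha> :: "'a::euclidean_space \<Rightarrow> real"
  where "affine_fun_on UNIV \<alpha>" "\<alpha> v = 0" "\<And>x. x \<in> \<tau> \<Longrightarrow> \<alpha> x = 1"
proof -
  obtain \<rho> where \<rho>: "\<tau> \<in> M" "v \<notin> \<tau>" "\<rho> \<in> M" "{v} face_of \<rho>" "\<tau> face_of \<rho>"
    using \<tau> unfolding link_def by blast
  define C where "C = {s\<in>\<rho>. {s} \<in> M}"
  have C: "\<not> affine_dependent C" "\<rho> = convex hull C"
    using simplicial_complex_vertices[OF M \<rho>(3)] unfolding C_def by auto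
  have vC: "v \<in> C" using \<rho>(4) vM face_of_imp_subset unfolding C_def by blast
  obtain c where c: "c \<subseteq> C" "\<tau> = convex hull c"
    using \<rho>(5) face_of_convex_hull_affine_independent[OF C(1)] unfolding C(2) by blast
  have vc: "v \<notin> c" using \<rho>(2) c(2) hull_inc by metis
  obtain \<alpha> where \<alpha>: "affine_fun_on UNIV \<alpha>" "\<forall>x\<in>C. \<alpha> x = (if x = v then 0 else 1 :: real)"
    using affine_extension[OF C(1), of "\<lambda>x. if x = v then 0 else 1"] by blast
  have "\<alpha> x = 1" if x: "x \<in> \<tau>" for x
    by (rule affine_fun_on_hull_eq[OF affine_fun_on_subset[OF \<alpha>(1)] affine_fun_on_const, of c])
       (use \<alpha>(2) vc c x in auto)
  moreover have "\<alpha> v = 0" using \<alpha>(2) vC by simp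
  ultimately show ?thesis using that \<alpha>(1) by blast
qed

text \<open>With the chart space seen as a subspace of the space of sequences, openness and
  continuity of the chart can be proved for sets and functions.\<close>

lemma Euclidean_space_top_of_set: "Euclidean_space d = top_of_set {x. \<forall>i\<ge>d. x i = 0}"
  by (simp add: Euclidean_space_def euclidean_product_topology)

lemma conic_imp_strongly_regular:
  fixes M :: "'a::euclidean_space set set" and f :: "'a \<Rightarrow> real" and G :: "'a \<Rightarrow> 'a"
  assumes M: "simplicial_complex M" and vM: "{v} \<in> M"
    and f: "\<And>\<sigma>. \<sigma> \<in> M \<Longrightarrow> affine_fun_on \<sigma> f"
    and D: "D \<subseteq> Basis" and b: "bij_betw b {..<d} D" and d: "d > 0"
    and S: "S = \<Union>(link M {v})"
    and G: "pl_on S G" "conic_inj S G" "ray_span (G ` S) = span D - {0}"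
    and sgn: "\<And>s. s \<in> S \<Longrightarrow> sgn (f s - f v) = sgn (G s \<bullet> b (d - 1))"
  shows "strongly_regular d M f v"
proof -
  let ?e = "b (d - 1)"
  have plF: "pl_on S (\<lambda>s. f s + - f v)"
    unfolding S by (intro pl_on_add pl_on_link[OF M vM f] pl_on_const[OF pl_on_link[OF M vM f]])
  obtain K where K: "simplicial_complex K" "\<Union>K = S" "\<forall>\<sigma>\<in>K. affine_fun_on \<sigma> (\<lambda>x. (G x, f x + - f v))"
    using pl_on_Pair[OF G(1) plF] unfolding pl_on_def by blast
  have KG: "\<And>\<sigma>. \<sigma> \<in> K \<Longrightarrow> affine_fun_on \<sigma> G" and KF: "\<And>\<sigma>. \<sigma> \<in> K \<Longrightarrow> affine_fun_on \<sigma> (\<lambda>x. f x + - f v)"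
    using K(3) affine_fun_on_compose_linear[OF _ linear_fst] affine_fun_on_compose_linear[OF _ linear_snd]
    by fastforce+
  \<comment> \<open>The ratio of the wanted height to the given one, positive because the signs
    agree. Where both heights vanish, any positive weight would do.\<close>
  define \<mu> where "\<mu> s = (if f s = f v then 1 else (f s - f v) / (G s \<bullet> ?e))" for s
  have \<mu>: "\<mu> s > 0 \<and> \<mu> s * (G s \<bullet> ?e) = f s - f v" if s: "{s} \<in> K" for s
  proof -
    have "s \<in> S" using s K(2) by blast
    then have "sgn (f s - f v) = sgn (G s \<bullet> ?e)" by (rule sgn)
    then show ?thesis
      by (cases "f s - f v" "0::real" rule: linorder_cases)
         (auto simp: \<mu>_def sgn_if divide_neg_neg split: if_splits)
  qed
  have \<mu>0: "\<And>s. {s} \<in> K \<Longrightarrow> \<mu> s > 0" using \<mu> by blast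
  define h where "h = simplicial_extension K (\<lambda>s. \<mu> s *\<^sub>R G s)"
  have ch: "conic_inj S h" "ray_span (h ` S) = span D - {0}"
    using conic_inj_reweight[of K \<mu> G, OF K(1) \<mu>0 KG] G(2,3) K(2) by (auto simp: h_def)
  have Kh: "\<And>\<sigma>. \<sigma> \<in> K \<Longrightarrow> affine_fun_on \<sigma> h"
    unfolding h_def by (rule simplicial_extension(1)[OF K(1)])
  have plh: "pl_on S h" unfolding pl_on_def using K(1,2) Kh by blast
  have inner_lin: "linear (\<lambda>y. y \<bullet> ?e)" by (rule linearI) (auto simp: inner_add_left)
  have he: "h s \<bullet> ?e = f s - f v" if s: "s \<in> S" for s
  proof -
    obtain \<sigma> where \<sigma>: "\<sigma> \<in> K" "s \<in> \<sigma>" using s K(2) by blast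
    have "h s \<bullet> ?e = f s + - f v"
      by (rule simplicial_complex_affine_eq[OF K(1) \<sigma>(1) affine_fun_on_compose_linear[OF Kh[OF \<sigma>(1)] inner_lin] KF[OF \<sigma>(1)] _ \<sigma>(2)])
         (use \<mu> in \<open>simp add: h_def simplicial_extension(2)[OF K(1)]\<close>)
    then show ?thesis by simp
  qed
  have hD: "h s \<in> span D" "h s \<noteq> 0" if s: "s \<in> S" for s
  proof -
    have "1 *\<^sub>R h s \<in> ray_span (h ` S)" unfolding ray_span_def using s zero_less_one by blast
    then show "h s \<in> span D" "h s \<noteq> 0" using ch(2) by auto
  qed
  have b0: "b 0 \<in> D" using b d by (auto simp: bij_betw_def)
  have "S \<noteq> {}"
  proof
    assume "S = {}"
    then have "span D - {0} = {}" using ch(2) by (simp add: ray_span_def)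
    moreover have "b 0 \<in> span D - {0}" using b0 D nonzero_Basis by (auto intro: span_base)
    ultimately show False by blast
  qed
  then obtain s0 where s0: "s0 \<in> S" by blast
  \<comment> \<open>\<open>star r\<close> is the closed star shrunk by the factor \<open>r\<close>,
    and \<open>U\<close> is the open star. Triangulations exist on the compact sets
    \<open>star r\<close>, and those with \<open>r < 1\<close> exhaust \<open>U\<close>.\<close>
  define star where "star r = {v + t *\<^sub>R (s - v) | t s. 0 \<le> t \<and> t \<le> r \<and> s \<in> S}" for r :: real
  define U where "U = {v + t *\<^sub>R (s - v) | t s. 0 \<le> t \<and> t < 1 \<and> s \<in> S}"
  have Sv: "s \<noteq> v" if "s \<in> S" for s using link_not_vertex[OF M vM] that unfolding S by blast
  have uniq: "(t = 0 \<and> t' = 0) \<or> (s = s' \<and> t = t')"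
    if "s \<in> S" "s' \<in> S" "0 \<le> t" "0 \<le> t'" "v + t *\<^sub>R (s - v) = v + t' *\<^sub>R (s' - v)" for s s' t t'
  proof (cases "t = 0 \<or> t' = 0")
    case True
    then show ?thesis using that Sv by auto
  next
    case False
    have "s - v = (1 / t) *\<^sub>R (t *\<^sub>R (s - v))" using False by simp
    also have "\<dots> = (1 / t) *\<^sub>R (t' *\<^sub>R (s' - v))" using that(5) by simp
    finally have "s - v = (t' / t) *\<^sub>R (s' - v)" by simp
    moreover have "t' / t > 0" using False that by simp
    ultimately have "s = s'"
      using conic_inj_link[OF M vM] that(1,2) unfolding conic_inj_def S by blast
    then show ?thesis using that(5) Sv[OF that(1)] by simp
  qed
  \<comment> \<open>At \<open>x = v\<close> only \<open>t = 0\<close> is determined, not \<open>s\<close>, but \<open>t *\<^sub>R h s\<close> is still unique.\<close>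
  define \<Phi> where "\<Phi> x = (THE y. \<exists>t s. 0 \<le> t \<and> s \<in> S \<and> x = v + t *\<^sub>R (s - v) \<and> y = t *\<^sub>R h s)" for x
  have \<Phi>: "\<Phi> (v + t *\<^sub>R (s - v)) = t *\<^sub>R h s" if ts: "0 \<le> t" "s \<in> S" for t s
    unfolding \<Phi>_def
  proof (rule the_equality)
    show "\<exists>t' s'. 0 \<le> t' \<and> s' \<in> S \<and> v + t *\<^sub>R (s - v) = v + t' *\<^sub>R (s' - v) \<and> t *\<^sub>R h s = t' *\<^sub>R h s'"
      using ts by blast
  next
    fix y assume "\<exists>t' s'. 0 \<le> t' \<and> s' \<in> S \<and> v + t *\<^sub>R (s - v) = v + t' *\<^sub>R (s' - v) \<and> y = t' *\<^sub>R h s'"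
    then obtain t' s' where t': "0 \<le> t'" "s' \<in> S" "v + t *\<^sub>R (s - v) = v + t' *\<^sub>R (s' - v)" "y = t' *\<^sub>R h s'"
      by blast
    show "y = t *\<^sub>R h s" using uniq[OF ts(2) t'(2) ts(1) t'(1,3)] t'(4) by auto
  qed
  have \<Phi>v: "\<Phi> v = 0" using \<Phi>[of 0 s0] s0 by simp
  have hinj: "(t = 0 \<and> t' = 0) \<or> (s = s' \<and> t = t')"
    if "s \<in> S" "s' \<in> S" "0 \<le> t" "0 \<le> t'" "t *\<^sub>R h s = t' *\<^sub>R h s'" for s s' t t'
  proof (cases "t = 0 \<or> t' = 0")
    case True
    then show ?thesis using that hD by auto
  next
    case False
    have "h s = (1 / t) *\<^sub>R (t *\<^sub>R h s)" using False by simp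
    also have "\<dots> = (1 / t) *\<^sub>R (t' *\<^sub>R h s')" using that(5) by simp
    finally have "h s = (t' / t) *\<^sub>R h s'" by simp
    moreover have "t' / t > 0" using False that by simp
    ultimately have "s = s'" using ch(1) that(1,2) unfolding conic_inj_def by blast
    then show ?thesis using that(5) hD(2)[OF that(1)] by simp
  qed
  have \<Phi>inj: "inj_on \<Phi> (star 1)"
  proof (rule inj_onI)
    fix x y assume "x \<in> star 1" "y \<in> star 1" and eq: "\<Phi> x = \<Phi> y"
    then obtain t s t' s' where x: "x = v + t *\<^sub>R (s - v)" "0 \<le> t" "s \<in> S"
      and y: "y = v + t' *\<^sub>R (s' - v)" "0 \<le> t'" "s' \<in> S" unfolding star_def by blast
    have "t *\<^sub>R h s = t' *\<^sub>R h s'" using eq x y \<Phi> by simp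
    then show "x = y" using hinj[OF x(3) y(3) x(2) y(2)] x(1) y(1) by auto
  qed
  have \<Phi>pl: "pl_on (star r) \<Phi>" if r: "0 < r" "r \<le> 1" for r
  proof -
    \<comment> \<open>Simplices of \<open>K\<close> make \<open>h\<close> affine, those of the link
      provide a height function; their intersections have both. The cone over the shrunken copy of
      such a piece lies in the cone over the piece, where \<open>\<Phi>\<close> is affine.\<close>
    define R where "R = (\<lambda>(\<sigma>,\<tau>). \<sigma> \<inter> \<tau>) ` (K \<times> link M {v})"
    define cone where "cone X = convex hull (insert v ((\<lambda>s. v + r *\<^sub>R (s - v)) ` X))" for X
    have finR: "finite R"
    proof -
      have "link M {v} \<subseteq> M" unfolding link_def by blast
      then show ?thesis using M K(1) finite_subset unfolding R_def simplicial_complex_def by blast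
    qed
    have RS: "\<Union>R = S"
    proof
      show "\<Union>R \<subseteq> S" unfolding R_def S by auto
      show "S \<subseteq> \<Union>R"
      proof
        fix s assume s: "s \<in> S"
        then obtain \<sigma> \<tau> where "\<sigma> \<in> K" "s \<in> \<sigma>" "\<tau> \<in> link M {v}" "s \<in> \<tau>" using K(2) unfolding S by blast
        then show "s \<in> \<Union>R" unfolding R_def by (intro UnionI[of "\<sigma> \<inter> \<tau>"]) auto
      qed
    qed
    have cell: "polytope X \<and> polytope (cone X) \<and> affine_fun_on (cone X) \<Phi>" if XR: "X \<in> R" for X
    proof -
      obtain \<sigma> \<tau> where X: "\<sigma> \<in> K" "\<tau> \<in> link M {v}" "X = \<sigma> \<inter> \<tau>" using XR unfolding R_def by auto
      have "\<tau> \<in> M" using X(2) unfolding link_def by blast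
      then have pX: "polytope X"
        using X(1,3) K(1) M polytope_Int simplex_imp_polytope unfolding simplicial_complex_def by metis
      obtain \<alpha> where \<alpha>: "affine_fun_on UNIV \<alpha>" "\<alpha> v = (0::real)" "\<And>x. x \<in> \<tau> \<Longrightarrow> \<alpha> x = 1"
        by (rule link_height[OF M vM X(2)]) blast
      have aX: "affine_fun_on X h" using Kh[OF X(1)] by (rule affine_fun_on_subset) (use X(3) in auto)
      have XS: "X \<subseteq> S" using XR RS by blast
      have \<alpha>X: "\<alpha> x = 1" if "x \<in> X" for x using \<alpha>(3) that X(3) by blast
      have c: "\<Phi> (v + t *\<^sub>R (s - v)) = t *\<^sub>R h s" if "s \<in> X" "0 < t" "t \<le> 1" for s t
        using \<Phi>[of t s] that XS by auto
      have aff: "affine_fun_on (convex hull (insert v X)) \<Phi>"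
        using affine_fun_on_cone(2)[OF pX aX \<alpha>(1,2) \<alpha>X \<Phi>v c] .
      have a: "affine_fun_on X (\<lambda>s. v + r *\<^sub>R (s - v))"
      proof -
        have "affine_fun_on X (\<lambda>s. (v - r *\<^sub>R v) + r *\<^sub>R s)"
          by (intro affine_fun_on_add affine_fun_on_const affine_fun_on_scaleR affine_fun_on_ident)
        then show ?thesis by (rule affine_fun_on_cong) (simp add: algebra_simps)
      qed
      have "polytope ((\<lambda>s. v + r *\<^sub>R (s - v)) ` X)" by (rule polytope_affine_image[OF a pX])
      then obtain F where F: "finite F" "(\<lambda>s. v + r *\<^sub>R (s - v)) ` X = convex hull F" unfolding polytope_def by blast
      have "cone X = convex hull (insert v F)"
        unfolding cone_def F(2) using hull_insert[of convex v F] by simp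
      moreover have "polytope (convex hull (insert v F))" by (rule polytope_convex_hull) (simp add: F(1))
      ultimately have pc: "polytope (cone X)" by metis
      have "cone X \<subseteq> convex hull (insert v X)"
        unfolding cone_def
      proof (rule hull_minimal)
        show "insert v ((\<lambda>s. v + r *\<^sub>R (s - v)) ` X) \<subseteq> convex hull (insert v X)"
        proof -
          have "v + r *\<^sub>R (s - v) \<in> convex hull (insert v X)" if s: "s \<in> X" for s
          proof -
            have "(1 - r) *\<^sub>R v + r *\<^sub>R s \<in> convex hull (insert v X)"
              using convex_convex_hull[of "insert v X"] hull_inc[of _ "insert v X" convex] s r
              unfolding convex_alt by auto
            then show ?thesis by (simp add: algebra_simps)
          qed
          then show ?thesis by (auto intro: hull_inc)
        qed
      qed simp
      then have "affine_fun_on (cone X) \<Phi>" by (rule affine_fun_on_subset[OF aff])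
      then show ?thesis using pX pc by blast
    qed
    show ?thesis
    proof (rule pl_onI)
      show "finite (insert {v} (cone ` R))" using finR by simp
      show "\<Union>(insert {v} (cone ` R)) = star r"
      proof (intro equalityI subsetI)
        fix x assume "x \<in> \<Union>(insert {v} (cone ` R))"
        then consider "x = v" | X where "X \<in> R" "x \<in> cone X" "x \<noteq> v" by blast
        then show "x \<in> star r"
        proof cases
          case 1
          have "v = v + 0 *\<^sub>R (s0 - v)" by simp
          then show ?thesis unfolding star_def 1 using s0 r(1) less_imp_le by blast
        next
          case 2
          let ?I = "(\<lambda>s. v + r *\<^sub>R (s - v)) ` X"
          have ne: "?I \<noteq> {}" using 2 unfolding cone_def by auto
          have "convex X" using cell[OF 2(1)] polytope_imp_convex by blast
          then have cI: "convex ?I"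
          proof -
            have "convex ((\<lambda>x. (v - r *\<^sub>R v) + r *\<^sub>R x) ` X)"
              using convex_affinity[OF \<open>convex X\<close>] .
            moreover have "(\<lambda>x. (v - r *\<^sub>R v) + r *\<^sub>R x) = (\<lambda>s. v + r *\<^sub>R (s - v))"
              by (auto simp: algebra_simps)
            ultimately show ?thesis by metis
          qed
          obtain u t y where u: "0 \<le> u" "0 \<le> t" "u + t = 1" "y \<in> ?I" "x = u *\<^sub>R v + t *\<^sub>R y"
            using 2(2) unfolding cone_def convex_hull_insert[OF ne] hull_same[of convex ?I, OF cI] by blast
          obtain s where s: "s \<in> X" "y = v + r *\<^sub>R (s - v)" using u(4) by blast
          have "x = (u + t) *\<^sub>R v + (t * r) *\<^sub>R (s - v)" unfolding u(5) s(2) by (simp add: algebra_simps)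
          then have "x = v + (t * r) *\<^sub>R (s - v)" using u(3) by simp
          moreover have "0 \<le> t * r" "t * r \<le> r" using u r mult_right_mono[of t 1 r] by auto
          moreover have "s \<in> S" using s(1) 2(1) RS by blast
          ultimately show ?thesis unfolding star_def by blast
        qed
      next
        fix x assume "x \<in> star r"
        then obtain t s where x: "x = v + t *\<^sub>R (s - v)" "0 \<le> t" "t \<le> r" "s \<in> S" unfolding star_def by blast
        obtain X where X: "X \<in> R" "s \<in> X" using x(4) RS by blast
        have "v \<in> cone X" "v + r *\<^sub>R (s - v) \<in> cone X" using X(2) by (auto simp: cone_def intro!: hull_inc)
        moreover have "convex (cone X)" unfolding cone_def by simp
        ultimately have "(1 - t / r) *\<^sub>R v + (t / r) *\<^sub>R (v + r *\<^sub>R (s - v)) \<in> cone X"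
          using x(2,3) r unfolding convex_alt by auto
        moreover have "(1 - t / r) *\<^sub>R v + (t / r) *\<^sub>R (v + r *\<^sub>R (s - v)) = x"
          unfolding x(1) using r by (simp add: algebra_simps)
        ultimately have "x \<in> cone X" by simp
        then show "x \<in> \<Union>(insert {v} (cone ` R))" using X(1) by blast
      qed
      fix P assume "P \<in> insert {v} (cone ` R)"
      then consider "P = {v}" | X where "X \<in> R" "P = cone X" by blast
      then have "polytope P \<and> affine_fun_on P \<Phi>"
      proof cases
        case 1
        have "affine_fun_on P \<Phi>"
          using affine_fun_on_const[of P "\<Phi> v"] by (rule affine_fun_on_cong) (simp add: 1)
        then show ?thesis using 1 polytope_sing by simp
      qed (use cell in auto)
      then show "polytope P" "affine_fun_on P \<Phi>" by auto
    qed
  qed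
  have Ustar: "U \<subseteq> star 1" unfolding U_def star_def using less_imp_le by blast
  \<comment> \<open>An injective PL map on the compact set \<open>star 1\<close> is a homeomorphism
    onto its image, and the open star inherits this by restriction.\<close>
  obtain \<Psi> where hom1: "homeomorphism (star 1) (\<Phi> ` star 1) \<Phi> \<Psi>"
    using pl_on_homeomorphism[OF \<Phi>pl \<Phi>inj] by fastforce
  have hom: "homeomorphism U (\<Phi> ` U) \<Phi> \<Psi>"
    using homeomorphism_of_subsets[OF hom1 Ustar] Ustar by blast
  have \<Phi>E: "\<Phi> x \<in> span D" if "x \<in> U" for x
    using that unfolding U_def by (auto intro!: span_scale hD(1) simp: \<Phi>)
  have vU: "v \<in> U"
  proof -
    have "v = v + 0 *\<^sub>R (s0 - v)" by simp
    then show ?thesis unfolding U_def using s0 zero_less_one by blast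
  qed
  have opU: "openin (top_of_set (\<Union>M)) U"
  proof -
    let ?bad = "{\<rho>\<in>M. v \<notin> \<rho>}"
    have "closed (\<Union>?bad)"
    proof (rule closed_Union)
      show "finite ?bad" using M unfolding simplicial_complex_def by auto
      show "\<forall>\<sigma>\<in>?bad. closed \<sigma>" using M closed_simplex unfolding simplicial_complex_def by blast
    qed
    then have "openin (top_of_set (\<Union>M)) (\<Union>M \<inter> - \<Union>?bad)" by (intro openin_open_Int open_Compl)
    moreover have "U = \<Union>M \<inter> - \<Union>?bad"
    proof (intro equalityI subsetI)
      fix x assume "x \<in> U"
      then obtain t s where x: "x = v + t *\<^sub>R (s - v)" "0 \<le> t" "t < 1" "s \<in> S" unfolding U_def by blast
      have s: "s \<in> \<Union>(link M {v})" using x(4) S by simp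
      obtain \<sigma> where \<sigma>: "\<sigma> \<in> M" "v \<in> \<sigma>" "s \<in> \<sigma>" using link_obtain[OF M vM s] by metis
      have "x \<in> \<sigma>" unfolding x(1) using star_segment_mem[OF M vM \<sigma>] x(2,3) by simp
      moreover have "x \<notin> \<rho>" if "\<rho> \<in> M" "v \<notin> \<rho>" for \<rho>
        unfolding x(1) using star_avoids[OF M vM s x(2,3) that] .
      ultimately show "x \<in> \<Union>M \<inter> - \<Union>?bad" using \<sigma>(1) by blast
    next
      fix x assume x: "x \<in> \<Union>M \<inter> - \<Union>?bad"
      then obtain \<sigma> where \<sigma>: "\<sigma> \<in> M" "v \<in> \<sigma>" "x \<in> \<sigma>" by blast
      show "x \<in> U"
      proof (cases "x = v")
        case False
        obtain t s where ts: "0 < t" "t \<le> 1" "s \<in> \<Union>(link M {v})" "x = v + t *\<^sub>R (s - v)"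
          using star_cone_obtain[OF M vM \<sigma> False] .
        have "t \<noteq> 1"
        proof
          assume "t = 1"
          then have "x = s" using ts(4) by simp
          then obtain \<tau> where "\<tau> \<in> M" "v \<notin> \<tau>" "x \<in> \<tau>" using link_obtain[OF M vM ts(3)] by metis
          then show False using x by blast
        qed
        then have "0 \<le> t" "t < 1" "s \<in> S" using ts S by auto
        then show ?thesis unfolding U_def using ts(4) by blast
      qed (simp add: vU)
    qed
    ultimately show ?thesis by simp
  qed
  have op\<Phi>: "openin (top_of_set (span D)) (\<Phi> ` U)"
  proof -
    \<comment> \<open>The points at or beyond the image of \<open>h\<close> on their ray: the
      segment from the origin to \<open>y\<close> meets that image. The set is closed as the
      projection of a closed set along a compact interval.\<close>
    let ?Z = "{y. \<exists>u. u \<in> {0..1::real} \<and> (u, y) \<in> (\<lambda>z. fst z *\<^sub>R snd z) -` (h ` S)}"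
    have "compact (h ` S)"
      using pl_on_compact[OF plh] pl_on_continuous[OF plh] compact_continuous_image by blast
    then have "closed ((\<lambda>z. fst z *\<^sub>R snd z) -` (h ` S))"
      by (intro closed_vimage compact_imp_closed continuous_intros)
    then have "closed ?Z" by (intro closed_compact_projection) auto
    then have "openin (top_of_set (span D)) (span D \<inter> - ?Z)" by (intro openin_open_Int open_Compl)
    moreover have "\<Phi> ` U = span D \<inter> - ?Z"
    proof (intro equalityI subsetI)
      fix y assume "y \<in> \<Phi> ` U"
      then obtain x where x: "x \<in> U" "y = \<Phi> x" by blast
      then obtain t s where ts: "x = v + t *\<^sub>R (s - v)" "0 \<le> t" "t < 1" "s \<in> S" unfolding U_def by blast
      have y: "y = t *\<^sub>R h s" using x(2) ts \<Phi> by simp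
      have "u *\<^sub>R y \<noteq> h s'" if u: "0 \<le> u" "u \<le> 1" "s' \<in> S" for u s'
      proof
        assume "u *\<^sub>R y = h s'"
        then have "(u * t) *\<^sub>R h s = 1 *\<^sub>R h s'" using y by simp
        then have "u * t = 1" using hinj[OF ts(4) u(3), of "u * t" 1] u ts by auto
        moreover have "u * t \<le> 1 * t" using u ts by (intro mult_right_mono) auto
        ultimately show False using ts(3) by simp
      qed
      then show "y \<in> span D \<inter> - ?Z" using \<Phi>E[OF x(1)] x(2) by auto
    next
      fix y assume y: "y \<in> span D \<inter> - ?Z"
      show "y \<in> \<Phi> ` U"
      proof (cases "y = 0")
        case True then show ?thesis using \<Phi>v vU by (metis imageI)
      next
        case False
        then have "y \<in> ray_span (h ` S)" using y ch(2) by blast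
        then obtain t s where t: "t > 0" "s \<in> S" "y = t *\<^sub>R h s" unfolding ray_span_def by blast
        have "t < 1"
        proof (rule ccontr)
          assume t1: "\<not> t < 1"
          have "(1 / t) *\<^sub>R y \<in> h ` S" using t by simp
          then have "(1 / t, y) \<in> (\<lambda>z. fst z *\<^sub>R snd z) -` (h ` S)" by simp
          moreover have "1 / t \<in> {0..1}" using t1 by simp
          ultimately have "y \<in> ?Z" by blast
          then show False using y by blast
        qed
        then have "v + t *\<^sub>R (s - v) \<in> U" unfolding U_def using t less_imp_le by blast
        moreover have "\<Phi> (v + t *\<^sub>R (s - v)) = y" using \<Phi> t by simp
        ultimately show ?thesis by (metis imageI)
      qed
    qed
    ultimately show ?thesis by simp
  qed
  define \<phi> where "\<phi> x = (\<lambda>i. if i < d then \<Phi> x \<bullet> b i else 0)" for x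
  \<comment> \<open>\<open>J\<close> turns coordinates back into vectors of \<open>span D\<close>;
    \<open>V\<close> is open because the image of \<open>\<Phi>\<close> is open there and
    \<open>J\<close> is continuous.\<close>
  define J where "J y = (\<Sum>i<d. y i *\<^sub>R b i)" for y :: "nat \<Rightarrow> real"
  define Ed where "Ed = {x :: nat \<Rightarrow> real. \<forall>i\<ge>d. x i = 0}"
  define V where "V = Ed \<inter> J -` (\<Phi> ` U)"
  have J\<phi>: "J (\<phi> x) = \<Phi> x" if x: "x \<in> U" for x
  proof -
    have "J (\<phi> x) = (\<Sum>i<d. (\<Phi> x \<bullet> b i) *\<^sub>R b i)" unfolding J_def \<phi>_def by (intro sum.cong) auto
    then show ?thesis using span_Basis_sum[OF D \<Phi>E[OF x] b] by simp
  qed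
  have JD: "J y \<in> span D" for y
    unfolding J_def using b bij_betwE by (intro span_sum span_scale span_base) blast
  have Jc: "continuous_on A J" for A
    unfolding J_def by (intro continuous_intros continuous_on_subset[OF continuous_on_product_coordinates]) auto
  have opV: "openin (Euclidean_space d) V"
    unfolding Euclidean_space_top_of_set V_def Ed_def[symmetric]
    using continuous_openin_preimage[OF Jc _ op\<Phi>, of Ed] JD by auto
  have \<phi>J: "\<phi> (\<Psi> (J y)) = y" "\<Psi> (J y) \<in> U" if y: "y \<in> V" for y
  proof -
    obtain x where x: "x \<in> U" "J y = \<Phi> x" using y unfolding V_def by blast
    have \<Psi>x: "\<Psi> (J y) = x" using x homeomorphism_apply1[OF hom x(1)] by simp
    then show "\<Psi> (J y) \<in> U" using x by simp
    show "\<phi> (\<Psi> (J y)) = y"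
    proof
      fix i
      show "\<phi> (\<Psi> (J y)) i = y i"
        unfolding \<Psi>x \<phi>_def x(2)[symmetric]
        using sum_Basis_inner[OF D b, of i y] y by (auto simp: J_def V_def Ed_def)
    qed
  qed
  have \<phi>V: "\<phi> x \<in> V" if x: "x \<in> U" for x
    using J\<phi>[OF x] x by (auto simp: V_def Ed_def \<phi>_def)
  have \<Phi>c: "continuous_on U \<Phi>" using hom homeomorphism_def by blast
  have \<phi>c: "continuous_on U \<phi>"
  proof (rule continuous_on_coordinatewise_then_product)
    fix i
    show "continuous_on U (\<lambda>x. \<phi> x i)"
      using \<Phi>c by (cases "i < d") (auto simp: \<phi>_def intro!: continuous_intros)
  qed
  have \<Psi>c: "continuous_on V (\<lambda>y. \<Psi> (J y))"
  proof -
    have "continuous_on (\<Phi> ` U) \<Psi>" using hom homeomorphism_def by blast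
    then have "continuous_on (J ` V) \<Psi>" by (rule continuous_on_subset) (auto simp: V_def)
    then show ?thesis using continuous_on_compose[OF Jc] by (simp add: o_def)
  qed
  have sub: "subtopology (Euclidean_space d) V = top_of_set V"
    unfolding Euclidean_space_top_of_set Ed_def[symmetric]
    by (simp add: subtopology_subtopology V_def Int_absorb1 Int_assoc[symmetric])
  have "homeomorphic_maps (top_of_set U) (top_of_set V) \<phi> (\<lambda>y. \<Psi> (J y))"
    unfolding homeomorphic_maps_def
    using \<phi>c \<Psi>c \<phi>V \<phi>J J\<phi> homeomorphism_apply1[OF hom] by auto
  then have homeo: "homeomorphic_map (top_of_set U) (subtopology (Euclidean_space d) V) \<phi>"
    unfolding sub homeomorphic_map_maps by blast
  have loc: "\<exists>T W. simplicial_complex T \<and> \<Union>T \<subseteq> U \<and> openin (top_of_set U) W \<and> x \<in> W \<and> W \<subseteq> \<Union>T \<and>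
          (\<forall>\<sigma>\<in>T. \<forall>i<d. affine_fun_on \<sigma> (\<lambda>y. \<phi> y i))" if x: "x \<in> U" for x
  proof -
    obtain t s where ts: "x = v + t *\<^sub>R (s - v)" "0 \<le> t" "t < 1" "s \<in> S" using x unfolding U_def by blast
    \<comment> \<open>Midway between the parameter of \<open>x\<close> and 1, so that
      \<open>star r\<close> lies in \<open>U\<close> and has \<open>x\<close> in its interior
      relative to \<open>U\<close>.\<close>
    define r where "r = (1 + t) / 2"
    have r: "0 < r" "r < 1" "t < r" using ts by (auto simp: r_def)
    have "r \<le> 1" using r(2) by simp
    then obtain T where T: "simplicial_complex T" "\<Union>T = star r" "\<forall>\<sigma>\<in>T. affine_fun_on \<sigma> \<Phi>"
      using \<Phi>pl[OF r(1)] unfolding pl_on_def by blast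
    \<comment> \<open>These are the points of \<open>U\<close> with cone parameter below
      \<open>r\<close>, described through \<open>\<Phi>\<close> so that openness follows from that
      of its image.\<close>
    define W where "W = U \<inter> (\<lambda>x. (1 / r) *\<^sub>R \<Phi> x) -` (\<Phi> ` U)"
    have "openin (top_of_set U) W"
      unfolding W_def
      by (rule continuous_openin_preimage[OF _ _ op\<Phi>])
         (use \<Phi>c \<Phi>E in \<open>auto intro!: continuous_intros span_scale\<close>)
    moreover have "star r \<subseteq> U" unfolding star_def U_def using r(2) by force
    moreover have "x \<in> W"
    proof -
      have "\<Phi> x = t *\<^sub>R h s" using \<Phi> ts by simp
      then have "(1 / r) *\<^sub>R \<Phi> x = \<Phi> (v + (t / r) *\<^sub>R (s - v))" using \<Phi>[of "t / r" s] ts r by simp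
      moreover have "0 \<le> t / r" "t / r < 1" using ts r by auto
      then have "v + (t / r) *\<^sub>R (s - v) \<in> U" unfolding U_def using ts(4) by blast
      ultimately show ?thesis using x by (auto simp: W_def)
    qed
    moreover have "W \<subseteq> star r"
    proof
      fix y assume "y \<in> W"
      then obtain z where y: "y \<in> U" "z \<in> U" "(1 / r) *\<^sub>R \<Phi> y = \<Phi> z" unfolding W_def by auto
      obtain t1 s1 where 1: "y = v + t1 *\<^sub>R (s1 - v)" "0 \<le> t1" "s1 \<in> S" using y(1) unfolding U_def by blast
      obtain t2 s2 where 2: "z = v + t2 *\<^sub>R (s2 - v)" "0 \<le> t2" "t2 < 1" "s2 \<in> S" using y(2) unfolding U_def by blast
      have "(t1 / r) *\<^sub>R h s1 = t2 *\<^sub>R h s2" using y(3) 1 2 \<Phi> by simp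
      then have "t1 / r < 1" using hinj[OF 1(3) 2(4), of "t1 / r" t2] 1(2) 2(2,3) r by auto
      then have "t1 \<le> r" using r by simp
      then show "y \<in> star r" unfolding star_def using 1 by blast
    qed
    moreover have "affine_fun_on \<sigma> (\<lambda>y. \<phi> y i)" if \<sigma>: "\<sigma> \<in> T" and i: "i < d" for \<sigma> i
    proof -
      have lin: "linear (\<lambda>y. y \<bullet> b i)" by (rule linearI) (auto simp: inner_add_left)
      have "affine_fun_on \<sigma> \<Phi>" using T(3) \<sigma> by blast
      then have "affine_fun_on \<sigma> (\<lambda>y. \<Phi> y \<bullet> b i)" by (rule affine_fun_on_compose_linear[OF _ lin])
      then show ?thesis using i by (simp add: \<phi>_def)
    qed
    ultimately show ?thesis using T(1,2) by (intro exI[of _ T] exI[of _ W]) auto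
  qed
  have "pl_chart d (\<Union>M) U \<phi>" unfolding pl_chart_def using opU opV homeo loc by blast
  moreover have "\<phi> v = (\<lambda>_. 0)" by (auto simp: \<phi>_def \<Phi>v)
  moreover have "f x = f v + \<phi> x (d - 1)" if x: "x \<in> U" for x
  proof -
    obtain t s where ts: "x = v + t *\<^sub>R (s - v)" "0 \<le> t" "t < 1" "s \<in> S" using x unfolding U_def by blast
    have s: "s \<in> \<Union>(link M {v})" using ts(4) S by simp
    obtain \<sigma> where \<sigma>: "\<sigma> \<in> M" "v \<in> \<sigma>" "s \<in> \<sigma>" using link_obtain[OF M vM s] by metis
    have xs: "x \<in> \<sigma>" unfolding ts(1) using star_segment_mem[OF M vM \<sigma>] ts(2,3) by simp
    have xe: "x = (1 - t) *\<^sub>R v + t *\<^sub>R s" unfolding ts(1) by (simp add: algebra_simps)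
    have "f x = (1 - t) * f v + t * f s"
      using affine_fun_on_segment[OF f[OF \<sigma>(1)] \<sigma>(2,3), of t] xs unfolding xe by simp
    moreover have "\<phi> x (d - 1) = t * (h s \<bullet> ?e)" using d \<Phi>[OF ts(2,4)] by (simp add: \<phi>_def ts(1))
    ultimately show ?thesis unfolding he[OF ts(4)] by (simp add: algebra_simps)
  qed
  ultimately show ?thesis unfolding strongly_regular_def using vU by blast
qed

subsection \<open>Unknotted pairs and strong regularity\<close>

lemma aff_dim_model_simplex: "D \<subseteq> Basis \<Longrightarrow> aff_dim (model_simplex D) = int (card D)"
  using model_simplex aff_dim_simplex by blast

text \<open>By \<open>ball_boundary\<close>, \<open>h\<close> takes \<open>A - T\<close> onto the
  relative interior of the model simplex, so \<open>A - T\<close> is connected. As \<open>F\<close>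
  has no zero there, its sign is constant.\<close>

lemma ball_side:
  fixes A B D S T :: "'a::euclidean_space set" and F :: "'a \<Rightarrow> real"
  assumes D: "D \<subseteq> Basis" "card D \<ge> 1"
    and S: "pl_sphere (int (card D)) S" and T: "pl_sphere (int (card D) - 1) T"
    and A: "pl_ball (int (card D)) A" and B: "closed B" and AB: "A \<union> B = S" "A \<inter> B = T"
    and F: "continuous_on S F" "\<And>x. x \<in> S \<Longrightarrow> F x = 0 \<longleftrightarrow> x \<in> T"
  obtains h where "pl_on A h" "inj_on h A" "h ` A = model_simplex D" "h ` T = model_sphere D"
    "(\<forall>x\<in>A - T. F x > 0) \<or> (\<forall>x\<in>A - T. F x < 0)"
proof -
  obtain h where h: "pl_on A h" "inj_on h A" "h ` A = model_simplex D"
    using pl_ball_model[OF D(1) A] .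
  have hom: "homeomorphism A (model_simplex D) h (inv_into A h)"
    using pl_on_homeomorphism[OF h(1,2)] h(3) by simp
  obtain U :: "'a set" where U: "(int (card D) + 1) simplex U" "pl_homeomorphic S (rel_frontier U)"
    using S unfolding pl_sphere_def by blast
  obtain W :: "'a set" where W: "(int (card D) - 1 + 1) simplex W" "pl_homeomorphic T (rel_frontier W)"
    using T unfolding pl_sphere_def by blast
  have m: "convex (model_simplex D)" "compact (model_simplex D)"
    using model_simplex[OF D(1)] convex_simplex compact_simplex by blast+
  have hT: "h ` T = rel_frontier (model_simplex D)"
  proof (rule ball_boundary[OF _ _ _ hom m _ _ _ _ _ _ AB B])
    show "S homeomorphic rel_frontier U" "T homeomorphic rel_frontier W"
      using U(2) W(2) unfolding pl_homeomorphic_def homeomorphic_def by blast+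
    show "convex U" "bounded U" using U(1) convex_simplex compact_simplex compact_imp_bounded by blast+
    show "convex W" "bounded W" using W(1) convex_simplex compact_simplex compact_imp_bounded by blast+
    show "aff_dim U = aff_dim (model_simplex D) + 1" "aff_dim W = aff_dim (model_simplex D)"
      "1 \<le> aff_dim (model_simplex D)"
      using aff_dim_simplex[OF U(1)] aff_dim_simplex[OF W(1)] aff_dim_model_simplex[OF D(1)] D(2) by auto
  qed
  have TA: "T \<subseteq> A" using AB by blast
  have "closed (model_simplex D)" using m(2) compact_imp_closed by blast
  then have fr: "rel_frontier (model_simplex D) = model_simplex D - rel_interior (model_simplex D)"
    unfolding rel_frontier_def by simp
  have "h ` (A - T) = h ` A - h ` T" using h(2) TA by (meson inj_on_image_set_diff Diff_subset order_refl)
  also have "\<dots> = rel_interior (model_simplex D)"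
    unfolding hT h(3) fr using rel_interior_subset by blast
  finally have him: "h ` (A - T) = rel_interior (model_simplex D)" .
  have "A - T = inv_into A h ` rel_interior (model_simplex D)"
    unfolding him[symmetric] using h(2) by (force simp: image_image)
  moreover have "connected (rel_interior (model_simplex D))"
    using m(1) convex_rel_interior convex_connected by blast
  moreover have "continuous_on (rel_interior (model_simplex D)) (inv_into A h)"
    using hom rel_interior_subset continuous_on_subset unfolding homeomorphism_def by metis
  ultimately have "connected (A - T)" by (metis connected_continuous_image)
  moreover have "continuous_on (A - T) F" using F(1) AB(1) by (auto intro: continuous_on_subset)
  ultimately have con: "connected (F ` (A - T))" using connected_continuous_image by blast
  have nz: "F x \<noteq> 0" if "x \<in> A - T" for x using F(2)[of x] that AB(1) by blast
  have "(\<forall>x\<in>A - T. F x > 0) \<or> (\<forall>x\<in>A - T. F x < 0)"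
  proof (rule ccontr)
    assume "\<not> ((\<forall>x\<in>A - T. F x > 0) \<or> (\<forall>x\<in>A - T. F x < 0))"
    then obtain x y where xy: "x \<in> A - T" "y \<in> A - T" "F x < 0" "F y > 0"
      using nz by (metis linorder_neqE_linordered_idom)
    have "0 \<in> F ` (A - T)"
      by (rule connectedD_interval[OF con, of "F x" "F y"]) (use xy in auto)
    then show False using nz by auto
  qed
  then show ?thesis using that[OF h] hT rel_frontier_model_simplex[OF D(1)] by simp
qed

lemma unknotted_imp_strongly_regular:
  fixes M :: "'a::euclidean_space set set" and f :: "'a \<Rightarrow> real" and D' :: "'a set"
  assumes M: "simplicial_complex M" and vM: "{v} \<in> M"
    and f: "\<And>\<sigma>. \<sigma> \<in> M \<Longrightarrow> affine_fun_on \<sigma> f"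
    and gen: "\<And>w. {w} \<in> M \<Longrightarrow> w \<noteq> v \<Longrightarrow> f w \<noteq> f v"
    and d: "d > 1" and b: "bij_betw b {..<d} D'" "D' \<subseteq> Basis"
    and S: "S = \<Union>(link M {v})"
    and unk: "unknotted_sphere_pair (int d - 1) S (f -` {f v} \<inter> S)"
  shows "strongly_regular d M f v"
proof -
  let ?e = "b (d - 1)" and ?T = "f -` {f v} \<inter> S"
  \<comment> \<open>The last basis vector is kept apart as the axis of the suspension; the other
    \<open>d - 1\<close> carry the model of the two balls.\<close>
  define D where "D = D' - {?e}"
  have eD': "?e \<in> D'" using b(1) d by (auto simp: bij_betw_def)
  have D: "D \<subseteq> Basis" and e: "?e \<in> Basis" "?e \<notin> D" and DD: "insert ?e D = D'"
    using b(2) eD' by (auto simp: D_def)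
  have "card D' = d" using bij_betw_same_card[OF b(1)] by simp
  then have cD: "card D = d - 1" using eD' finite_subset_Basis[OF b(2)] by (simp add: D_def)
  have icD: "int (card D) = int d - 1" using cD d by simp
  obtain A B where sph: "pl_sphere (int d - 1) S" "pl_sphere (int d - 1 - 1) ?T"
    and A: "pl_ball (int d - 1) A" and B: "pl_ball (int d - 1) B" and AB: "A \<union> B = S" "A \<inter> B = ?T"
    using unk unfolding unknotted_sphere_pair_def by blast
  have BA: "B \<union> A = S" "B \<inter> A = ?T" using AB by auto
  define F where "F x = f x - f v" for x
  have Fc: "continuous_on S F"
    unfolding F_def S by (intro continuous_intros pl_on_continuous[OF pl_on_link[OF M vM f]])
  have F0: "F x = 0 \<longleftrightarrow> x \<in> ?T" if "x \<in> S" for x using that by (auto simp: F_def)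
  have c1: "card D \<ge> 1" using cD d by simp
  have closed: "closed X" if "pl_ball (int d - 1) X" for X :: "'a set"
    using pl_ball_model[OF D, of X] that icD pl_on_compact compact_imp_closed by metis
  obtain hA where hA: "pl_on A hA" "inj_on hA A" "hA ` A = model_simplex D" "hA ` ?T = model_sphere D"
    and sA: "(\<forall>x\<in>A - ?T. F x > 0) \<or> (\<forall>x\<in>A - ?T. F x < 0)"
    using ball_side[OF D c1 _ _ _ closed[OF B] AB Fc F0] sph A icD by metis
  obtain hB where hB: "pl_on B hB" "inj_on hB B" "hB ` B = model_simplex D" "hB ` ?T = model_sphere D"
    and sB: "(\<forall>x\<in>B - ?T. F x > 0) \<or> (\<forall>x\<in>B - ?T. F x < 0)"
    using ball_side[OF D c1 _ _ _ closed[OF A] BA Fc F0] sph B icD by metis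
  \<comment> \<open>This rules out two balls on the same side. As \<open>d > 1\<close>, the level
    set in the link is nonempty. One of its points lies in a link simplex, and there
    \<open>f v\<close> is a weighted mean of vertex values, all different from \<open>f v\<close>;
    such a mean needs values on both sides.\<close>
  have both: "\<exists>x\<in>S. F x > 0" "\<exists>x\<in>S. F x < 0"
  proof -
    obtain W :: "'a set" where W: "(int d - 1 - 1 + 1) simplex W" "pl_homeomorphic ?T (rel_frontier W)"
      using sph(2) unfolding pl_sphere_def by blast
    have "rel_frontier W \<noteq> {}"
    proof
      assume "rel_frontier W = {}"
      then have "affine W" by (simp add: rel_frontier_eq_empty)
      moreover have "bounded W" using W(1) compact_simplex compact_imp_bounded by blast
      ultimately have "W = {} \<or> (\<exists>a. W = {a})" using affine_bounded_eq_trivial by blast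
      then show False using aff_dim_simplex[OF W(1)] d by auto
    qed
    then have "?T \<noteq> {}" using W(2) unfolding pl_homeomorphic_def homeomorphism_def by blast
    then obtain x where x: "x \<in> S" "f x = f v" by auto
    obtain \<tau> where \<tau>: "\<tau> \<in> M" "v \<notin> \<tau>" "x \<in> \<tau>" "\<tau> \<in> link M {v}"
      using link_obtain[OF M vM, of x] x(1) unfolding S by metis
    define C where "C = {s\<in>\<tau>. {s} \<in> M}"
    have C: "\<tau> = convex hull C" "finite C" using simplicial_complex_vertices[OF M \<tau>(1)] by (auto simp: C_def)
    have CS: "C \<subseteq> S" using \<tau>(4) unfolding S C_def by blast
    have Fn: "F s \<noteq> 0" if "s \<in> C" for s using gen[of s] that \<tau>(2) by (auto simp: C_def F_def)
    obtain u where u: "\<And>s. s\<in>C \<Longrightarrow> 0 \<le> u s" "sum u C = 1" "(\<Sum>s\<in>C. u s *\<^sub>R s) = x"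
      using \<tau>(3) unfolding C(1) convex_hull_finite[OF C(2)] by blast
    have "f (\<Sum>s\<in>C. u s *\<^sub>R s) = (\<Sum>s\<in>C. u s *\<^sub>R f s)"
      by (rule affine_fun_on_convex_sum[OF f[OF \<tau>(1)] u(2)]) (use u(3) \<tau>(3) in \<open>auto simp: C_def\<close>)
    then have fx: "f v = (\<Sum>s\<in>C. u s * f s)" using u(3) x(2) by simp
    have "(\<Sum>s\<in>C. u s * F s) = (\<Sum>s\<in>C. u s * f s) - sum u C * f v"
      by (simp add: F_def algebra_simps sum_subtractf sum_distrib_left)
    then have s0: "(\<Sum>s\<in>C. u s * F s) = 0" using fx u(2) by simp
    obtain s1 where s1: "s1 \<in> C" "u s1 > 0" using u(1,2) by (metis less_eq_real_def sum.neutral zero_neq_one)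
    have pos: "\<exists>s\<in>C. F s > 0"
    proof (rule ccontr)
      assume "\<not> (\<exists>s\<in>C. F s > 0)"
      then have n: "\<And>s. s \<in> C \<Longrightarrow> F s < 0" using Fn by (metis linorder_neqE_linordered_idom)
      have "\<forall>s\<in>C. - (u s * F s) = 0"
      proof (subst sum_nonneg_eq_0_iff[OF C(2), symmetric])
        show "0 \<le> - (u s * F s)" if "s \<in> C" for s using u(1)[OF that] n[OF that] by (simp add: mult_le_0_iff)
      qed (simp add: sum_negf s0)
      then show False using s1 n[OF s1(1)] by auto
    qed
    have neg: "\<exists>s\<in>C. F s < 0"
    proof (rule ccontr)
      assume "\<not> (\<exists>s\<in>C. F s < 0)"
      then have n: "\<And>s. s \<in> C \<Longrightarrow> F s > 0" using Fn by (metis linorder_neqE_linordered_idom)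
      have "\<forall>s\<in>C. u s * F s = 0"
      proof (subst sum_nonneg_eq_0_iff[OF C(2), symmetric])
        show "0 \<le> u s * F s" if "s \<in> C" for s using u(1)[OF that] n[OF that] by simp
      qed (rule s0)
      then show False using s1 n[OF s1(1)] by auto
    qed
    show "\<exists>x\<in>S. F x > 0" "\<exists>x\<in>S. F x < 0" using pos neg CS by blast+
  qed
  \<comment> \<open>Stated for an upper ball \<open>P\<close> and a lower ball \<open>Q\<close>,
    since either of \<open>A\<close> and \<open>B\<close> may be the upper one.\<close>
  have conclude: "strongly_regular d M f v"
    if PQ: "P \<union> Q = S" "P \<inter> Q = ?T"
      and P: "pl_on P hP" "inj_on hP P" "hP ` P = model_simplex D" "hP ` ?T = model_sphere D"
      and Q: "pl_on Q hQ" "inj_on hQ Q" "hQ ` Q = model_simplex D" "hQ ` ?T = model_sphere D"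
      and sP: "\<forall>x\<in>P - ?T. F x > 0" and sQ: "\<forall>x\<in>Q - ?T. F x < 0"
    for P Q :: "'a set" and hP hQ
  proof -
    obtain G where G: "pl_on (P \<union> Q) G" "conic_inj (P \<union> Q) G"
      "ray_span (G ` (P \<union> Q)) = span (insert ?e D) - {0}"
      and G0: "\<And>x. x \<in> ?T \<Longrightarrow> G x \<bullet> ?e = 0" and G1: "\<And>x. x \<in> P - ?T \<Longrightarrow> G x \<bullet> ?e > 0"
      and G2: "\<And>x. x \<in> Q - ?T \<Longrightarrow> G x \<bullet> ?e < 0"
      by (rule balls_imp_conic[OF D e P(1-3) Q(1-3) PQ(2) P(4) Q(4)]) blast
    have "sgn (f s - f v) = sgn (G s \<bullet> ?e)" if s: "s \<in> S" for s
    proof -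
      consider "s \<in> ?T" | "s \<in> P - ?T" | "s \<in> Q - ?T" using s PQ(1) by blast
      then show ?thesis
      proof cases
        case 1 then show ?thesis using G0[OF 1] by simp
      next
        case 2
        then have "F s > 0" using sP by blast
        then show ?thesis using G1[OF 2] by (simp add: F_def)
      next
        case 3
        then have "F s < 0" using sQ by blast
        then show ?thesis using G2[OF 3] by (simp add: F_def)
      qed
    qed
    then show ?thesis
      using conic_imp_strongly_regular[OF M vM f b(2,1) _ S] G d PQ(1) DD by simp
  qed
  have FT: "F x = 0" if "x \<in> ?T" for x using that by (simp add: F_def)
  from sA show ?thesis
  proof
    assume pA: "\<forall>x\<in>A - ?T. F x > 0"
    obtain x where x: "x \<in> S" "F x < 0" using both(2) by blast
    have "x \<notin> ?T" using FT[of x] x(2) by auto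
    moreover have "x \<notin> A - ?T" using pA x(2) by (meson less_asym)
    ultimately have "x \<in> B - ?T" using AB(1) x(1) by blast
    then have "\<forall>x\<in>B - ?T. F x < 0" using sB x(2) by (meson less_asym)
    then show ?thesis by (rule conclude[OF AB hA hB pA])
  next
    assume nA: "\<forall>x\<in>A - ?T. F x < 0"
    obtain x where x: "x \<in> S" "F x > 0" using both(1) by blast
    have "x \<notin> ?T" using FT[of x] x(2) by auto
    moreover have "x \<notin> A - ?T" using nA x(2) by (meson less_asym)
    ultimately have "x \<in> B - ?T" using AB(1) x(1) by blast
    then have "\<forall>x\<in>B - ?T. F x > 0" using sB x(2) by (meson less_asym)
    then show ?thesis by (rule conclude[OF BA hB hA _ nA])
  qed
qed

theorem corollary4p3:
  fixes d :: nat
    and M :: "'a::euclidean_space set set"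
    and f :: "'a \<Rightarrow> real"
    and v :: 'a
    and a :: real
  assumes "d > 1"
    and "combinatorial_manifold d M"
    and "generic_pl M f"
    and "{v} \<in> M"
    and "f v = a"
  shows "strongly_regular d M f v \<longleftrightarrow>
         unknotted_sphere_pair (int d - 1) (\<Union>(link M {v})) (f -` {a} \<inter> \<Union>(link M {v}))"
proof -
  define S where "S = \<Union>(link M {v})"
  have M: "simplicial_complex M" using assms(2) unfolding combinatorial_manifold_def by blast
  have f: "\<And>\<sigma>. \<sigma> \<in> M \<Longrightarrow> affine_fun_on \<sigma> f" using assms(3) unfolding generic_pl_def by blast
  have sph: "pl_sphere (int d - 1) S"
  proof -
    have "pl_sphere (int d - 0 - 1) (\<Union>(link M {v}))"
      using assms(2,4) zero_simplex_sing unfolding combinatorial_manifold_def by blast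
    then show ?thesis by (simp add: S_def)
  qed
  \<comment> \<open>The model for the sphere \<open>S\<close> is the frontier of a
    \<open>d\<close>-simplex in the ambient space, which must therefore have at least
    \<open>d\<close> basis vectors to choose \<open>D\<close> from.\<close>
  obtain \<Delta> :: "'a set" where "(int d - 1 + 1) simplex \<Delta>" using sph unfolding pl_sphere_def by blast
  then have "d \<le> DIM('a)" using aff_dim_simplex aff_dim_le_DIM[of \<Delta>] by fastforce
  then obtain D where D: "D \<subseteq> (Basis :: 'a set)" "card D = d" "finite D"
    by (rule obtain_subset_with_card_n)
  then obtain b where b: "bij_betw b {..<d} D"
    using ex_bij_betw_nat_finite[OF D(3)] by (auto simp: atLeast0LessThan)
  show ?thesis
  proof
    assume reg: "strongly_regular d M f v"
    let ?e = "b (d - 1)" and ?D = "D - {b (d - 1)}"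
    obtain \<psi> :: "'a \<Rightarrow> 'a" and c where c: "c > 0" and \<psi>: "pl_on S \<psi>" "conic_inj S \<psi>" "ray_span (\<psi> ` S) = span D - {0}"
      and h: "\<And>s. s \<in> S \<Longrightarrow> \<psi> s \<bullet> ?e = c * (f s - f v)"
      by (rule strongly_regular_imp_conic[OF M assms(4) f D(1) b _ reg, folded S_def])
         (use assms(1) in auto)
    have eD: "?e \<in> D" using b assms(1) by (auto simp: bij_betw_def)
    have DD: "insert ?e ?D = D" and D': "?D \<subseteq> Basis" and e: "?e \<in> Basis" "?e \<notin> ?D" using eD D(1) by auto
    have cD: "int (card ?D) = int d - 1" using eD D(2,3) assms(1) by simp
    have sides: "{x\<in>S. \<psi> x \<bullet> ?e \<ge> 0} = {x\<in>S. f x \<ge> a}" "{x\<in>S. \<psi> x \<bullet> ?e \<le> 0} = {x\<in>S. f x \<le> a}"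
      "{x\<in>S. \<psi> x \<bullet> ?e = 0} = f -` {a} \<inter> S"
      using h c assms(5) by (auto simp: zero_le_mult_iff mult_le_0_iff)
    have "ray_span (\<psi> ` S) = span (insert ?e ?D) - {0}" using \<psi>(3) DD by simp
    note balls = conic_imp_ball_sphere[OF D' e \<psi>(1,2) this, unfolded sides cD]
    show "unknotted_sphere_pair (int d - 1) (\<Union>(link M {v})) (f -` {a} \<inter> \<Union>(link M {v}))"
      unfolding unknotted_sphere_pair_def S_def[symmetric]
    proof (intro conjI sph balls(3))
      have "{x \<in> S. a \<le> f x} \<union> {x \<in> S. f x \<le> a} = S"
        "{x \<in> S. a \<le> f x} \<inter> {x \<in> S. f x \<le> a} = f -` {a} \<inter> S"
        by auto
      then show "\<exists>A B. pl_ball (int d - 1) A \<and> pl_ball (int d - 1) B \<and> A \<union> B = S \<and> A \<inter> B = f -` {a} \<inter> S"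
        using balls(1,2) by blast
    qed auto
  next
    assume "unknotted_sphere_pair (int d - 1) (\<Union>(link M {v})) (f -` {a} \<inter> \<Union>(link M {v}))"
    then show "strongly_regular d M f v"
      using unknotted_imp_strongly_regular[OF M assms(4) f _ assms(1) b D(1) S_def]
        assms(3-5) unfolding generic_pl_def S_def by blast
  qed
qed

end
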